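(* (a) Suppose that $\mathcal{Y},\mathcal{Z}',\mathcal{Z}''\in\mathbb{M}$ satisfy $\mathcal{Y}\boxplus\mathcal{Z}'=\mathcal{Y}\boxplus\mathcal{Z}''$; then $\mathcal{Z}'=\mathcal{Z}''$. If $\mathcal{Y}\boxplus\mathcal{Z}'\le\mathcal{Y}\boxplus\mathcal{Z}''$, then $\mathcal{Z}'\le\mathcal{Z}''$. (b) Consider sequences $(\mathcal{X}_n)_{n\in\mathbb{N}}$ and $(\mathcal{Y}_n)_{n\in\mathbb{N}}$ in $\mathbb{M}$. Set $\mathcal{Z}_n:=\mathcal{X}_n\boxplus\mathcal{Y}_n$. Suppose that $\mathcal{X}:=\lim_{n\to\infty}\mathcal{X}_n$ and $\mathcal{Z}:=\lim_{n\to\infty}\mathcal{Z}_n$ exist. Then $\mathcal{Y}:=\lim_{n\to\infty}\mathcal{Y}_n$ exists and $\mathcal{Z}=\mathcal{X}\boxplus\mathcal{Y}$.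
   Context: $\mathbb{N}=\{0,1,2,\ldots\}$. A metric measure space is a triple $\mathcal{X}=(X,r_X,\mu_X)$ where $(X,r_X)$ is a complete separable metric space and $\mu_X$ is a Borel probability measure on $X$ with full support. Two such spaces are equivalent if there is an isometry from one onto the other that maps the first probability measure to the second by push-forward. $\mathbb{M}$ denotes the set of equivalence classes, and a class is not distinguished from its representatives. For $\mathcal{Y},\mathcal{Z}\in\mathbb{M}$, $\mathcal{Y}\boxplus\mathcal{Z}:=(Y\times Z,\,r_Y\oplus r_Z,\,\mu_Y\otimes\mu_Z)$ with $(r_Y\oplus r_Z)((y',z'),(y'',z''))=r_Y(y',y'')+r_Z(z',z'')$. $\mathbb{M}$ carries the topology of the Gromov–Prohorov metric $d_{\mathrm{GPr}}(\mathcal{X},\mathcal{Y}):=\inf d_{\mathrm{Pr}}^{(Z,r_Z)}(\mu_X\circ\phi_X^{-1},\mu_Y\circ\phi_Y^{-1})$, where the infimum is over all metric spaces $(Z,r_Z)$ and isometric embeddings $\phi_X:X\to Z$, $\phi_Y:Y\to Z$, and $d_{\mathrm{Pr}}^{(Z,r_Z)}$ is the Prohorov metric on probability measures on $(Z,r_Z)$; limits in $\mathbb{M}$ are with respect to $d_{\mathrm{GPr}}$. Partial order: $\mathcal{Y}\le\mathcal{Z}$ if $\mathcal{Z}=\mathcal{Y}\boxplus\mathcal{X}$ for some $\mathcal{X}\in\mathbb{M}$. *)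

theory Defs
  imports "HOL-Probability.Probability"
begin

text \<open>A metric on an arbitrary carrier together with a measure. Two elements of the type represent
  the same element of \<open>\<bbbM>\<close> iff they are related by \<open>mm_iso\<close> below; representatives may have
  points of different types.\<close>

type_synonym 'a mms = "'a metric \<times> 'a measure"

definition metric_borel :: "'a metric \<Rightarrow> 'a measure" where
  "metric_borel m = sigma (mspace m) {U. openin (mtopology_of m) U}"

definition mm_space :: "'a mms \<Rightarrow> bool" where
  "mm_space X \<longleftrightarrow>
     mcomplete_of (fst X) \<and> separable_space (mtopology_of (fst X)) \<and>
     prob_space (snd X) \<and>
     space (snd X) = mspace (fst X) \<and> sets (snd X) = sets (metric_borel (fst X)) \<and>
     (\<forall>U. openin (mtopology_of (fst X)) U \<and> U \<noteq> {} \<longrightarrow> emeasure (snd X) U > 0)"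

definition isometric_embedding :: "'a metric \<Rightarrow> 'b metric \<Rightarrow> ('a \<Rightarrow> 'b) \<Rightarrow> bool" where
  "isometric_embedding m m' f \<longleftrightarrow>
     f \<in> mspace m \<rightarrow> mspace m' \<and>
     (\<forall>x\<in>mspace m. \<forall>y\<in>mspace m. mdist m' (f x) (f y) = mdist m x y)"

definition mm_iso :: "'a mms \<Rightarrow> 'b mms \<Rightarrow> bool"  (infix "\<simeq>\<^sub>m" 50) where
  "X \<simeq>\<^sub>m Y \<longleftrightarrow>
     (\<exists>f. isometric_embedding (fst X) (fst Y) f \<and> f ` mspace (fst X) = mspace (fst Y) \<and>
          distr (snd X) (metric_borel (fst Y)) f = snd Y)"

definition sum_metric :: "'a metric \<Rightarrow> 'b metric \<Rightarrow> ('a \<times> 'b) metric" where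
  "sum_metric m1 m2 =
     metric (mspace m1 \<times> mspace m2, \<lambda>(x, y) (x', y'). mdist m1 x x' + mdist m2 y y')"

lemma Metric_space_sum_metric:
  "Metric_space (mspace m1 \<times> mspace m2) (\<lambda>(x, y) (x', y'). mdist m1 x x' + mdist m2 y y')"
proof
  fix p q r :: "'a \<times> 'b"
  show "0 \<le> (case p of (x, y) \<Rightarrow> \<lambda>(x', y'). mdist m1 x x' + mdist m2 y y') q"
    by (auto split: prod.splits)
  show "(case p of (x, y) \<Rightarrow> \<lambda>(x', y'). mdist m1 x x' + mdist m2 y y') q =
        (case q of (x, y) \<Rightarrow> \<lambda>(x', y'). mdist m1 x x' + mdist m2 y y') p"
    by (auto split: prod.splits simp: mdist_commute)
  assume p: "p \<in> mspace m1 \<times> mspace m2" and q: "q \<in> mspace m1 \<times> mspace m2"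
  show "(case p of (x, y) \<Rightarrow> \<lambda>(x', y'). mdist m1 x x' + mdist m2 y y') q = 0 \<longleftrightarrow> p = q"
    using p q by (auto simp: add_nonneg_eq_0_iff)
  assume r: "r \<in> mspace m1 \<times> mspace m2"
  obtain a b c d e f where "p = (a, b)" "q = (c, d)" "r = (e, f)"
    by (metis surj_pair)
  then show "(case p of (x, y) \<Rightarrow> \<lambda>(x', y'). mdist m1 x x' + mdist m2 y y') r \<le>
        (case p of (x, y) \<Rightarrow> \<lambda>(x', y'). mdist m1 x x' + mdist m2 y y') q +
        (case q of (x, y) \<Rightarrow> \<lambda>(x', y'). mdist m1 x x' + mdist m2 y y') r"
    using p q r mdist_triangle[of a m1 c e] mdist_triangle[of b m2 d f] by auto
qed

lemma mspace_sum_metric [simp]: "mspace (sum_metric m1 m2) = mspace m1 \<times> mspace m2"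
  by (simp add: sum_metric_def Metric_space.mspace_metric[OF Metric_space_sum_metric])

lemma mdist_sum_metric [simp]:
  "mdist (sum_metric m1 m2) = (\<lambda>(x, y) (x', y'). mdist m1 x x' + mdist m2 y y')"
  by (simp add: sum_metric_def Metric_space.mdist_metric[OF Metric_space_sum_metric])

definition boxplus :: "'a mms \<Rightarrow> 'b mms \<Rightarrow> ('a \<times> 'b) mms"  (infixl "\<boxplus>" 65) where
  "Y \<boxplus> Z = (sum_metric (fst Y) (fst Z), snd Y \<Otimes>\<^sub>M snd Z)"

text \<open>Existential quantifiers cannot range over types. By the next lemma, a separable metric
  space has at most as many points as the real line, so every element of \<open>\<bbbM>\<close> has a
  representative with points of type \<^typ>\<open>real\<close>, and a quantifier over \<open>\<bbbM>\<close> may be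
  taken over \<^typ>\<open>real mms\<close>.\<close>

lemma separable_inj_real:
  fixes m :: "'a metric"
  assumes "separable_space (mtopology_of m)"
  shows "\<exists>f :: 'a \<Rightarrow> real. inj_on f (mspace m)"
proof (cases "mspace m = {}")
  case False
  interpret Metric_space "mspace m" "mdist m"
    by simp
  have top: "mtopology_of m = mtopology"
    by (simp add: mtopology_of_def)
  obtain C where C: "countable C" "C \<subseteq> mspace m" "mtopology closure_of C = mspace m"
    using assms unfolding separable_space_def top by auto
  then have "C \<noteq> {}"
    using False by auto
  define s where "s = from_nat_into C"
  have s: "range s = C"
    unfolding s_def using C(1) \<open>C \<noteq> {}\<close> by (rule range_from_nat_into[rotated])
  define g where "g x = {n. mdist m x (s (fst (prod_decode n))) < 1 / real (Suc (snd (prod_decode n)))}" for x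
  have "inj_on g (mspace m)"
  proof (rule inj_onI, rule ccontr)
    fix x y assume x: "x \<in> mspace m" and y: "y \<in> mspace m" and eq: "g x = g y" and ne: "x \<noteq> y"
    then have "mdist m x y / 2 > 0"
      by simp
    then obtain k where k: "1 / real (Suc k) < mdist m x y / 2"
      using nat_approx_posE by metis
    have "x \<in> mtopology closure_of C"
      using x C(3) by simp
    then obtain c where c: "c \<in> C" "mdist m x c < 1 / real (Suc k)"
      unfolding metric_closure_of by (auto simp: in_mball dest!: spec[of _ "1 / real (Suc k)"])
    obtain i where i: "c = s i"
      using c(1) s by auto
    have "prod_encode (i, k) \<in> g x"
      using c i by (simp add: g_def)
    then have "prod_encode (i, k) \<in> g y"
      using eq by simp
    then have "mdist m y c < 1 / real (Suc k)"
      by (simp add: g_def i)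
    moreover have "mdist m x y \<le> mdist m x c + mdist m y c"
      using x y c(1) C(2) by (metis subsetD triangle commute)
    ultimately show False
      using c(2) k by linarith
  qed
  moreover obtain h :: "nat set \<Rightarrow> real" where "inj h"
    using nat_sets_lepoll_reals01 unfolding lepoll_def by blast
  ultimately have "inj_on (h \<circ> g) (mspace m)"
    by (meson comp_inj_on inj_on_subset subset_UNIV)
  then show ?thesis
    by blast
qed auto

definition mm_le :: "'a mms \<Rightarrow> 'b mms \<Rightarrow> bool"  (infix "\<le>\<^sub>m" 50) where
  "Y \<le>\<^sub>m Z \<longleftrightarrow> (\<exists>X :: real mms. mm_space X \<and> Z \<simeq>\<^sub>m Y \<boxplus> X)"

definition prohorov_dist :: "'a metric \<Rightarrow> 'a measure \<Rightarrow> 'a measure \<Rightarrow> real" where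
  "prohorov_dist m \<mu> \<nu> = Inf {\<epsilon>. \<epsilon> > 0 \<and>
     (\<forall>A\<in>sets (metric_borel m).
        let A\<epsilon> = \<Union>a\<in>A. mball_of m a \<epsilon> in
          measure \<mu> A \<le> measure \<nu> A\<epsilon> + \<epsilon> \<and> measure \<nu> A \<le> measure \<mu> A\<epsilon> + \<epsilon>)}"

text \<open>The ambient space may be replaced by the union of the images of the two embeddings without
  changing the Prohorov distance: the images are closed, being complete. This union is separable,
  so again points of type \<^typ>\<open>real\<close> suffice.\<close>

definition GPr_dist :: "'a mms \<Rightarrow> 'b mms \<Rightarrow> real" where
  "GPr_dist X Y = Inf {prohorov_dist Z (distr (snd X) (metric_borel Z) f)
                                       (distr (snd Y) (metric_borel Z) g) |
     (Z :: real metric) f g. isometric_embedding (fst X) Z f \<and> isometric_embedding (fst Y) Z g}"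

definition GPr_lim :: "(nat \<Rightarrow> 'a mms) \<Rightarrow> 'b mms \<Rightarrow> bool" where
  "GPr_lim Xs X \<longleftrightarrow> (\<lambda>n. GPr_dist (Xs n) X) \<longlonglongrightarrow> 0"

end

theory Submission
  imports Defs "HOL-Library.Diagonal_Subsequence"
begin

text \<open>For a finite multigraph with edge list \<open>es\<close> on \<open>k\<close> vertices let \<open>semichar X k es\<close> be the expectation
  of \<open>exp (- \<Sum> r\<^sub>X (\<xi>\<^sub>i, \<xi>\<^sub>j))\<close>, the sum over the edges \<open>(i, j)\<close>, for independent samples \<open>\<xi>\<^sub>1, \<dots>, \<xi>\<^sub>k\<close>
  of \<open>\<mu>\<^sub>X\<close>. A sample of \<open>Y \<boxplus> Z\<close> is a pair of independent samples whose distances add up, so these numbers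
  are multiplicative (\<open>semichar_boxplus\<close>). They are strictly positive (\<open>semichar_pos\<close>), continuous in the
  Gromov--Prohorov distance (\<open>semichar_tendsto\<close>), and jointly they determine a space up to
  isomorphism (\<open>semichar_eq_imp_iso\<close>). Part (a) follows by dividing by the semicharacters of \<open>Y\<close>.

  For part (b) it is enough that every subsequence of \<open>Y\<^sub>n\<close> has a further subsequence with some limit
  \<open>U\<close>: the semicharacters of \<open>U\<close> are then the quotients of those of \<open>Z\<close> by those of \<open>X\<close>, so \<open>Z\<close> is isomorphic
  to \<open>X \<boxplus> U\<close>, and \<open>U\<close> is the same for all subsequences. The limit \<open>U\<close> is found as a quotient of \<open>Z\<close>
  (\<open>summand_limit_subsequence\<close>). Take a dense sequence \<open>q\<^sub>i\<close> in \<open>Z\<close> and points \<open>p\<^sub>i\<^sup>n\<close> of \<open>Z\<^sub>n\<close> that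
  converge to \<open>q\<^sub>i\<close>. The distances in \<open>Y\<^sub>n\<close> of the projections of \<open>p\<^sub>i\<^sup>n\<close> and \<open>p\<^sub>j\<^sup>n\<close> are asymptotically at most
  \<open>r\<^sub>Z (q\<^sub>i, q\<^sub>j)\<close>; along a subsequence they converge to a pseudometric on the indices. Its completion
  receives a 1-Lipschitz map from \<open>Z\<close>, and \<open>U\<close> carries the image of \<open>\<mu>\<^sub>Z\<close>.

  The reconstruction theorem compares, for points \<open>x\<^sub>1, x\<^sub>2, \<dots>\<close> of \<open>X\<close>, the mutual distances together with
  the numbers \<open>\<integral> exp (- \<Sum> r\<^sub>X (x\<^sub>i, \<xi>)) d\<mu>\<^sub>X(\<xi>)\<close>, which describe the joint law of the distances
  to a random point. The semicharacters are the joint moments of these functionals under random choice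
  of the \<open>x\<^sub>i\<close>. Hence every finite configuration in \<open>X\<close> is matched up to any error by one in \<open>Y\<close>
  (\<open>profile_approximation\<close>), and a compactness argument matches a dense sequence of \<open>X\<close> exactly
  (\<open>profile_copy_exists\<close>). The resulting correspondence extends to an isometry that preserves the
  measures.\<close>

section \<open>Metric measure spaces in terms of distances\<close>

abbreviation points :: "'a mms \<Rightarrow> 'a set" where
  "points X \<equiv> mspace (fst X)"

abbreviation rdist :: "'a mms \<Rightarrow> 'a \<Rightarrow> 'a \<Rightarrow> real" where
  "rdist X \<equiv> mdist (fst X)"

abbreviation rball :: "'a mms \<Rightarrow> 'a \<Rightarrow> real \<Rightarrow> 'a set" where
  "rball X \<equiv> mball_of (fst X)"

abbreviation mass :: "'a mms \<Rightarrow> 'a set \<Rightarrow> real" where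
  "mass X \<equiv> measure (snd X)"

text \<open>Separability is used through an enumerated dense set. Repetitions are harmless, and the indices
  serve later for diagonal arguments.\<close>

definition dense_seq :: "'a metric \<Rightarrow> (nat \<Rightarrow> 'a) \<Rightarrow> bool" where
  "dense_seq m q \<longleftrightarrow> (\<forall>i. q i \<in> mspace m) \<and> (\<forall>x\<in>mspace m. \<forall>e>0. \<exists>i. mdist m x (q i) < e)"

lemma mdist_self: "x \<in> mspace m \<Longrightarrow> mdist m x x = 0"
  by simp

lemma openin_mtopology_of_iff:
  "openin (mtopology_of m) U \<longleftrightarrow>
     U \<subseteq> mspace m \<and> (\<forall>x\<in>U. \<exists>e>0. \<forall>y\<in>mspace m. mdist m x y < e \<longrightarrow> y \<in> U)"
proof -
  interpret Metric_space "mspace m" "mdist m" by simp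
  have "mball x e \<subseteq> U \<longleftrightarrow> (\<forall>y\<in>mspace m. mdist m x y < e \<longrightarrow> y \<in> U)" if "x \<in> mspace m" for x e
    using that by auto
  then show ?thesis
    unfolding mtopology_of_def openin_mtopology by (smt (verit) subsetD)
qed

lemma openin_ball [simp]: "openin (mtopology_of m) (mball_of m x e)"
  by (simp add: mball_of_def mtopology_of_def Metric_space.openin_mball)

lemma space_metric_borel [simp]: "space (metric_borel m) = mspace m"
  unfolding metric_borel_def by (rule space_measure_of) (auto simp: openin_mtopology_of_iff)

lemma sets_metric_borel:
  "sets (metric_borel m) = sigma_sets (mspace m) {U. openin (mtopology_of m) U}"
  unfolding metric_borel_def by (rule sets_measure_of) (auto simp: openin_mtopology_of_iff)

lemma open_in_metric_borel: "openin (mtopology_of m) U \<Longrightarrow> U \<in> sets (metric_borel m)"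
  by (simp add: sets_metric_borel sigma_sets.Basic)

text \<open>All maps between metric spaces below are 1-Lipschitz (short), which makes their measurability
  immediate.\<close>

lemma short_map_measurable:
  assumes "f \<in> mspace m \<rightarrow> mspace m'"
    and "\<And>x y. x \<in> mspace m \<Longrightarrow> y \<in> mspace m \<Longrightarrow> mdist m' (f x) (f y) \<le> mdist m x y"
  shows "f \<in> measurable (metric_borel m) (metric_borel m')"
  unfolding metric_borel_def[of m']
proof (rule measurable_measure_of)
  fix U assume "U \<in> {U. openin (mtopology_of m') U}"
  then have U: "U \<subseteq> mspace m'" "\<And>x. x \<in> U \<Longrightarrow> \<exists>e>0. \<forall>y\<in>mspace m'. mdist m' x y < e \<longrightarrow> y \<in> U"
    by (auto simp: openin_mtopology_of_iff)
  have "openin (mtopology_of m) (f -` U \<inter> mspace m)"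
    unfolding openin_mtopology_of_iff
  proof (intro conjI ballI)
    fix x assume x: "x \<in> f -` U \<inter> mspace m"
    then obtain e where e: "e > 0" "\<And>y. y \<in> mspace m' \<Longrightarrow> mdist m' (f x) y < e \<Longrightarrow> y \<in> U"
      using U(2)[of "f x"] by auto
    then show "\<exists>e>0. \<forall>y\<in>mspace m. mdist m x y < e \<longrightarrow> y \<in> f -` U \<inter> mspace m"
      using x assms by (intro exI[of _ e]) (force dest: le_less_trans)
  qed auto
  then show "f -` U \<inter> space (metric_borel m) \<in> sets (metric_borel m)"
    by (simp add: open_in_metric_borel)
qed (use assms in \<open>auto simp: openin_mtopology_of_iff\<close>)

lemma mcomplete_ofI:
  assumes "\<And>\<sigma>. \<lbrakk>\<And>n. \<sigma> n \<in> mspace m; \<And>e. e > 0 \<Longrightarrow> \<exists>N. \<forall>i\<ge>N. \<forall>j\<ge>N. mdist m (\<sigma> i) (\<sigma> j) < e\<rbrakk>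
      \<Longrightarrow> \<exists>l\<in>mspace m. (\<lambda>n. mdist m (\<sigma> n) l) \<longlonglongrightarrow> 0"
  shows "mcomplete_of m"
proof -
  interpret Metric_space "mspace m" "mdist m" by simp
  show ?thesis
    unfolding mcomplete_of_def mcomplete_def
  proof (intro allI impI)
    fix \<sigma> assume s: "MCauchy \<sigma>"
    then obtain l where "l \<in> mspace m" "(\<lambda>n. mdist m (\<sigma> n) l) \<longlonglongrightarrow> 0"
      using assms[of \<sigma>] by (auto simp: MCauchy_def)
    then show "\<exists>x. limitin mtopology \<sigma> x sequentially"
      using s by (auto simp: limitin_metric_dist_null MCauchy_def intro!: always_eventually)
  qed
qed

lemma mcomplete_ofD:
  assumes "mcomplete_of m" "\<And>n. \<sigma> n \<in> mspace m"
    and "\<And>e. e > 0 \<Longrightarrow> \<exists>N. \<forall>i\<ge>N. \<forall>j\<ge>N. mdist m (\<sigma> i) (\<sigma> j) < e"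
  obtains l where "l \<in> mspace m" "(\<lambda>n. mdist m (\<sigma> n) l) \<longlonglongrightarrow> 0"
proof -
  interpret Metric_space "mspace m" "mdist m" by simp
  have "MCauchy \<sigma>"
    using assms by (auto simp: MCauchy_def)
  then show ?thesis
    using assms(1) that by (auto simp: mcomplete_of_def mcomplete_def limitin_metric_dist_null)
qed

lemma dense_seq_exists:
  assumes "separable_space (mtopology_of m)" "mspace m \<noteq> {}"
  obtains q where "dense_seq m q"
proof -
  interpret Metric_space "mspace m" "mdist m" by simp
  obtain C where C: "countable C" "C \<subseteq> mspace m" "mtopology closure_of C = mspace m"
    using assms(1) unfolding separable_space_def mtopology_of_def by auto
  then have ne: "C \<noteq> {}"
    using assms(2) by auto
  have "\<exists>i. mdist m x (from_nat_into C i) < e" if "x \<in> mspace m" "e > 0" for x e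
  proof -
    have "x \<in> mtopology closure_of C"
      using that C by simp
    then obtain c where "c \<in> C" "mdist m x c < e"
      using \<open>e > 0\<close> unfolding metric_closure_of by auto
    then show ?thesis
      using range_from_nat_into[OF ne C(1)] by (metis imageE)
  qed
  then have "dense_seq m (from_nat_into C)"
    using C(2) from_nat_into[OF ne] by (auto simp: dense_seq_def)
  then show ?thesis
    by (rule that)
qed

lemma dense_seq_separable:
  assumes "dense_seq m q"
  shows "separable_space (mtopology_of m)"
proof -
  interpret Metric_space "mspace m" "mdist m" by simp
  have "mtopology closure_of range q = mspace m"
    using assms unfolding metric_closure_of dense_seq_def by auto
  then show ?thesis
    using assms unfolding separable_space_def mtopology_of_def dense_seq_def
    by (intro exI[of _ "range q"]) auto
qed

lemma mm_spaceD:
  assumes "mm_space X"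
  shows "mcomplete_of (fst X)" "separable_space (mtopology_of (fst X))" "prob_space (snd X)"
    "space (snd X) = points X" "sets (snd X) = sets (metric_borel (fst X))"
  using assms by (auto simp: mm_space_def)

lemma mm_space_nonempty: "mm_space X \<Longrightarrow> points X \<noteq> {}"
  using mm_spaceD(3,4) prob_space.not_empty by metis

lemma mm_space_dense_seq:
  assumes "mm_space X"
  obtains q where "dense_seq (fst X) q"
  using dense_seq_exists[OF mm_spaceD(2)[OF assms] mm_space_nonempty[OF assms]] .

lemma mm_space_open_sets:
  "mm_space X \<Longrightarrow> openin (mtopology_of (fst X)) U \<Longrightarrow> U \<in> sets (snd X)"
  by (simp add: mm_spaceD open_in_metric_borel)

lemma mm_space_ball_sets: "mm_space X \<Longrightarrow> rball X x e \<in> sets (snd X)"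
  by (simp add: mm_space_open_sets)

lemma mm_space_open_pos:
  assumes "mm_space X" "openin (mtopology_of (fst X)) U" "U \<noteq> {}"
  shows "mass X U > 0"
proof -
  interpret prob_space "snd X" using assms(1) by (rule mm_spaceD)
  show ?thesis
    using assms unfolding mm_space_def by (auto simp: emeasure_eq_measure)
qed

lemma mm_space_ball_pos:
  assumes "mm_space X" "x \<in> points X" "e > 0"
  shows "mass X (rball X x e) > 0"
proof -
  have "x \<in> rball X x e"
    using assms by (simp add: mdist_self)
  then show ?thesis
    by (intro mm_space_open_pos) (use assms in auto)
qed

lemma mm_spaceI:
  assumes "mcomplete_of (fst X)" "dense_seq (fst X) q" "prob_space (snd X)"
    and "space (snd X) = points X" "sets (snd X) = sets (metric_borel (fst X))"
    and "\<And>x e. x \<in> points X \<Longrightarrow> e > 0 \<Longrightarrow> mass X (rball X x e) > 0"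
  shows "mm_space X"
  unfolding mm_space_def
proof (intro conjI allI impI)
  interpret prob_space "snd X" by fact
  fix U assume U: "openin (mtopology_of (fst X)) U \<and> U \<noteq> {}"
  then obtain x e where x: "x \<in> U" "e > 0" "\<And>y. y \<in> points X \<Longrightarrow> rdist X x y < e \<Longrightarrow> y \<in> U"
    unfolding openin_mtopology_of_iff by blast
  have "rball X x e \<subseteq> U"
    using x by auto
  moreover have "U \<in> sets (snd X)"
    using U assms(5) open_in_metric_borel by blast
  moreover have "x \<in> points X"
    using x U by (auto simp: openin_mtopology_of_iff)
  ultimately have "0 < mass X U"
    using assms(6)[of x e] x finite_measure_mono[of "rball X x e" U] by linarith
  then show "0 < emeasure (snd X) U"
    by (simp add: emeasure_eq_measure)
qed (use assms dense_seq_separable in auto)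

text \<open>By separability, the distance is measurable for the product \<open>\<sigma>\<close>-algebra: two points are closer
  than \<open>a\<close> iff some member of the dense sequence has distances to them below \<open>r\<close> and \<open>a - r\<close> for a rational \<open>r\<close>.\<close>

lemma measurable_mdist:
  assumes X: "mm_space X" and f: "f \<in> measurable N (snd X)" and g: "g \<in> measurable N (snd X)"
  shows "(\<lambda>w. rdist X (f w) (g w)) \<in> borel_measurable N"
proof -
  let ?m = "fst X"
  obtain q where q: "dense_seq ?m q"
    using mm_space_dense_seq[OF X] .
  have sp: "f w \<in> mspace ?m" "g w \<in> mspace ?m" if "w \<in> space N" for w
    using measurable_space[OF f that] measurable_space[OF g that] mm_spaceD(4)[OF X] by auto
  have q': "q i \<in> mspace ?m" for i
    using q by (simp add: dense_seq_def)
  have "{w \<in> space N. mdist ?m (f w) (g w) < a} =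
      (\<Union>i. \<Union>r\<in>\<rat>. (f -` mball_of ?m (q i) r \<inter> space N) \<inter> (g -` mball_of ?m (q i) (a - r) \<inter> space N))"
    (is "?L = ?R") for a
  proof (intro subset_antisym subsetI)
    fix w assume "w \<in> ?L"
    then have w: "w \<in> space N" "mdist ?m (f w) (g w) < a" by auto
    define h where "h = (a - mdist ?m (f w) (g w)) / 3"
    have h: "h > 0" using w by (simp add: h_def)
    obtain i where i: "mdist ?m (f w) (q i) < h"
      using q sp(1)[OF w(1)] h unfolding dense_seq_def by blast
    obtain r where r: "r \<in> \<rat>" "h < r" "r < h + h"
      using Rats_dense_in_real[of h "h + h"] h by auto
    have "mdist ?m (q i) (g w) \<le> mdist ?m (q i) (f w) + mdist ?m (f w) (g w)"
      using sp w(1) q' by (intro mdist_triangle) auto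
    then have "mdist ?m (q i) (g w) < a - r"
      using i r unfolding h_def by (simp add: mdist_commute field_simps)
    then show "w \<in> ?R"
      using i r w(1) sp q' by (intro UN_I[of i] UN_I[of r]) (auto simp: mdist_commute)
  next
    fix w assume "w \<in> ?R"
    then obtain i r where i: "w \<in> space N" "mdist ?m (q i) (f w) < r" "mdist ?m (q i) (g w) < a - r"
      by auto
    moreover have "mdist ?m (f w) (g w) \<le> mdist ?m (f w) (q i) + mdist ?m (q i) (g w)"
      using sp i(1) q' by (intro mdist_triangle) auto
    ultimately show "w \<in> ?L"
      by (simp add: mdist_commute)
  qed
  moreover have "?R a \<in> sets N" for a :: real
    using countable_rat
    by (intro sets.countable_UN'' sets.Int measurable_sets[OF f] measurable_sets[OF g] mm_space_ball_sets[OF X]) auto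
  ultimately show ?thesis
    by (simp add: borel_measurable_iff_less)
qed

lemma measurable_mdist_const:
  assumes "mm_space X" "c \<in> points X"
  shows "(\<lambda>x. rdist X c x) \<in> borel_measurable (snd X)"
  using assms by (intro measurable_mdist) (auto simp: mm_spaceD)

text \<open>Tightness of a single measure, by continuity from below along the balls around a dense sequence.\<close>

lemma mm_space_net:
  assumes X: "mm_space X" and q: "dense_seq (fst X) q" and "e > 0" "h > 0"
  obtains K :: nat where
    "mass X (points X - (\<Union>i<K. rball X (q i) e)) < h"
proof -
  interpret prob_space "snd X" using X by (rule mm_spaceD)
  let ?B = "\<lambda>i. rball X (q i) e"
  have "(\<lambda>K. mass X (\<Union>i<K. ?B i)) \<longlonglongrightarrow> mass X (\<Union>K. \<Union>i<K. ?B i)"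
    using mm_space_ball_sets[OF X]
    by (intro finite_Lim_measure_incseq) (auto simp: incseq_def intro: less_le_trans)
  moreover have "(\<Union>K. \<Union>i<K. ?B i) = space (snd X)"
    using q \<open>e > 0\<close> mm_spaceD(4)[OF X] unfolding dense_seq_def
    by (auto simp: mdist_commute) (meson lessI lessThan_iff)
  ultimately have "(\<lambda>K. mass X (\<Union>i<K. ?B i)) \<longlonglongrightarrow> 1"
    by (simp add: prob_space)
  then have "eventually (\<lambda>K. mass X (\<Union>i<K. ?B i) > 1 - h) sequentially"
    using \<open>h > 0\<close> by (intro order_tendstoD) auto
  then obtain K where "mass X (\<Union>i<K. ?B i) > 1 - h"
    by (auto simp: eventually_sequentially)
  moreover have "mass X (space (snd X) - (\<Union>i<K. ?B i)) = 1 - mass X (\<Union>i<K. ?B i)"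
    using mm_space_ball_sets[OF X] by (intro prob_compl) auto
  ultimately show ?thesis
    using that[of K] mm_spaceD(4)[OF X] by simp
qed

section \<open>The sum of two spaces\<close>

lemma dense_seq_sum_metric:
  assumes "dense_seq m1 p" "dense_seq m2 q"
  shows "dense_seq (sum_metric m1 m2) (\<lambda>n. (p (fst (prod_decode n)), q (snd (prod_decode n))))"
  unfolding dense_seq_def
proof (intro conjI allI ballI impI)
  fix x :: "'a \<times> 'b" and e :: real assume x: "x \<in> mspace (sum_metric m1 m2)" and "e > 0"
  then obtain i j where "mdist m1 (fst x) (p i) < e / 2" "mdist m2 (snd x) (q j) < e / 2"
    using assms unfolding dense_seq_def by (metis half_gt_zero mem_Sigma_iff mspace_sum_metric prod.collapse)
  then show "\<exists>n. mdist (sum_metric m1 m2) x (p (fst (prod_decode n)), q (snd (prod_decode n))) < e"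
    by (intro exI[of _ "prod_encode (i, j)"]) (auto split: prod.splits)
qed (use assms in \<open>auto simp: dense_seq_def\<close>)

lemma mcomplete_sum_metric:
  assumes "mcomplete_of m1" "mcomplete_of m2"
  shows "mcomplete_of (sum_metric m1 m2)"
proof (rule mcomplete_ofI)
  fix \<sigma> :: "nat \<Rightarrow> 'a \<times> 'b"
  assume s: "\<And>n. \<sigma> n \<in> mspace (sum_metric m1 m2)"
    and c: "\<And>e. e > 0 \<Longrightarrow> \<exists>N. \<forall>i\<ge>N. \<forall>j\<ge>N. mdist (sum_metric m1 m2) (\<sigma> i) (\<sigma> j) < e"
  have d: "mdist (sum_metric m1 m2) x y = mdist m1 (fst x) (fst y) + mdist m2 (snd x) (snd y)" for x y
    by (simp add: case_prod_unfold)
  have s': "fst (\<sigma> n) \<in> mspace m1" "snd (\<sigma> n) \<in> mspace m2" for n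
    using s[of n] by auto
  have less: "mdist m1 (fst x) (fst y) < e" "mdist m2 (snd x) (snd y) < e"
    if "mdist (sum_metric m1 m2) x y < e" for x y e
    using that unfolding d by (smt (verit) mdist_nonneg)+
  obtain a where a: "a \<in> mspace m1" "(\<lambda>n. mdist m1 (fst (\<sigma> n)) a) \<longlonglongrightarrow> 0"
    using mcomplete_ofD[OF assms(1), of "fst \<circ> \<sigma>"] s' c less unfolding comp_def by metis
  obtain b where b: "b \<in> mspace m2" "(\<lambda>n. mdist m2 (snd (\<sigma> n)) b) \<longlonglongrightarrow> 0"
    using mcomplete_ofD[OF assms(2), of "snd \<circ> \<sigma>"] s' c less unfolding comp_def by metis
  show "\<exists>l\<in>mspace (sum_metric m1 m2). (\<lambda>n. mdist (sum_metric m1 m2) (\<sigma> n) l) \<longlonglongrightarrow> 0"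
    using a b tendsto_add[OF a(2) b(2)] by (intro bexI[of _ "(a, b)"]) (auto simp: d simp del: mdist_sum_metric)
qed

text \<open>The product of the Borel \<open>\<sigma>\<close>-algebras is the Borel \<open>\<sigma>\<close>-algebra of the product because, by separability,
  every open set is a countable union of products of balls.\<close>

lemma mm_space_boxplus:
  assumes Y: "mm_space Y" and Z: "mm_space Z"
  shows "mm_space (Y \<boxplus> Z)"
proof -
  let ?m = "sum_metric (fst Y) (fst Z)" and ?M = "snd Y \<Otimes>\<^sub>M snd Z"
  interpret Y: prob_space "snd Y" using Y by (rule mm_spaceD)
  interpret Z: prob_space "snd Z" using Z by (rule mm_spaceD)
  interpret P: pair_prob_space "snd Y" "snd Z" ..
  obtain p where p: "dense_seq (fst Y) p" using mm_space_dense_seq[OF Y] .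
  obtain q where q: "dense_seq (fst Z) q" using mm_space_dense_seq[OF Z] .
  have p': "p i \<in> points Y" and q': "q i \<in> points Z" for i
    using p q by (auto simp: dense_seq_def)
  have space: "space ?M = mspace ?m"
    using mm_spaceD(4)[OF Y] mm_spaceD(4)[OF Z] by (simp add: space_pair_measure)
  have rect: "rball Y a r \<times> rball Z b s \<in> sets ?M" for a b r s
    using mm_space_ball_sets[OF Y] mm_space_ball_sets[OF Z] by auto
  have open_sets: "U \<in> sets ?M" if U: "openin (mtopology_of ?m) U" for U
  proof -
    define I where "I = {(i, j, r). r \<in> \<rat> \<and> rball Y (p i) r \<times> rball Z (q j) r \<subseteq> U}"
    have "I \<subseteq> UNIV \<times> UNIV \<times> \<rat>" unfolding I_def by auto
    moreover have "countable (UNIV \<times> UNIV \<times> \<rat> :: (nat \<times> nat \<times> real) set)"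
      by (intro countable_SIGMA countable_rat) auto
    ultimately have I: "countable I"
      by (rule countable_subset)
    have "U = (\<Union>(i, j, r)\<in>I. rball Y (p i) r \<times> rball Z (q j) r)" (is "_ = ?R")
    proof (intro subset_antisym subsetI)
      fix x assume x: "x \<in> U"
      then obtain y z where yz: "x = (y, z)" "y \<in> points Y" "z \<in> points Z"
        using U by (auto simp: openin_mtopology_of_iff)
      obtain e where e: "e > 0" "\<And>y. y \<in> mspace ?m \<Longrightarrow> mdist ?m x y < e \<Longrightarrow> y \<in> U"
        using U x unfolding openin_mtopology_of_iff by blast
      obtain r where r: "r \<in> \<rat>" "0 < r" "r < e / 4"
        using Rats_dense_in_real[of 0 "e / 4"] e by auto
      obtain i where i: "rdist Y y (p i) < r"
        using p yz r unfolding dense_seq_def by blast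
      obtain j where j: "rdist Z z (q j) < r"
        using q yz r unfolding dense_seq_def by blast
      have "(a, b) \<in> U" if ab: "a \<in> rball Y (p i) r" "b \<in> rball Z (q j) r" for a b
      proof (rule e(2))
        have "rdist Y y a \<le> rdist Y y (p i) + rdist Y (p i) a"
          using yz ab by (intro mdist_triangle) auto
        moreover have "rdist Z z b \<le> rdist Z z (q j) + rdist Z (q j) b"
          using yz ab by (intro mdist_triangle) auto
        ultimately show "mdist ?m x (a, b) < e"
          using yz ab r i j by auto
      qed (use ab in auto)
      then have "(i, j, r) \<in> I"
        using r by (auto simp: I_def)
      then show "x \<in> ?R"
        by (rule UN_I) (use yz i j p' q' in \<open>auto simp: mdist_commute\<close>)
    qed (auto simp: I_def)
    also have "\<dots> \<in> sets ?M"
      using rect I by (intro sets.countable_UN') auto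
    finally show ?thesis .
  qed
  have "fst \<in> measurable (metric_borel ?m) (metric_borel (fst Y))"
    by (intro short_map_measurable) (auto simp: case_prod_unfold)
  then have f: "fst \<in> measurable (metric_borel ?m) (snd Y)"
    using measurable_cong_sets[OF refl mm_spaceD(5)[OF Y]] by auto
  have "snd \<in> measurable (metric_borel ?m) (metric_borel (fst Z))"
    by (intro short_map_measurable) (auto simp: case_prod_unfold)
  then have s: "snd \<in> measurable (metric_borel ?m) (snd Z)"
    using measurable_cong_sets[OF refl mm_spaceD(5)[OF Z]] by auto
  have "sets ?M = sets (metric_borel ?m)"
  proof
    have "(\<lambda>x. (fst x, snd x)) \<in> measurable (metric_borel ?m) ?M"
      using f s by (rule measurable_Pair)
    then have id: "(\<lambda>x. x) \<in> measurable (metric_borel ?m) ?M"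
      by simp
    show "sets ?M \<subseteq> sets (metric_borel ?m)"
    proof
      fix A assume A: "A \<in> sets ?M"
      then have "A \<subseteq> mspace ?m" using sets.sets_into_space space by blast
      then show "A \<in> sets (metric_borel ?m)"
        using measurable_sets[OF id A] by (simp add: Int_absorb2)
    qed
    show "sets (metric_borel ?m) \<subseteq> sets ?M"
      unfolding sets_metric_borel using open_sets sets.sigma_sets_subset[of "{U. openin (mtopology_of ?m) U}" ?M] space
      by auto
  qed
  moreover have "measure ?M (mball_of ?m x e) > 0" if x: "x \<in> mspace ?m" "e > 0" for x e
  proof -
    obtain y z where yz: "x = (y, z)" "y \<in> points Y" "z \<in> points Z"
      using x by auto
    let ?R = "rball Y y (e / 2) \<times> rball Z z (e / 2)"
    have "0 < mass Y (rball Y y (e / 2)) * mass Z (rball Z z (e / 2))"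
      using mm_space_ball_pos[OF Y] mm_space_ball_pos[OF Z] yz x by simp
    also have "\<dots> = measure ?M ?R"
      using mm_space_ball_sets[OF Y] mm_space_ball_sets[OF Z]
      by (simp add: measure_def Z.emeasure_pair_measure_Times enn2real_mult)
    also have "\<dots> \<le> measure ?M (mball_of ?m x e)"
      using yz by (intro P.finite_measure_mono open_sets) auto
    finally show ?thesis .
  qed
  ultimately have "mm_space (?m, ?M)"
    using mcomplete_sum_metric[OF mm_spaceD(1)[OF Y] mm_spaceD(1)[OF Z]] dense_seq_sum_metric[OF p q]
      P.prob_space_axioms space by (intro mm_spaceI) auto
  then show ?thesis
    by (simp add: boxplus_def)
qed

section \<open>The Gromov--Prohorov distance in terms of cross distances\<close>

text \<open>The distances between points of two spaces inside a common metric space that contains both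
  isometrically. Zero distances are admitted, so a cross metric is a pseudometric on the disjoint union.\<close>

definition cross_metric :: "'a metric \<Rightarrow> 'b metric \<Rightarrow> ('a \<Rightarrow> 'b \<Rightarrow> real) \<Rightarrow> bool" where
  "cross_metric m1 m2 d \<longleftrightarrow>
     (\<forall>x\<in>mspace m1. \<forall>y\<in>mspace m2. 0 \<le> d x y) \<and>
     (\<forall>x\<in>mspace m1. \<forall>x'\<in>mspace m1. \<forall>y\<in>mspace m2.
        d x y \<le> mdist m1 x x' + d x' y \<and> mdist m1 x x' \<le> d x y + d x' y) \<and>
     (\<forall>x\<in>mspace m1. \<forall>y\<in>mspace m2. \<forall>y'\<in>mspace m2.
        d x y \<le> d x y' + mdist m2 y' y \<and> mdist m2 y y' \<le> d x y + d x y')"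

text \<open>One half of the Prohorov condition for the two measures, with neighbourhoods measured by a cross
  metric.\<close>

definition cross_dominates :: "'a mms \<Rightarrow> 'b mms \<Rightarrow> ('a \<Rightarrow> 'b \<Rightarrow> real) \<Rightarrow> real \<Rightarrow> bool" where
  "cross_dominates X Y d e \<longleftrightarrow> (\<forall>A\<in>sets (snd X).
     mass X A \<le> mass Y {y \<in> points Y. \<exists>x\<in>A. d x y < e} + e)"

lemma cross_metric_flip: "cross_metric m1 m2 d \<Longrightarrow> cross_metric m2 m1 (\<lambda>y x. d x y)"
  unfolding cross_metric_def by (auto simp: mdist_commute add.commute)

lemma cross_nbhd_open:
  assumes d: "cross_metric m1 m2 d" and A: "A \<subseteq> mspace m1"
  shows "openin (mtopology_of m2) {y \<in> mspace m2. \<exists>x\<in>A. d x y < e}"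
  unfolding openin_mtopology_of_iff
proof (intro conjI ballI)
  fix y assume "y \<in> {y \<in> mspace m2. \<exists>x\<in>A. d x y < e}"
  then obtain x where x: "y \<in> mspace m2" "x \<in> A" "d x y < e" by auto
  have "d x z < e" if "z \<in> mspace m2" "mdist m2 y z < e - d x y" for z
  proof -
    have "d x z \<le> d x y + mdist m2 y z"
      using d x that A unfolding cross_metric_def by blast
    then show ?thesis using that by simp
  qed
  then show "\<exists>r>0. \<forall>z\<in>mspace m2. mdist m2 y z < r \<longrightarrow> z \<in> {y \<in> mspace m2. \<exists>x\<in>A. d x y < e}"
    using x by (intro exI[of _ "e - d x y"]) auto
qed auto

lemma cross_nbhd_sets:
  assumes "mm_space Y" "cross_metric m1 (fst Y) d" "A \<subseteq> mspace m1"
  shows "{y \<in> points Y. \<exists>x\<in>A. d x y < e} \<in> sets (snd Y)"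
  using mm_space_open_sets[OF assms(1) cross_nbhd_open[OF assms(2,3)]] .

lemma isometric_embedding_measurable:
  assumes "mm_space X" "isometric_embedding (fst X) Z f"
  shows "f \<in> measurable (snd X) (metric_borel Z)"
proof -
  have "f \<in> measurable (metric_borel (fst X)) (metric_borel Z)"
    using assms(2) unfolding isometric_embedding_def by (intro short_map_measurable) auto
  then show ?thesis
    using measurable_cong_sets[OF mm_spaceD(5)[OF assms(1)] refl] by auto
qed

definition glue_dist :: "'a metric \<Rightarrow> 'b metric \<Rightarrow> ('a \<Rightarrow> 'b \<Rightarrow> real) \<Rightarrow> 'a + 'b \<Rightarrow> 'a + 'b \<Rightarrow> real" where
  "glue_dist m1 m2 d = (\<lambda>u v. case u of
     Inl x \<Rightarrow> (case v of Inl x' \<Rightarrow> mdist m1 x x' | Inr y' \<Rightarrow> d x y')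
   | Inr y \<Rightarrow> (case v of Inl x' \<Rightarrow> d x' y | Inr y' \<Rightarrow> mdist m2 y y'))"

text \<open>The distance is cut off to \<open>0\<close> outside the disjoint union, since nonnegativity and symmetry of a metric are
  demanded for all elements of the type.\<close>

lemma Metric_space_glue:
  assumes d: "cross_metric m1 m2 d" and pos: "\<And>x y. x \<in> mspace m1 \<Longrightarrow> y \<in> mspace m2 \<Longrightarrow> d x y > 0"
  shows "Metric_space (mspace m1 <+> mspace m2)
    (\<lambda>u v. if u \<in> mspace m1 <+> mspace m2 \<and> v \<in> mspace m1 <+> mspace m2 then glue_dist m1 m2 d u v else 0)"
    (is "Metric_space ?S ?D")
proof
  fix u v w
  show "0 \<le> ?D u v"
    using pos by (auto simp: glue_dist_def less_imp_le)
  show "?D u v = ?D v u"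
    by (auto simp: glue_dist_def mdist_commute)
  show "?D u v = 0 \<longleftrightarrow> u = v" if "u \<in> ?S" "v \<in> ?S"
    using that pos by (auto simp: glue_dist_def less_imp_neq[symmetric])
  show "?D u w \<le> ?D u v + ?D v w" if "u \<in> ?S" "v \<in> ?S" "w \<in> ?S"
    using that d unfolding cross_metric_def
    by (auto simp: glue_dist_def mdist_triangle) (metis mdist_commute add.commute)+
qed

definition push_metric :: "'a metric \<Rightarrow> ('a \<Rightarrow> 'b) \<Rightarrow> 'b metric" where
  "push_metric m h = metric (h ` mspace m, \<lambda>u v. mdist m (inv_into (mspace m) h u) (inv_into (mspace m) h v))"

lemma
  assumes h: "inj_on h (mspace m)"
  shows mspace_push_metric: "mspace (push_metric m h) = h ` mspace m"
    and mdist_push_metric: "x \<in> mspace m \<Longrightarrow> y \<in> mspace m \<Longrightarrow> mdist (push_metric m h) (h x) (h y) = mdist m x y"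
proof -
  let ?D = "\<lambda>u v. mdist m (inv_into (mspace m) h u) (inv_into (mspace m) h v)"
  interpret Metric_space "h ` mspace m" ?D
    by standard (use h in \<open>auto simp: mdist_commute mdist_triangle\<close>)
  show "mspace (push_metric m h) = h ` mspace m"
    by (simp add: push_metric_def)
  show "mdist (push_metric m h) (h x) (h y) = mdist m x y" if "x \<in> mspace m" "y \<in> mspace m"
    using that h by (simp add: push_metric_def)
qed

text \<open>Adding \<open>\<delta>\<close> turns the pseudometric on the disjoint union into a metric. The two carriers are embedded in the
  positive and in the negative reals, which gives a representation over the reals.\<close>

lemma cross_metric_realize:
  assumes d: "cross_metric m1 m2 d" and "\<delta> > 0"
    and sep: "separable_space (mtopology_of m1)" "separable_space (mtopology_of m2)"
  obtains Z :: "real metric" and f g where "isometric_embedding m1 Z f" "isometric_embedding m2 Z g"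
    "\<And>x y. x \<in> mspace m1 \<Longrightarrow> y \<in> mspace m2 \<Longrightarrow> mdist Z (f x) (g y) = d x y + \<delta>"
proof -
  let ?d = "\<lambda>x y. d x y + \<delta>"
  let ?S = "mspace m1 <+> mspace m2"
  let ?D = "\<lambda>u v. if u \<in> ?S \<and> v \<in> ?S then glue_dist m1 m2 ?d u v else 0"
  have "cross_metric m1 m2 ?d"
    using d \<open>\<delta> > 0\<close> unfolding cross_metric_def by (smt (verit))
  moreover have "?d x y > 0" if "x \<in> mspace m1" "y \<in> mspace m2" for x y
    using d that \<open>\<delta> > 0\<close> unfolding cross_metric_def by (simp add: add_nonneg_pos)
  ultimately interpret S: Metric_space ?S ?D
    by (rule Metric_space_glue)
  define m where "m = metric (?S, ?D)"
  have m: "mspace m = ?S" "mdist m = ?D"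
    by (auto simp: m_def)
  obtain f1 :: "'a \<Rightarrow> real" where f1: "inj_on f1 (mspace m1)"
    using separable_inj_real[OF sep(1)] by auto
  obtain f2 :: "'b \<Rightarrow> real" where f2: "inj_on f2 (mspace m2)"
    using separable_inj_real[OF sep(2)] by auto
  define h where "h = case_sum (\<lambda>x. exp (f1 x)) (\<lambda>y. - exp (f2 y))"
  have ne: "exp a \<noteq> - exp b" "- exp a \<noteq> exp b" for a b :: real
    by (smt (verit) exp_gt_zero)+
  have h: "inj_on h (mspace m)"
  proof (rule inj_onI)
    fix u v assume "u \<in> mspace m" "v \<in> mspace m" "h u = h v"
    then show "u = v"
      using inj_onD[OF f1] inj_onD[OF f2] unfolding m by (elim PlusE) (auto simp: h_def ne)
  qed
  have in_S: "Inl x \<in> ?S \<longleftrightarrow> x \<in> mspace m1" "Inr y \<in> ?S \<longleftrightarrow> y \<in> mspace m2" for x y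
    by auto
  show ?thesis
  proof (rule that[of "push_metric m h" "h \<circ> Inl" "h \<circ> Inr"])
    show "isometric_embedding m1 (push_metric m h) (h \<circ> Inl)"
      unfolding isometric_embedding_def
      by (auto simp: mspace_push_metric[OF h] mdist_push_metric[OF h] m in_S glue_dist_def)
    show "isometric_embedding m2 (push_metric m h) (h \<circ> Inr)"
      unfolding isometric_embedding_def
      by (auto simp: mspace_push_metric[OF h] mdist_push_metric[OF h] m in_S glue_dist_def)
    show "mdist (push_metric m h) ((h \<circ> Inl) x) ((h \<circ> Inr) y) = d x y + \<delta>"
      if "x \<in> mspace m1" "y \<in> mspace m2" for x y
      using that by (auto simp: mdist_push_metric[OF h] m in_S glue_dist_def)
  qed
qed

text \<open>A finite correspondence whose distortion is at most \<open>2 * \<delta>\<close> yields a cross metric: travel to a matched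
  point, cross over at cost \<open>\<delta>\<close>, and travel on. This is the source of all cross metrics between spaces that
  are not given inside a common space.\<close>

lemma cross_metric_correspondence:
  assumes I: "finite I" "I \<noteq> {}" and "\<delta> \<ge> 0"
    and a: "\<And>i. i \<in> I \<Longrightarrow> a i \<in> mspace m1" and b: "\<And>i. i \<in> I \<Longrightarrow> b i \<in> mspace m2"
    and ab: "\<And>i j. i \<in> I \<Longrightarrow> j \<in> I \<Longrightarrow> \<bar>mdist m1 (a i) (a j) - mdist m2 (b i) (b j)\<bar> \<le> 2 * \<delta>"
  shows "cross_metric m1 m2 (\<lambda>x y. (MIN i\<in>I. mdist m1 x (a i) + mdist m2 (b i) y) + \<delta>)"
proof -
  let ?d = "\<lambda>x y. (MIN i\<in>I. mdist m1 x (a i) + mdist m2 (b i) y)"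
  have le: "?d x y \<le> mdist m1 x (a i) + mdist m2 (b i) y" if "i \<in> I" for x y i
    using I that by (intro Min_le) auto
  have att: "\<exists>i\<in>I. ?d x y = mdist m1 x (a i) + mdist m2 (b i) y" for x y
  proof -
    have "?d x y \<in> (\<lambda>i. mdist m1 x (a i) + mdist m2 (b i) y) ` I"
      using I by (intro Min_in) auto
    then show ?thesis by auto
  qed
  show ?thesis
    unfolding cross_metric_def
  proof (intro conjI ballI)
    fix x y
    show "0 \<le> ?d x y + \<delta>"
      using att[of x y] \<open>\<delta> \<ge> 0\<close> by auto
  next
    fix x x' y assume p: "x \<in> mspace m1" "x' \<in> mspace m1" "y \<in> mspace m2"
    obtain i where i: "i \<in> I" "?d x y = mdist m1 x (a i) + mdist m2 (b i) y" using att by blast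
    obtain j where j: "j \<in> I" "?d x' y = mdist m1 x' (a j) + mdist m2 (b j) y" using att by blast
    show "?d x y + \<delta> \<le> mdist m1 x x' + (?d x' y + \<delta>)"
      using le[OF j(1), of x y] j mdist_triangle[of x m1 x' "a j"] p a[OF j(1)] by linarith
    show "mdist m1 x x' \<le> ?d x y + \<delta> + (?d x' y + \<delta>)"
      using i j ab[OF i(1) j(1)] mdist_triangle[of x m1 "a i" x'] mdist_triangle[of "a i" m1 "a j" x']
        mdist_triangle[of "b i" m2 y "b j"] p a[OF i(1)] a[OF j(1)] b[OF i(1)] b[OF j(1)]
        mdist_commute[of m1 x' "a j"] mdist_commute[of m2 y "b j"] by linarith
  next
    fix x y y' assume p: "x \<in> mspace m1" "y \<in> mspace m2" "y' \<in> mspace m2"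
    obtain i where i: "i \<in> I" "?d x y = mdist m1 x (a i) + mdist m2 (b i) y" using att by blast
    obtain j where j: "j \<in> I" "?d x y' = mdist m1 x (a j) + mdist m2 (b j) y'" using att by blast
    show "?d x y + \<delta> \<le> ?d x y' + \<delta> + mdist m2 y' y"
      using le[OF j(1), of x y] j mdist_triangle[of "b j" m2 y' y] p b[OF j(1)] by linarith
    show "mdist m2 y y' \<le> ?d x y + \<delta> + (?d x y' + \<delta>)"
      using i j ab[OF i(1) j(1)] mdist_triangle[of y m2 "b i" y'] mdist_triangle[of "b i" m2 "b j" y']
        mdist_triangle[of "a i" m1 x "a j"] p a[OF i(1)] a[OF j(1)] b[OF i(1)] b[OF j(1)]
        mdist_commute[of m2 y "b i"] mdist_commute[of m1 x "a i"] by linarith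
  qed
qed

abbreviation prohorov_radii :: "'a metric \<Rightarrow> 'a measure \<Rightarrow> 'a measure \<Rightarrow> real set" where
  "prohorov_radii m \<mu> \<nu> \<equiv> {\<epsilon>. \<epsilon> > 0 \<and>
     (\<forall>A\<in>sets (metric_borel m).
        let A\<epsilon> = \<Union>a\<in>A. mball_of m a \<epsilon> in
          measure \<mu> A \<le> measure \<nu> A\<epsilon> + \<epsilon> \<and> measure \<nu> A \<le> measure \<mu> A\<epsilon> + \<epsilon>)}"

abbreviation GPr_values :: "'a mms \<Rightarrow> 'b mms \<Rightarrow> real set" where
  "GPr_values X Y \<equiv> {prohorov_dist Z (distr (snd X) (metric_borel Z) f) (distr (snd Y) (metric_borel Z) g) |
     (Z :: real metric) f g. isometric_embedding (fst X) Z f \<and> isometric_embedding (fst Y) Z g}"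

lemma GPr_dist_set_nonempty:
  assumes X: "mm_space X" and Y: "mm_space Y"
  shows "GPr_values X Y \<noteq> {}"
proof -
  obtain x y where "x \<in> points X" "y \<in> points Y"
    using mm_space_nonempty[OF X] mm_space_nonempty[OF Y] by auto
  then have "cross_metric (fst X) (fst Y)
      (\<lambda>p q. (MIN i\<in>{()}. rdist X p x + rdist Y y q) + 0)"
    by (intro cross_metric_correspondence) (auto simp: mdist_self)
  then obtain Z :: "real metric" and f g where "isometric_embedding (fst X) Z f" "isometric_embedding (fst Y) Z g"
    by (rule cross_metric_realize[OF _ zero_less_one mm_spaceD(2)[OF X] mm_spaceD(2)[OF Y]])
  then have "prohorov_dist Z (distr (snd X) (metric_borel Z) f) (distr (snd Y) (metric_borel Z) g) \<in>
    GPr_values X Y"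
    by blast
  then show ?thesis by blast
qed

lemma prohorov_dist_set_nonempty:
  assumes "prob_space \<mu>" "prob_space \<nu>"
  shows "prohorov_radii m \<mu> \<nu> \<noteq> {}"
proof -
  have "measure \<mu> A \<le> measure \<nu> B + 1" "measure \<nu> A \<le> measure \<mu> B + 1" for A B
    using assms by (simp_all add: prob_space.prob_le_1 add_increasing)
  then have "1 \<in> prohorov_radii m \<mu> \<nu>"
    by (simp add: Let_def)
  then show ?thesis by blast
qed

lemma prohorov_dist_nonneg:
  assumes "prob_space \<mu>" "prob_space \<nu>"
  shows "prohorov_dist m \<mu> \<nu> \<ge> 0"
  unfolding prohorov_dist_def by (rule cInf_greatest[OF prohorov_dist_set_nonempty[OF assms]]) simp

lemma prohorov_dist_lessE:
  assumes "prob_space \<mu>" "prob_space \<nu>" "prohorov_dist m \<mu> \<nu> < e"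
  obtains e' where "0 < e'" "e' < e"
    "\<And>A. A \<in> sets (metric_borel m) \<Longrightarrow> measure \<mu> A \<le> measure \<nu> (\<Union>a\<in>A. mball_of m a e') + e'"
    "\<And>A. A \<in> sets (metric_borel m) \<Longrightarrow> measure \<nu> A \<le> measure \<mu> (\<Union>a\<in>A. mball_of m a e') + e'"
  using cInf_lessD[OF prohorov_dist_set_nonempty[OF assms(1,2)] assms(3)[unfolded prohorov_dist_def]] that
  by (simp add: Let_def) blast

lemma GPr_dist_nonneg:
  assumes X: "mm_space X" and Y: "mm_space Y"
  shows "GPr_dist X Y \<ge> 0"
  unfolding GPr_dist_def
proof (rule cInf_greatest[OF GPr_dist_set_nonempty[OF X Y]])
  interpret X: prob_space "snd X" using X by (rule mm_spaceD)
  interpret Y: prob_space "snd Y" using Y by (rule mm_spaceD)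
  fix r assume "r \<in> GPr_values X Y"
  then show "0 \<le> r"
    using isometric_embedding_measurable[OF X] isometric_embedding_measurable[OF Y]
    by (auto intro!: prohorov_dist_nonneg X.prob_space_distr Y.prob_space_distr)
qed

lemma GPr_dist_le:
  fixes Z :: "real metric"
  assumes X: "mm_space X" and Y: "mm_space Y"
    and Z: "isometric_embedding (fst X) Z f" "isometric_embedding (fst Y) Z g"
  shows "GPr_dist X Y \<le> prohorov_dist Z (distr (snd X) (metric_borel Z) f) (distr (snd Y) (metric_borel Z) g)"
  unfolding GPr_dist_def
proof (rule cInf_lower)
  interpret X: prob_space "snd X" using X by (rule mm_spaceD)
  interpret Y: prob_space "snd Y" using Y by (rule mm_spaceD)
  show "bdd_below (GPr_values X Y)"
    using isometric_embedding_measurable[OF X] isometric_embedding_measurable[OF Y]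
    by (intro bdd_belowI[of _ 0]) (auto intro!: prohorov_dist_nonneg X.prob_space_distr Y.prob_space_distr)
qed (use Z in blast)

lemma cross_metric_embed:
  assumes f: "isometric_embedding m1 Z f" and g: "isometric_embedding m2 Z g"
  shows "cross_metric m1 m2 (\<lambda>x y. mdist Z (f x) (g y))"
proof -
  have sp: "f x \<in> mspace Z" "g y \<in> mspace Z" if "x \<in> mspace m1" "y \<in> mspace m2" for x y
    using f g that by (auto simp: isometric_embedding_def)
  have fd: "mdist m1 x x' = mdist Z (f x) (f x')" if "x \<in> mspace m1" "x' \<in> mspace m1" for x x'
    using f that by (auto simp: isometric_embedding_def)
  have gd: "mdist m2 x x' = mdist Z (g x) (g x')" if "x \<in> mspace m2" "x' \<in> mspace m2" for x x'
    using g that by (auto simp: isometric_embedding_def)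
  show ?thesis
    unfolding cross_metric_def
  proof (intro conjI ballI)
    fix x x' y assume "x \<in> mspace m1" "x' \<in> mspace m1" "y \<in> mspace m2"
    then show "mdist Z (f x) (g y) \<le> mdist m1 x x' + mdist Z (f x') (g y)"
      "mdist m1 x x' \<le> mdist Z (f x) (g y) + mdist Z (f x') (g y)"
      using mdist_triangle[of "f x" Z "f x'" "g y"] mdist_triangle[of "f x" Z "g y" "f x'"]
      by (simp_all add: fd sp mdist_commute)
  next
    fix x y y' assume "x \<in> mspace m1" "y \<in> mspace m2" "y' \<in> mspace m2"
    then show "mdist Z (f x) (g y) \<le> mdist Z (f x) (g y') + mdist m2 y' y"
      "mdist m2 y y' \<le> mdist Z (f x) (g y) + mdist Z (f x) (g y')"
      using mdist_triangle[of "f x" Z "g y'" "g y"] mdist_triangle[of "g y" Z "f x" "g y'"]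
      by (simp_all add: gd sp mdist_commute)
  qed auto
qed

text \<open>Conversely, a common ambient space for which the Prohorov condition holds provides a cross metric.\<close>

lemma cross_dominates_embed:
  assumes X: "mm_space X" and Y: "mm_space Y"
    and Z: "isometric_embedding (fst X) Z f" "isometric_embedding (fst Y) Z g" and e': "0 < e'" "e' < e"
    and le: "\<And>A. A \<in> sets (metric_borel Z) \<Longrightarrow> measure (distr (snd X) (metric_borel Z) f) A \<le>
      measure (distr (snd Y) (metric_borel Z) g) (\<Union>a\<in>A. mball_of Z a e') + e'"
  shows "cross_dominates X Y (\<lambda>x y. mdist Z (f x) (g y)) e"
  unfolding cross_dominates_def
proof
  interpret X: prob_space "snd X" using X by (rule mm_spaceD)
  interpret Y: prob_space "snd Y" using Y by (rule mm_spaceD)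
  note fm = isometric_embedding_measurable[OF X Z(1)] and gm = isometric_embedding_measurable[OF Y Z(2)]
  fix A assume A: "A \<in> sets (snd X)"
  then have AX: "A \<subseteq> points X"
    using sets.sets_into_space mm_spaceD(4)[OF X] by blast
  have f: "f x \<in> mspace Z" if "x \<in> points X" for x
    using Z that by (auto simp: isometric_embedding_def)
  have g: "g x \<in> mspace Z" if "x \<in> points Y" for x
    using Z that by (auto simp: isometric_embedding_def)
  \<comment> \<open>The image of \<open>A\<close> need not be measurable, but its open neighbourhoods are.\<close>
  define U where "U = (\<Union>x\<in>A. mball_of Z (f x) (e - e'))"
  have U: "openin (mtopology_of Z) U"
    unfolding U_def by (intro openin_Union) auto
  have V: "openin (mtopology_of Z) (\<Union>a\<in>U. mball_of Z a e')"
    by (intro openin_Union) auto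
  have "mass X A \<le> mass X (f -` U \<inter> space (snd X))"
  proof (intro X.finite_measure_mono measurable_sets[OF fm] open_in_metric_borel U subsetI)
    fix x assume "x \<in> A"
    then show "x \<in> f -` U \<inter> space (snd X)"
      using AX f[of x] e' mm_spaceD(4)[OF X] by (auto simp: U_def mdist_self intro!: bexI[of _ x])
  qed
  also have "\<dots> = measure (distr (snd X) (metric_borel Z) f) U"
    using open_in_metric_borel[OF U] fm by (simp add: measure_distr)
  also have "\<dots> \<le> measure (distr (snd Y) (metric_borel Z) g) (\<Union>a\<in>U. mball_of Z a e') + e'"
    using le open_in_metric_borel[OF U] by blast
  also have "measure (distr (snd Y) (metric_borel Z) g) (\<Union>a\<in>U. mball_of Z a e') =
      mass Y (g -` (\<Union>a\<in>U. mball_of Z a e') \<inter> space (snd Y))"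
    using open_in_metric_borel[OF V] gm by (simp add: measure_distr)
  also have "\<dots> \<le> mass Y {y \<in> points Y. \<exists>x\<in>A. mdist Z (f x) (g y) < e}"
  proof (rule Y.finite_measure_mono)
    have "mdist Z (f x) (g y) < e" if "x \<in> A" "y \<in> points Y" "a \<in> mspace Z"
      "mdist Z (f x) a < e - e'" "mdist Z a (g y) < e'" for x y a
      using mdist_triangle[of "f x" Z a "g y"] that f[of x] g[of y] AX by auto
    then show "g -` (\<Union>a\<in>U. mball_of Z a e') \<inter> space (snd Y) \<subseteq> {y \<in> points Y. \<exists>x\<in>A. mdist Z (f x) (g y) < e}"
      using mm_spaceD(4)[OF Y] by (force simp: U_def)
    show "{y \<in> points Y. \<exists>x\<in>A. mdist Z (f x) (g y) < e} \<in> sets (snd Y)"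
      by (rule cross_nbhd_sets[OF Y cross_metric_embed[OF Z] AX])
  qed
  finally show "mass X A \<le> mass Y {y \<in> points Y. \<exists>x\<in>A. mdist Z (f x) (g y) < e} + e"
    using e' by simp
qed

text \<open>Together with \<open>GPr_dist_le_cross\<close> this replaces the Gromov--Prohorov distance by statements about cross
  metrics, in which ambient spaces no longer occur.\<close>

lemma GPr_dist_less_cross:
  assumes X: "mm_space X" and Y: "mm_space Y" and e: "GPr_dist X Y < e"
  obtains d where "cross_metric (fst X) (fst Y) d" "cross_dominates X Y d e" "cross_dominates Y X (\<lambda>y x. d x y) e"
proof -
  interpret X: prob_space "snd X" using X by (rule mm_spaceD)
  interpret Y: prob_space "snd Y" using Y by (rule mm_spaceD)
  obtain Z :: "real metric" and f g where Z: "isometric_embedding (fst X) Z f" "isometric_embedding (fst Y) Z g"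
    and less: "prohorov_dist Z (distr (snd X) (metric_borel Z) f) (distr (snd Y) (metric_borel Z) g) < e"
    using cInf_lessD[OF GPr_dist_set_nonempty[OF X Y] e[unfolded GPr_dist_def]] by blast
  note fm = isometric_embedding_measurable[OF X Z(1)] and gm = isometric_embedding_measurable[OF Y Z(2)]
  obtain e' where e': "0 < e'" "e' < e" and
    le: "\<And>A. A \<in> sets (metric_borel Z) \<Longrightarrow> measure (distr (snd X) (metric_borel Z) f) A \<le>
      measure (distr (snd Y) (metric_borel Z) g) (\<Union>a\<in>A. mball_of Z a e') + e'"
      "\<And>A. A \<in> sets (metric_borel Z) \<Longrightarrow> measure (distr (snd Y) (metric_borel Z) g) A \<le>
      measure (distr (snd X) (metric_borel Z) f) (\<Union>a\<in>A. mball_of Z a e') + e'"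
    using prohorov_dist_lessE[OF X.prob_space_distr[OF fm] Y.prob_space_distr[OF gm] less] by blast
  show ?thesis
  proof (rule that[of "\<lambda>x y. mdist Z (f x) (g y)"])
    show "cross_metric (fst X) (fst Y) (\<lambda>x y. mdist Z (f x) (g y))"
      by (rule cross_metric_embed[OF Z])
    show "cross_dominates X Y (\<lambda>x y. mdist Z (f x) (g y)) e"
      using cross_dominates_embed[OF X Y Z e' le(1)] .
    show "cross_dominates Y X (\<lambda>y x. mdist Z (f x) (g y)) e"
      using cross_dominates_embed[OF Y X Z(2,1) e' le(2)] by (simp add: mdist_commute)
  qed
qed

lemma cross_dominates_realized:
  assumes X: "mm_space X" and Y: "mm_space Y" and d: "cross_metric (fst X) (fst Y) d"
    and dom: "cross_dominates X Y d e" and "\<delta> > 0"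
    and Z: "isometric_embedding (fst X) Z f" "isometric_embedding (fst Y) Z g"
    and fg: "\<And>x y. x \<in> points X \<Longrightarrow> y \<in> points Y \<Longrightarrow> mdist Z (f x) (g y) = d x y + \<delta>"
    and A: "A \<in> sets (metric_borel Z)"
  shows "measure (distr (snd X) (metric_borel Z) f) A \<le>
      measure (distr (snd Y) (metric_borel Z) g) (\<Union>a\<in>A. mball_of Z a (e + \<delta>)) + (e + \<delta>)"
proof -
  interpret Y: prob_space "snd Y" using Y by (rule mm_spaceD)
  note fm = isometric_embedding_measurable[OF X Z(1)] and gm = isometric_embedding_measurable[OF Y Z(2)]
  have V: "openin (mtopology_of Z) (\<Union>a\<in>A. mball_of Z a (e + \<delta>))"
    by (intro openin_Union) auto
  let ?A = "f -` A \<inter> space (snd X)"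
  have AX: "?A \<subseteq> points X"
    using mm_spaceD(4)[OF X] by auto
  have "measure (distr (snd X) (metric_borel Z) f) A = mass X ?A"
    using A fm by (simp add: measure_distr)
  also have "\<dots> \<le> mass Y {y \<in> points Y. \<exists>x\<in>?A. d x y < e} + e"
    using dom measurable_sets[OF fm A] unfolding cross_dominates_def by blast
  also have "mass Y {y \<in> points Y. \<exists>x\<in>?A. d x y < e} \<le>
      mass Y (g -` (\<Union>a\<in>A. mball_of Z a (e + \<delta>)) \<inter> space (snd Y))"
    using fg Z mm_spaceD(4)[OF X] mm_spaceD(4)[OF Y]
    by (intro Y.finite_measure_mono measurable_sets[OF gm] open_in_metric_borel V)
      (auto simp: isometric_embedding_def intro!: bexI)
  also have "\<dots> = measure (distr (snd Y) (metric_borel Z) g) (\<Union>a\<in>A. mball_of Z a (e + \<delta>))"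
    using open_in_metric_borel[OF V] gm by (simp add: measure_distr)
  finally show ?thesis
    using \<open>\<delta> > 0\<close> by simp
qed

lemma GPr_dist_le_cross:
  assumes X: "mm_space X" and Y: "mm_space Y" and d: "cross_metric (fst X) (fst Y) d"
    and dom: "cross_dominates X Y d e" "cross_dominates Y X (\<lambda>y x. d x y) e" and "e > 0"
  shows "GPr_dist X Y \<le> e"
proof (rule field_le_epsilon)
  fix \<delta> :: real assume "\<delta> > 0"
  obtain Z :: "real metric" and f g where Z: "isometric_embedding (fst X) Z f" "isometric_embedding (fst Y) Z g"
    and fg: "\<And>x y. x \<in> points X \<Longrightarrow> y \<in> points Y \<Longrightarrow> mdist Z (f x) (g y) = d x y + \<delta>"
    using cross_metric_realize[OF d \<open>\<delta> > 0\<close> mm_spaceD(2)[OF X] mm_spaceD(2)[OF Y]] by blast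
  have gf: "mdist Z (g y) (f x) = d x y + \<delta>" if "y \<in> points Y" "x \<in> points X" for x y
    using fg that by (simp add: mdist_commute)
  have "prohorov_dist Z (distr (snd X) (metric_borel Z) f) (distr (snd Y) (metric_borel Z) g) \<le> e + \<delta>"
    unfolding prohorov_dist_def
  proof (rule cInf_lower)
    show "e + \<delta> \<in> prohorov_radii Z (distr (snd X) (metric_borel Z) f) (distr (snd Y) (metric_borel Z) g)"
      using cross_dominates_realized[OF X Y d dom(1) \<open>\<delta> > 0\<close> Z fg]
        cross_dominates_realized[OF Y X cross_metric_flip[OF d] dom(2) \<open>\<delta> > 0\<close> Z(2,1) gf] \<open>\<delta> > 0\<close> \<open>e > 0\<close>
      by (auto simp: Let_def)
  qed (auto intro!: bdd_belowI[of _ 0])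
  then show "GPr_dist X Y \<le> e + \<delta>"
    using GPr_dist_le[OF X Y Z] by linarith
qed

text \<open>An embedding of \<open>Y'\<close> composed with the isomorphism is an embedding of \<open>Y\<close> with the same image measure, so
  the infimum on the left ranges over more values.\<close>

lemma GPr_dist_iso_le:
  assumes X: "mm_space X" and Y: "mm_space Y" and Y': "mm_space Y'" and iso: "Y \<simeq>\<^sub>m Y'"
  shows "GPr_dist X Y \<le> GPr_dist X Y'"
proof -
  obtain h where h: "isometric_embedding (fst Y) (fst Y') h"
    "distr (snd Y) (metric_borel (fst Y')) h = snd Y'"
    using iso by (auto simp: mm_iso_def)
  have hm: "h \<in> measurable (snd Y) (metric_borel (fst Y'))"
    using isometric_embedding_measurable[OF Y h(1)] .
  have "GPr_dist X Y \<le> r" if r: "r \<in> GPr_values X Y'" for r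
  proof -
    obtain Z :: "real metric" and f g where Z: "isometric_embedding (fst X) Z f" "isometric_embedding (fst Y') Z g"
      and r: "r = prohorov_dist Z (distr (snd X) (metric_borel Z) f) (distr (snd Y') (metric_borel Z) g)"
      using r by blast
    have gm: "g \<in> measurable (metric_borel (fst Y')) (metric_borel Z)"
      using isometric_embedding_measurable[OF Y' Z(2)] measurable_cong_sets[OF mm_spaceD(5)[OF Y'] refl] by auto
    have "isometric_embedding (fst Y) Z (g \<circ> h)"
      using Z(2) h(1) unfolding isometric_embedding_def by (auto simp: Pi_iff)
    from GPr_dist_le[OF X Y Z(1) this]
    show ?thesis
      using distr_distr[OF gm hm] unfolding r h(2) by simp
  qed
  then show ?thesis
    unfolding GPr_dist_def[of X Y'] by (intro cInf_greatest GPr_dist_set_nonempty[OF X Y'])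
qed

section \<open>Images of metric measure spaces\<close>

text \<open>Full support is inherited: the preimage of a ball contains a ball of the original space.\<close>

lemma mm_space_image:
  assumes X: "mm_space X" and m: "mcomplete_of m" and f: "f \<in> points X \<rightarrow> mspace m"
    and short: "\<And>x y. x \<in> points X \<Longrightarrow> y \<in> points X \<Longrightarrow> mdist m (f x) (f y) \<le> rdist X x y"
    and dense: "\<And>y e. y \<in> mspace m \<Longrightarrow> e > 0 \<Longrightarrow> \<exists>x\<in>points X. mdist m y (f x) < e"
  shows "mm_space (m, distr (snd X) (metric_borel m) f)"
proof -
  interpret X: prob_space "snd X" using X by (rule mm_spaceD)
  obtain q where q: "dense_seq (fst X) q" using mm_space_dense_seq[OF X] .
  have fm: "f \<in> measurable (snd X) (metric_borel m)"
    using short_map_measurable[OF f short] measurable_cong_sets[OF mm_spaceD(5)[OF X] refl] by auto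
  have "\<exists>i. mdist m y (f (q i)) < e" if y: "y \<in> mspace m" "e > 0" for y e
  proof -
    obtain x where x: "x \<in> points X" "mdist m y (f x) < e / 2"
      using dense[of y "e / 2"] y by auto
    obtain i where i: "rdist X x (q i) < e / 2"
      using q x y unfolding dense_seq_def by (meson half_gt_zero)
    have qi: "q i \<in> points X"
      using q by (simp add: dense_seq_def)
    have "mdist m y (f (q i)) \<le> mdist m y (f x) + mdist m (f x) (f (q i))"
      using y x qi f by (intro mdist_triangle) auto
    then show ?thesis
      using x i short[OF x(1) qi] by (intro exI[of _ i]) linarith
  qed
  then have "dense_seq m (f \<circ> q)"
    using q f by (auto simp: dense_seq_def)
  moreover have "measure (distr (snd X) (metric_borel m) f) (mball_of m y e) > 0"
    if y: "y \<in> mspace m" "e > 0" for y e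
  proof -
    obtain x where x: "x \<in> points X" "mdist m y (f x) < e"
      using dense[OF y] by auto
    let ?r = "e - mdist m y (f x)"
    have B: "mball_of m y e \<in> sets (metric_borel m)"
      by (simp add: open_in_metric_borel)
    have "0 < mass X (rball X x ?r)"
      using x by (intro mm_space_ball_pos[OF X]) auto
    also have "\<dots> \<le> mass X (f -` mball_of m y e \<inter> space (snd X))"
    proof (intro X.finite_measure_mono measurable_sets[OF fm B] subsetI)
      fix z assume z: "z \<in> rball X x ?r"
      then have "mdist m y (f z) \<le> mdist m y (f x) + mdist m (f x) (f z)"
        using y x f by (intro mdist_triangle) auto
      moreover have "mdist m (f x) (f z) \<le> rdist X x z"
        using z short by auto
      ultimately show "z \<in> f -` mball_of m y e \<inter> space (snd X)"
        using y z f mm_spaceD(4)[OF X] by auto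
    qed
    also have "\<dots> = measure (distr (snd X) (metric_borel m) f) (mball_of m y e)"
      using fm B by (simp add: measure_distr)
    finally show ?thesis .
  qed
  ultimately show ?thesis
    using m X.prob_space_distr[OF fm] by (intro mm_spaceI) auto
qed

text \<open>Only this direction of the isomorphism is recorded, because \<open>GPr_dist_iso_le\<close> then bounds distances to the
  representative by distances to the given space.\<close>

lemma mm_space_real_representative:
  assumes X: "mm_space X"
  obtains X' :: "real mms" where "mm_space X'" "X' \<simeq>\<^sub>m X"
proof -
  interpret X: prob_space "snd X" using X by (rule mm_spaceD)
  obtain h :: "'a \<Rightarrow> real" where h: "inj_on h (points X)"
    using separable_inj_real[OF mm_spaceD(2)[OF X]] by auto
  let ?m = "push_metric (fst X) h" and ?g = "inv_into (points X) h"
  note sp = mspace_push_metric[OF h] and di = mdist_push_metric[OF h]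
  have "mcomplete_of ?m"
  proof (rule mcomplete_ofI)
    fix \<sigma> :: "nat \<Rightarrow> real" assume s: "\<And>n. \<sigma> n \<in> mspace ?m"
      and c: "\<And>e. e > 0 \<Longrightarrow> \<exists>N. \<forall>i\<ge>N. \<forall>j\<ge>N. mdist ?m (\<sigma> i) (\<sigma> j) < e"
    have "\<forall>n. \<exists>t\<in>points X. \<sigma> n = h t"
      using s by (auto simp: sp)
    then obtain t where t: "\<And>n. t n \<in> points X" "\<And>n. \<sigma> n = h (t n)"
      by metis
    have "\<exists>N. \<forall>i\<ge>N. \<forall>j\<ge>N. rdist X (t i) (t j) < e" if "e > 0" for e
      using c[OF that] t by (simp add: di)
    then obtain l where "l \<in> points X" "(\<lambda>n. rdist X (t n) l) \<longlonglongrightarrow> 0"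
      by (rule mcomplete_ofD[OF mm_spaceD(1)[OF X] t(1)])
    then show "\<exists>l\<in>mspace ?m. (\<lambda>n. mdist ?m (\<sigma> n) l) \<longlonglongrightarrow> 0"
      using t by (intro bexI[of _ "h l"]) (auto simp: di sp)
  qed
  then have mm: "mm_space (?m, distr (snd X) (metric_borel ?m) h)"
    by (rule mm_space_image[OF X]) (auto simp: sp di mdist_self intro!: bexI)
  have hm: "h \<in> measurable (snd X) (metric_borel ?m)"
    by (rule isometric_embedding_measurable[OF X]) (auto simp: isometric_embedding_def sp di)
  have emb: "isometric_embedding ?m (fst X) ?g"
    using h by (auto simp: isometric_embedding_def sp di)
  have gm: "?g \<in> measurable (metric_borel ?m) (metric_borel (fst X))"
    using isometric_embedding_measurable[OF mm, of _ ?g] emb by auto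
  have "distr (distr (snd X) (metric_borel ?m) h) (metric_borel (fst X)) ?g
      = distr (snd X) (metric_borel (fst X)) (?g \<circ> h)"
    using distr_distr[OF gm hm] .
  also have "\<dots> = distr (snd X) (snd X) (\<lambda>x. x)"
    using h mm_spaceD(4,5)[OF X] by (intro distr_cong) auto
  also have "\<dots> = snd X"
    by (rule distr_id)
  finally have push: "distr (distr (snd X) (metric_borel ?m) h) (metric_borel (fst X)) ?g = snd X" .
  have "?g ` h ` points X = points X"
    by (rule inv_into_image_cancel[OF h subset_refl])
  then have "(?m, distr (snd X) (metric_borel ?m) h) \<simeq>\<^sub>m X"
    unfolding mm_iso_def using emb push by (intro exI[of _ ?g]) (simp add: sp)
  then show ?thesis
    using mm that by blast
qed

section \<open>The semicharacters\<close>

abbreviation sample :: "nat \<Rightarrow> 'a mms \<Rightarrow> (nat \<Rightarrow> 'a) measure" where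
  "sample k X \<equiv> \<Pi>\<^sub>M i\<in>{..<k}. snd X"

abbreviation on_vertices :: "nat \<Rightarrow> (nat \<times> nat) list \<Rightarrow> bool" where
  "on_vertices k es \<equiv> set es \<subseteq> {..<k} \<times> {..<k}"

definition edge_prod :: "'a metric \<Rightarrow> (nat \<times> nat) list \<Rightarrow> (nat \<Rightarrow> 'a) \<Rightarrow> real" where
  "edge_prod m es x = (\<Prod>e\<leftarrow>es. exp (- mdist m (x (fst e)) (x (snd e))))"

definition semichar :: "'a mms \<Rightarrow> nat \<Rightarrow> (nat \<times> nat) list \<Rightarrow> real" where
  "semichar X k es = (\<integral>x. edge_prod (fst X) es x \<partial>sample k X)"

lemma edge_prod_simps [simp]:
  "edge_prod m [] x = 1"
  "edge_prod m (e # es) x = exp (- mdist m (x (fst e)) (x (snd e))) * edge_prod m es x"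
  "edge_prod m (es @ fs) x = edge_prod m es x * edge_prod m fs x"
  by (simp_all add: edge_prod_def)

lemma edge_prod_pos: "edge_prod m es x > 0"
  by (induction es) auto

lemma edge_prod_le_1: "edge_prod m es x \<le> 1"
  by (induction es) (auto intro!: mult_le_one less_imp_le[OF edge_prod_pos])

lemma edge_prod_nonneg: "edge_prod m es x \<ge> 0"
  by (rule less_imp_le[OF edge_prod_pos])

lemma edge_prod_cong:
  assumes "set es \<subseteq> I \<times> I" "\<And>i. i \<in> I \<Longrightarrow> x i = y i"
  shows "edge_prod m es x = edge_prod m es y"
  using assms(1) by (induction es) (auto simp: assms(2))

lemma edge_prod_measurable:
  assumes X: "mm_space X" and "set es \<subseteq> I \<times> I"
    and "\<And>i. i \<in> I \<Longrightarrow> (\<lambda>w. f w i) \<in> measurable N (snd X)"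
  shows "(\<lambda>w. edge_prod (fst X) es (f w)) \<in> borel_measurable N"
  using assms(2)
proof (induction es)
  case (Cons e es)
  then have "(\<lambda>w. rdist X (f w (fst e)) (f w (snd e))) \<in> borel_measurable N"
    by (intro measurable_mdist[OF X] assms(3)) auto
  then show ?case
    using Cons by auto
qed auto

lemma edge_prod_measurable_PiM:
  assumes X: "mm_space X" and "set es \<subseteq> I \<times> I"
  shows "edge_prod (fst X) es \<in> borel_measurable (\<Pi>\<^sub>M i\<in>I. snd X)"
  by (rule edge_prod_measurable[OF assms]) simp

text \<open>The Lipschitz estimates that follow give both the continuity of the semicharacters in the space
  and the continuity of the profiles in the points.\<close>

lemma exp_minus_lipschitz:
  fixes a b :: real
  assumes "a \<ge> 0" "b \<ge> 0"
  shows "\<bar>exp (- a) - exp (- b)\<bar> \<le> \<bar>a - b\<bar>"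
proof -
  have *: "exp (- u) - exp (- v) \<le> v - u" if "0 \<le> u" "u \<le> v" for u v :: real
  proof -
    have "exp (- u) - exp (- v) = exp (- u) * (1 - exp (- (v - u)))"
      by (simp add: algebra_simps flip: exp_add)
    also have "\<dots> \<le> 1 * (v - u)"
      using that exp_ge_add_one_self[of "- (v - u)"] by (intro mult_mono) (auto simp: algebra_simps)
    finally show ?thesis by simp
  qed
  have "exp (- u) \<ge> exp (- v)" if "u \<le> v" for u v :: real
    using that by simp
  then show ?thesis
    using *[of a b] *[of b a] assms by (smt (verit))
qed

lemma abs_mult_diff_le:
  fixes a b c d :: real
  assumes "\<bar>a\<bar> \<le> 1" "\<bar>d\<bar> \<le> 1"
  shows "\<bar>a * b - c * d\<bar> \<le> \<bar>a - c\<bar> + \<bar>b - d\<bar>"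
proof -
  have "a * b - c * d = (a - c) * d + a * (b - d)"
    by (simp add: algebra_simps)
  also have "\<bar>\<dots>\<bar> \<le> \<bar>a - c\<bar> * \<bar>d\<bar> + \<bar>a\<bar> * \<bar>b - d\<bar>"
    by (rule order_trans[OF abs_triangle_ineq]) (simp add: abs_mult)
  also have "\<dots> \<le> \<bar>a - c\<bar> * 1 + 1 * \<bar>b - d\<bar>"
    using assms by (intro add_mono mult_mono) auto
  finally show ?thesis by simp
qed

lemma edge_prod_lipschitz:
  assumes "\<And>e. e \<in> set es \<Longrightarrow>
    \<bar>mdist m (x (fst e)) (x (snd e)) - mdist m' (y (fst e)) (y (snd e))\<bar> \<le> c"
  shows "\<bar>edge_prod m es x - edge_prod m' es y\<bar> \<le> real (length es) * c"
  using assms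
proof (induction es)
  case (Cons e es)
  have "\<bar>edge_prod m (e # es) x - edge_prod m' (e # es) y\<bar> \<le>
    \<bar>exp (- mdist m (x (fst e)) (x (snd e))) - exp (- mdist m' (y (fst e)) (y (snd e)))\<bar>
     + \<bar>edge_prod m es x - edge_prod m' es y\<bar>"
    unfolding edge_prod_simps
    by (rule abs_mult_diff_le) (auto simp: edge_prod_nonneg edge_prod_le_1)
  also have "\<dots> \<le> c + real (length es) * c"
    using Cons by (intro add_mono order_trans[OF exp_minus_lipschitz]) auto
  finally show ?case by (simp add: algebra_simps)
qed auto

lemma prob_space_PiM_mm: "mm_space X \<Longrightarrow> prob_space (\<Pi>\<^sub>M i\<in>I. snd X)"
  by (intro prob_space_PiM mm_spaceD)

lemma (in prob_space) integrable_unit_interval: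
  fixes f :: "'a \<Rightarrow> real"
  assumes "f \<in> borel_measurable M" "\<And>x. 0 \<le> f x" "\<And>x. f x \<le> 1"
  shows "integrable M f"
  using assms by (intro integrable_const_bound[of _ 1]) auto

lemma (in prob_space) integral_unit_interval:
  fixes f :: "'a \<Rightarrow> real"
  assumes "f \<in> borel_measurable M" "\<And>x. 0 \<le> f x" "\<And>x. f x \<le> 1"
  shows "0 \<le> (\<integral>x. f x \<partial>M)" "(\<integral>x. f x \<partial>M) \<le> 1"
  using assms integrable_unit_interval[OF assms] by (auto intro!: integral_le_const)

lemma semichar_pos:
  assumes X: "mm_space X" and es: "on_vertices k es"
  shows "semichar X k es > 0"
proof -
  interpret prob_space "sample k X" by (rule prob_space_PiM_mm[OF X])
  note m = edge_prod_measurable_PiM[OF X es]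
  have "semichar X k es \<noteq> 0"
    unfolding semichar_def
  proof
    assume "(\<integral>x. edge_prod (fst X) es x \<partial>sample k X) = 0"
    then have "AE x in (sample k X). edge_prod (fst X) es x = 0"
      using integral_nonneg_eq_0_iff_AE[OF integrable_unit_interval[OF m edge_prod_nonneg edge_prod_le_1]]
      by (simp add: edge_prod_nonneg)
    then have "AE x in (sample k X). False"
      by eventually_elim (use edge_prod_pos in \<open>metis less_irrefl\<close>)
    then show False by simp
  qed
  moreover have "semichar X k es \<ge> 0"
    unfolding semichar_def by (intro integral_nonneg_AE) (auto simp: edge_prod_nonneg)
  ultimately show ?thesis by simp
qed

subsection \<open>Multiplicativity\<close>

text \<open>A finite product of product measures is, after regrouping the coordinates, the product of the two
  finite products. On boxes of arbitrary measurable sets \<open>A i\<close> the inner integral factorises over the coordinates,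
  and then so does the outer one.\<close>

lemma PiM_pair_measure:
  assumes "prob_space M" "prob_space N" "finite I"
  shows "distr ((\<Pi>\<^sub>M i\<in>I. M) \<Otimes>\<^sub>M (\<Pi>\<^sub>M i\<in>I. N)) (\<Pi>\<^sub>M i\<in>I. M \<Otimes>\<^sub>M N) (\<lambda>p. \<lambda>i\<in>I. (fst p i, snd p i))
    = (\<Pi>\<^sub>M i\<in>I. M \<Otimes>\<^sub>M N)"
proof -
  interpret M: prob_space M by fact
  interpret N: prob_space N by fact
  interpret MN: pair_prob_space M N ..
  interpret PM: product_prob_space "\<lambda>_. M" I ..
  interpret PN: product_prob_space "\<lambda>_. N" I ..
  interpret PMN: product_prob_space "\<lambda>_. M \<Otimes>\<^sub>M N" I ..
  interpret PP: pair_prob_space "\<Pi>\<^sub>M i\<in>I. M" "\<Pi>\<^sub>M i\<in>I. N" ..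
  let ?T = "\<lambda>p. \<lambda>i\<in>I. (fst p i, snd p i)"
  have T: "?T \<in> measurable ((\<Pi>\<^sub>M i\<in>I. M) \<Otimes>\<^sub>M (\<Pi>\<^sub>M i\<in>I. N)) (\<Pi>\<^sub>M i\<in>I. M \<Otimes>\<^sub>M N)"
    by measurable
  show ?thesis
  proof (rule PMN.PiM_eqI)
    fix A assume A: "\<And>i. i \<in> I \<Longrightarrow> A i \<in> sets (M \<Otimes>\<^sub>M N)"
    then have [measurable]: "\<And>i. i \<in> I \<Longrightarrow> A i \<in> sets (M \<Otimes>\<^sub>M N)" .
    have box: "Pi\<^sub>E I A \<in> sets (\<Pi>\<^sub>M i\<in>I. M \<Otimes>\<^sub>M N)"
      using A \<open>finite I\<close> by (intro sets_PiM_I_finite) auto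
    let ?B = "?T -` Pi\<^sub>E I A \<inter> space ((\<Pi>\<^sub>M i\<in>I. M) \<Otimes>\<^sub>M (\<Pi>\<^sub>M i\<in>I. N))"
    have B: "?B \<in> sets ((\<Pi>\<^sub>M i\<in>I. M) \<Otimes>\<^sub>M (\<Pi>\<^sub>M i\<in>I. N))"
      using measurable_sets[OF T box] .
    have "emeasure (distr ((\<Pi>\<^sub>M i\<in>I. M) \<Otimes>\<^sub>M (\<Pi>\<^sub>M i\<in>I. N)) (\<Pi>\<^sub>M i\<in>I. M \<Otimes>\<^sub>M N) ?T) (Pi\<^sub>E I A)
        = emeasure ((\<Pi>\<^sub>M i\<in>I. M) \<Otimes>\<^sub>M (\<Pi>\<^sub>M i\<in>I. N)) ?B"
      using T box by (simp add: emeasure_distr)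
    also have "\<dots> = (\<integral>\<^sup>+x. \<integral>\<^sup>+y. indicator ?B (x, y) \<partial>(\<Pi>\<^sub>M i\<in>I. N) \<partial>(\<Pi>\<^sub>M i\<in>I. M))"
      using B by (rule PN.emeasure_pair_measure)
    also have "\<dots> = (\<integral>\<^sup>+x. \<integral>\<^sup>+y. (\<Prod>i\<in>I. indicator (A i) (x i, y i)) \<partial>(\<Pi>\<^sub>M i\<in>I. N) \<partial>(\<Pi>\<^sub>M i\<in>I. M))"
    proof (intro nn_integral_cong)
      fix x y assume "x \<in> space (\<Pi>\<^sub>M i\<in>I. M)" "y \<in> space (\<Pi>\<^sub>M i\<in>I. N)"
      then show "indicator ?B (x, y) = (\<Prod>i\<in>I. indicator (A i) (x i, y i) :: ennreal)"
        using \<open>finite I\<close> by (auto simp: indicator_def space_pair_measure PiE_iff prod_zero_iff)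
    qed
    also have "\<dots> = (\<integral>\<^sup>+x. (\<Prod>i\<in>I. \<integral>\<^sup>+t. indicator (A i) (x i, t) \<partial>N) \<partial>(\<Pi>\<^sub>M i\<in>I. M))"
    proof (intro nn_integral_cong)
      fix x assume x: "x \<in> space (\<Pi>\<^sub>M i\<in>I. M)"
      then have "x i \<in> space M" if "i \<in> I" for i
        using that by (auto simp: space_PiM)
      then show "(\<integral>\<^sup>+y. (\<Prod>i\<in>I. indicator (A i) (x i, y i)) \<partial>(\<Pi>\<^sub>M i\<in>I. N)) =
          (\<Prod>i\<in>I. \<integral>\<^sup>+t. indicator (A i) (x i, t) \<partial>N)"
        using \<open>finite I\<close> by (intro PN.product_nn_integral_prod) auto
    qed
    also have "\<dots> = (\<Prod>i\<in>I. \<integral>\<^sup>+s. \<integral>\<^sup>+t. indicator (A i) (s, t) \<partial>N \<partial>M)"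
      using \<open>finite I\<close> by (intro PM.product_nn_integral_prod) auto
    also have "\<dots> = (\<Prod>i\<in>I. emeasure (M \<Otimes>\<^sub>M N) (A i))"
      using A by (intro prod.cong) (auto simp: N.emeasure_pair_measure)
    finally show "emeasure (distr ((\<Pi>\<^sub>M i\<in>I. M) \<Otimes>\<^sub>M (\<Pi>\<^sub>M i\<in>I. N)) (\<Pi>\<^sub>M i\<in>I. M \<Otimes>\<^sub>M N) ?T) (Pi\<^sub>E I A)
        = (\<Prod>i\<in>I. emeasure (M \<Otimes>\<^sub>M N) (A i))" .
  qed (use \<open>finite I\<close> in auto)
qed

lemma edge_prod_boxplus:
  "edge_prod (sum_metric m1 m2) es (\<lambda>i. (x i, y i)) = edge_prod m1 es x * edge_prod m2 es y"
  by (induction es) (auto simp: exp_add[symmetric] algebra_simps)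

lemma semichar_boxplus:
  assumes Y: "mm_space Y" and Z: "mm_space Z" and es: "on_vertices k es"
  shows "semichar (Y \<boxplus> Z) k es = semichar Y k es * semichar Z k es"
proof -
  let ?I = "{..<k}" and ?M = "snd Y" and ?N = "snd Z"
  let ?PM = "\<Pi>\<^sub>M i\<in>?I. ?M" and ?PN = "\<Pi>\<^sub>M i\<in>?I. ?N" and ?PMN = "\<Pi>\<^sub>M i\<in>?I. ?M \<Otimes>\<^sub>M ?N"
  interpret M: prob_space ?PM by (rule prob_space_PiM_mm[OF Y])
  interpret N: prob_space ?PN by (rule prob_space_PiM_mm[OF Z])
  interpret PP: pair_prob_space ?PM ?PN ..
  let ?T = "\<lambda>p. \<lambda>i\<in>?I. (fst p i, snd p i)"
  have T: "?T \<in> measurable (?PM \<Otimes>\<^sub>M ?PN) ?PMN"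
    by measurable
  note mY = edge_prod_measurable_PiM[OF Y es] and mZ = edge_prod_measurable_PiM[OF Z es]
  have b: "fst (Y \<boxplus> Z) = sum_metric (fst Y) (fst Z)" "snd (Y \<boxplus> Z) = ?M \<Otimes>\<^sub>M ?N"
    by (auto simp: boxplus_def)
  have "semichar (Y \<boxplus> Z) k es = (\<integral>x. edge_prod (sum_metric (fst Y) (fst Z)) es x \<partial>distr (?PM \<Otimes>\<^sub>M ?PN) ?PMN ?T)"
    unfolding semichar_def b
    by (subst PiM_pair_measure) (use Y Z in \<open>auto intro: mm_spaceD\<close>)
  also have "\<dots> = (\<integral>p. edge_prod (sum_metric (fst Y) (fst Z)) es (?T p) \<partial>(?PM \<Otimes>\<^sub>M ?PN))"
    using edge_prod_measurable_PiM[OF mm_space_boxplus[OF Y Z] es] T unfolding b by (intro integral_distr) auto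
  also have "\<dots> = (\<integral>p. edge_prod (fst Y) es (fst p) * edge_prod (fst Z) es (snd p) \<partial>(?PM \<Otimes>\<^sub>M ?PN))"
    unfolding edge_prod_boxplus[symmetric] by (intro Bochner_Integration.integral_cong edge_prod_cong[OF es]) auto
  also have "\<dots> = (\<integral>x. \<integral>y. edge_prod (fst Y) es x * edge_prod (fst Z) es y \<partial>?PN \<partial>?PM)"
  proof -
    have "integrable (?PM \<Otimes>\<^sub>M ?PN) (\<lambda>p. edge_prod (fst Y) es (fst p) * edge_prod (fst Z) es (snd p))"
      using mY mZ by (intro PP.integrable_unit_interval)
        (auto simp: edge_prod_nonneg edge_prod_le_1 mult_le_one)
    from PP.integral_fst'[OF this] show ?thesis by simp
  qed
  also have "\<dots> = semichar Y k es * semichar Z k es"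
    by (simp add: semichar_def)
  finally show ?thesis .
qed

subsection \<open>Continuity\<close>

text \<open>Counting the points of the grid \<open>j / N\<close> below \<open>t\<close> recovers \<open>t\<close> up to \<open>1 / N\<close>. This is a discrete form
  of the layer-cake formula: it expresses integrals by the measures of superlevel sets.\<close>

lemma count_grid_ge:
  assumes "0 \<le> t" "t \<le> 1" "N > 0"
  shows "t \<le> (\<Sum>j<N. if real j / real N < t then 1 / real N else 0)"
proof -
  let ?m = "nat \<lceil>real N * t\<rceil>"
  have "real N * t \<le> real N"
    using assms by (simp add: mult_le_cancel_left1)
  then have m: "?m \<le> N"
    by (simp add: ceiling_le_iff)
  have "t = real N * t / real N"
    using assms by simp
  also have "\<dots> \<le> real ?m / real N"
    by (intro divide_right_mono) (auto intro: real_nat_ceiling_ge)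
  also have "\<dots> = (\<Sum>j<?m. 1 / real N)"
    by simp
  also have "\<dots> = (\<Sum>j<?m. if real j / real N < t then 1 / real N else 0)"
  proof (intro sum.cong refl)
    fix j assume "j \<in> {..<?m}"
    then have "int j < \<lceil>real N * t\<rceil>" by auto
    then have "real j < real N * t" by (simp add: less_ceiling_iff)
    then show "1 / real N = (if real j / real N < t then 1 / real N else 0)"
      using assms by (auto simp: field_simps)
  qed
  also have "\<dots> \<le> (\<Sum>j<N. if real j / real N < t then 1 / real N else 0)"
    using m by (intro sum_mono2) auto
  finally show ?thesis .
qed

lemma count_grid_le:
  assumes "0 \<le> t" "N > 0"
  shows "(\<Sum>j<N. if real j / real N < t then 1 / real N else 0) \<le> t + 1 / real N"
proof -
  let ?m = "nat \<lceil>real N * t\<rceil>"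
  have "(\<Sum>j<N. if real j / real N < t then 1 / real N else 0) =
      (\<Sum>j\<in>{j\<in>{..<N}. real j / real N < t}. 1 / real N)"
    by (rule sum.inter_filter[symmetric]) simp
  also have "\<dots> \<le> (\<Sum>j<?m. 1 / real N)"
  proof (rule sum_mono2)
    show "{j \<in> {..<N}. real j / real N < t} \<subseteq> {..<?m}"
    proof
      fix j assume "j \<in> {j \<in> {..<N}. real j / real N < t}"
      then have "real j < real N * t"
        using assms by (auto simp: field_simps)
      then have "int j < \<lceil>real N * t\<rceil>" by (simp add: less_ceiling_iff)
      then show "j \<in> {..<?m}" by auto
    qed
  qed auto
  also have "\<dots> = real ?m / real N" by simp
  also have "\<dots> \<le> (real N * t + 1) / real N"
    using assms by (intro divide_right_mono) (auto simp: of_nat_nat)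
  also have "\<dots> = t + 1 / real N"
    using assms by (simp add: field_simps)
  finally show ?thesis .
qed

text \<open>If \<open>f x > t\<close> and \<open>d x y < \<epsilon>\<close> then \<open>g y + L * \<epsilon> + c > t\<close>, so the Prohorov condition compares the measures
  of the superlevel sets of \<open>f\<close> with those of \<open>g + L * \<epsilon> + c\<close>. Summation over the grid turns this into a
  comparison of the integrals.\<close>

lemma integral_le_cross_dominates:
  assumes X: "mm_space X" and Y: "mm_space Y" and d: "cross_metric (fst X) (fst Y) d"
    and dom: "cross_dominates X Y d \<epsilon>"
    and f: "f \<in> borel_measurable (snd X)" "\<And>x. 0 \<le> f x" "\<And>x. f x \<le> 1"
    and g: "g \<in> borel_measurable (snd Y)" "\<And>y. 0 \<le> g y" "\<And>y. g y \<le> 1"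
    and pos: "0 \<le> L" "0 \<le> c" "0 < \<epsilon>"
    and le: "\<And>x y. x \<in> points X \<Longrightarrow> y \<in> points Y \<Longrightarrow> f x \<le> g y + L * d x y + c"
  shows "(\<integral>x. f x \<partial>snd X) \<le> (\<integral>y. g y \<partial>snd Y) + c + (L + 1) * \<epsilon>"
proof (rule field_le_epsilon)
  interpret X: prob_space "snd X" using X by (rule mm_spaceD)
  interpret Y: prob_space "snd Y" using Y by (rule mm_spaceD)
  note [measurable] = f(1) g(1)
  fix \<delta> :: real assume "\<delta> > 0"
  then obtain N :: nat where N: "N > 0" "1 / real N < \<delta>"
    by (metis nat_approx_posE zero_less_Suc)
  let ?h = "\<lambda>y. g y + L * \<epsilon> + c"
  have h0: "0 \<le> ?h y" for y
    using g(2) pos by simp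
  let ?A = "\<lambda>t. {x \<in> space (snd X). t < f x}" and ?B = "\<lambda>t. {y \<in> space (snd Y). t < ?h y}"
  have AB: "mass X (?A t) \<le> mass Y (?B t) + \<epsilon>" for t
  proof -
    have "mass X (?A t) \<le> mass Y {y \<in> points Y. \<exists>x\<in>?A t. d x y < \<epsilon>} + \<epsilon>"
    proof -
      have "?A t \<in> sets (snd X)" by measurable
      then show ?thesis using dom unfolding cross_dominates_def by blast
    qed
    also have "mass Y {y \<in> points Y. \<exists>x\<in>?A t. d x y < \<epsilon>} \<le> mass Y (?B t)"
    proof (rule Y.finite_measure_mono)
      show "{y \<in> points Y. \<exists>x\<in>?A t. d x y < \<epsilon>} \<subseteq> ?B t"
      proof
        fix y assume "y \<in> {y \<in> points Y. \<exists>x\<in>?A t. d x y < \<epsilon>}"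
        then obtain x where x: "y \<in> points Y" "x \<in> points X" "t < f x" "d x y < \<epsilon>"
          using mm_spaceD(4)[OF X] by auto
        have "L * d x y \<le> L * \<epsilon>"
          using x pos by (intro mult_left_mono) auto
        then show "y \<in> ?B t"
          using le[OF x(2,1)] x mm_spaceD(4)[OF Y] by auto
      qed
    qed measurable
    finally show ?thesis by simp
  qed
  have ind: "(\<integral>x. (if t < f x then 1 / real N else 0) \<partial>snd X) = mass X (?A t) / real N" for t
  proof -
    have "(\<integral>x. (if t < f x then 1 / real N else 0) \<partial>snd X) = (\<integral>x. indicator (?A t) x * (1 / real N) \<partial>snd X)"
      by (intro Bochner_Integration.integral_cong) (auto simp: indicator_def)
    then show ?thesis by simp
  qed
  have ind2: "(\<integral>x. (if t < ?h x then 1 / real N else 0) \<partial>snd Y) = mass Y (?B t) / real N" for t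
  proof -
    have "(\<integral>x. (if t < ?h x then 1 / real N else 0) \<partial>snd Y) = (\<integral>x. indicator (?B t) x * (1 / real N) \<partial>snd Y)"
      by (intro Bochner_Integration.integral_cong) (auto simp: indicator_def)
    then show ?thesis by simp
  qed
  have intX: "integrable (snd X) (\<lambda>x. if t < f x then 1 / real N else 0)" for t
    by (intro X.integrable_const_bound[of _ "1 / real N"]) auto
  have intY: "integrable (snd Y) (\<lambda>x. if t < ?h x then 1 / real N else 0)" for t
    by (intro Y.integrable_const_bound[of _ "1 / real N"]) auto
  have ig: "integrable (snd Y) g"
    using g by (intro Y.integrable_unit_interval)
  have "(\<integral>x. f x \<partial>snd X) \<le> (\<integral>x. (\<Sum>j<N. if real j / real N < f x then 1 / real N else 0) \<partial>snd X)"
    using f count_grid_ge N intX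
    by (intro integral_mono X.integrable_unit_interval Bochner_Integration.integrable_sum) auto
  also have "\<dots> = (\<Sum>j<N. mass X (?A (real j / real N)) / real N)"
    using intX by (simp add: Bochner_Integration.integral_sum ind)
  also have "\<dots> \<le> (\<Sum>j<N. mass Y (?B (real j / real N)) / real N + \<epsilon> / real N)"
    using AB by (intro sum_mono) (auto simp: add_divide_distrib[symmetric] intro!: divide_right_mono)
  also have "\<dots> = (\<Sum>j<N. mass Y (?B (real j / real N)) / real N) + \<epsilon>"
    using N by (simp add: sum.distrib)
  also have "(\<Sum>j<N. mass Y (?B (real j / real N)) / real N) =
      (\<integral>y. (\<Sum>j<N. if real j / real N < ?h y then 1 / real N else 0) \<partial>snd Y)"
    using intY by (simp add: Bochner_Integration.integral_sum ind2)
  also have "\<dots> \<le> (\<integral>y. ?h y + 1 / real N \<partial>snd Y)"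
    using ig intY count_grid_le[OF h0 N(1)]
    by (intro integral_mono Bochner_Integration.integrable_sum Bochner_Integration.integrable_add) auto
  also have "\<dots> = (\<integral>y. g y \<partial>snd Y) + L * \<epsilon> + c + 1 / real N"
    using ig Y.prob_space by simp
  finally show "(\<integral>x. f x \<partial>snd X) \<le> (\<integral>y. g y \<partial>snd Y) + c + (L + 1) * \<epsilon> + \<delta>"
    using N by (simp add: algebra_simps)
qed

lemma integral_PiM_Suc:
  fixes F :: "(nat \<Rightarrow> 'a) \<Rightarrow> real"
  assumes M: "prob_space M" and F: "F \<in> borel_measurable (\<Pi>\<^sub>M i\<in>{..<Suc k}. M)"
    and b: "\<And>x. 0 \<le> F x" "\<And>x. F x \<le> 1"
  shows "(\<lambda>x. \<integral>t. F (x(k := t)) \<partial>M) \<in> borel_measurable (\<Pi>\<^sub>M i\<in>{..<k}. M)"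
    and "x \<in> space (\<Pi>\<^sub>M i\<in>{..<k}. M) \<Longrightarrow> (\<lambda>t. F (x(k := t))) \<in> borel_measurable M"
    and "(\<integral>x. F x \<partial>(\<Pi>\<^sub>M i\<in>{..<Suc k}. M)) = (\<integral>x. \<integral>t. F (x(k := t)) \<partial>M \<partial>(\<Pi>\<^sub>M i\<in>{..<k}. M))"
proof -
  interpret M: prob_space M by fact
  interpret P: product_prob_space "\<lambda>_. M" "UNIV :: nat set" ..
  interpret PS: prob_space "\<Pi>\<^sub>M i\<in>{..<Suc k}. M" by (intro prob_space_PiM M)
  have eq: "{..<Suc k} = insert k {..<k}" by auto
  have "(\<lambda>(x, t). x(k := t)) \<in> measurable ((\<Pi>\<^sub>M i\<in>{..<k}. M) \<Otimes>\<^sub>M M) (\<Pi>\<^sub>M i\<in>{..<Suc k}. M)"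
    unfolding eq by (rule measurable_add_dim)
  then have m: "(\<lambda>p. F ((fst p)(k := snd p))) \<in> borel_measurable ((\<Pi>\<^sub>M i\<in>{..<k}. M) \<Otimes>\<^sub>M M)"
    using measurable_compose[OF _ F] by (auto simp: case_prod_unfold)
  then show "(\<lambda>x. \<integral>t. F (x(k := t)) \<partial>M) \<in> borel_measurable (\<Pi>\<^sub>M i\<in>{..<k}. M)"
    by (intro M.borel_measurable_lebesgue_integral) (simp add: case_prod_unfold)
  show "(\<lambda>t. F (x(k := t))) \<in> borel_measurable M" if "x \<in> space (\<Pi>\<^sub>M i\<in>{..<k}. M)"
    using measurable_compose[OF measurable_Pair1'[OF that] m] by simp
  show "(\<integral>x. F x \<partial>(\<Pi>\<^sub>M i\<in>{..<Suc k}. M)) = (\<integral>x. \<integral>t. F (x(k := t)) \<partial>M \<partial>(\<Pi>\<^sub>M i\<in>{..<k}. M))"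
    using PS.integrable_unit_interval[OF F b] unfolding eq
    by (intro P.product_integral_insert) auto
qed

text \<open>The coordinates are exchanged one at a time: integrating out the last coordinate preserves the
  shape of the hypothesis and only increases the constant \<open>c\<close> by \<open>(L + 1) * \<epsilon>\<close>.\<close>

lemma integral_PiM_le_cross_dominates:
  fixes X :: "'a mms" and Y :: "'b mms"
  assumes X: "mm_space X" and Y: "mm_space Y" and d: "cross_metric (fst X) (fst Y) d"
    and dom: "cross_dominates X Y d \<epsilon>" and pos: "0 \<le> L" "0 < \<epsilon>"
  shows "\<lbrakk>F \<in> borel_measurable (sample k X); \<And>x. 0 \<le> F x; \<And>x. F x \<le> 1;
    G \<in> borel_measurable (sample k Y); \<And>y. 0 \<le> G y; \<And>y. G y \<le> 1; 0 \<le> c;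
    \<And>x y. x \<in> space (sample k X) \<Longrightarrow> y \<in> space (sample k Y) \<Longrightarrow>
      F x \<le> G y + L * (\<Sum>i<k. d (x i) (y i)) + c\<rbrakk>
   \<Longrightarrow> (\<integral>x. F x \<partial>sample k X) \<le> (\<integral>y. G y \<partial>sample k Y) + c + real k * ((L + 1) * \<epsilon>)"
proof (induction k arbitrary: F G c)
  case 0
  let ?u = "\<lambda>_. undefined"
  have "F ?u \<le> G ?u + c"
    using "0.prems"(8)[of ?u ?u] by (simp add: space_PiM)
  moreover have "(\<integral>x. F x \<partial>(\<Pi>\<^sub>M i\<in>{..<0::nat}. snd X)) = F ?u" "(\<integral>x. G x \<partial>(\<Pi>\<^sub>M i\<in>{..<0::nat}. snd Y)) = G ?u"
    by (simp_all add: PiM_empty lebesgue_integral_count_space_finite)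
  ultimately show ?case by simp
next
  case (Suc k)
  interpret X: prob_space "snd X" using X by (rule mm_spaceD)
  interpret Y: prob_space "snd Y" using Y by (rule mm_spaceD)
  note FS = integral_PiM_Suc[OF mm_spaceD(3)[OF X] Suc.prems(1-3)]
  note GS = integral_PiM_Suc[OF mm_spaceD(3)[OF Y] Suc.prems(4-6)]
  \<comment> \<open>The inner integrals are set to \<open>0\<close> outside the product space, since the induction hypothesis asks for values
    in the unit interval everywhere.\<close>
  define F' where "F' x = (if x \<in> space (sample k X) then \<integral>t. F (x(k := t)) \<partial>snd X else 0)" for x
  define G' where "G' y = (if y \<in> space (sample k Y) then \<integral>t. G (y(k := t)) \<partial>snd Y else 0)" for y
  have "(\<integral>x. F' x \<partial>sample k X) \<le>
      (\<integral>y. G' y \<partial>sample k Y) + (c + (L + 1) * \<epsilon>) + real k * ((L + 1) * \<epsilon>)"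
  proof (rule Suc.IH)
    show "F' \<in> borel_measurable (sample k X)"
      using FS(1) by (rule subst[OF measurable_cong, rotated]) (simp add: F'_def fun_upd_def)
    show "G' \<in> borel_measurable (sample k Y)"
      using GS(1) by (rule subst[OF measurable_cong, rotated]) (simp add: G'_def fun_upd_def)
    show "0 \<le> F' x" "F' x \<le> 1" for x
      unfolding F'_def by (auto intro: X.integral_unit_interval[OF FS(2) Suc.prems(2,3)])
    show "0 \<le> G' y" "G' y \<le> 1" for y
      unfolding G'_def by (auto intro: Y.integral_unit_interval[OF GS(2) Suc.prems(5,6)])
    show "0 \<le> c + (L + 1) * \<epsilon>"
      using Suc.prems(7) pos by simp
    fix x y assume x: "x \<in> space (sample k X)" and y: "y \<in> space (sample k Y)"
    let ?s = "L * (\<Sum>i<k. d (x i) (y i))"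
    have xy: "x i \<in> points X" "y i \<in> points Y" if "i < k" for i
      using x y that mm_spaceD(4)[OF X] mm_spaceD(4)[OF Y] by (auto simp: space_PiM)
    have s: "0 \<le> (\<Sum>i<k. d (x i) (y i))"
      using d xy unfolding cross_metric_def by (intro sum_nonneg) auto
    have "F (x(k := t)) \<le> G (y(k := u)) + L * d t u + (?s + c)"
      if t: "t \<in> points X" and u: "u \<in> points Y" for t u
    proof -
      have "x(k := t) \<in> space (sample (Suc k) X)" "y(k := u) \<in> space (sample (Suc k) Y)"
        using x y t u mm_spaceD(4)[OF X] mm_spaceD(4)[OF Y]
        by (auto simp: space_PiM PiE_iff extensional_def less_Suc_eq)
      from Suc.prems(8)[OF this] show ?thesis
        by (simp add: algebra_simps fun_upd_def)
    qed
    then have "(\<integral>t. F (x(k := t)) \<partial>snd X) \<le> (\<integral>u. G (y(k := u)) \<partial>snd Y) + (?s + c) + (L + 1) * \<epsilon>"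
      using pos s Suc.prems(7)
      by (intro integral_le_cross_dominates[OF X Y d dom] FS(2)[OF x] GS(2)[OF y] Suc.prems(2,3,5,6)) auto
    then show "F' x \<le> G' y + ?s + (c + (L + 1) * \<epsilon>)"
      using x y by (simp add: F'_def G'_def)
  qed
  moreover have "(\<integral>x. F' x \<partial>sample k X) = (\<integral>x. F x \<partial>(sample (Suc k) X))"
    unfolding FS(3) by (intro Bochner_Integration.integral_cong) (auto simp: F'_def)
  moreover have "(\<integral>x. G' x \<partial>sample k Y) = (\<integral>x. G x \<partial>(sample (Suc k) Y))"
    unfolding GS(3) by (intro Bochner_Integration.integral_cong) (auto simp: G'_def)
  ultimately show ?case
    by (simp add: algebra_simps)
qed

lemma semichar_le_cross_dominates:
  assumes X: "mm_space X" and Y: "mm_space Y" and d: "cross_metric (fst X) (fst Y) d"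
    and dom: "cross_dominates X Y d \<epsilon>" and "0 < \<epsilon>" and es: "on_vertices k es"
  shows "semichar X k es \<le> semichar Y k es + real k * ((2 * real (length es) + 1) * \<epsilon>)"
proof -
  let ?n = "real (length es)"
  have "semichar X k es \<le> semichar Y k es + 0 + real k * ((2 * ?n + 1) * \<epsilon>)"
    unfolding semichar_def
  proof (rule integral_PiM_le_cross_dominates[OF X Y d dom])
    fix x y assume x: "x \<in> space (sample k X)" and y: "y \<in> space (sample k Y)"
    have xy: "x i \<in> points X" "y i \<in> points Y" if "i < k" for i
      using x y that mm_spaceD(4)[OF X] mm_spaceD(4)[OF Y] by (auto simp: space_PiM)
    let ?s = "\<Sum>i<k. d (x i) (y i)"
    have s: "d (x i) (y i) \<le> ?s" if "i < k" for i
      using d xy that unfolding cross_metric_def by (intro member_le_sum) auto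
    have "\<bar>rdist X (x i) (x j) - rdist Y (y i) (y j)\<bar> \<le> 2 * ?s" if "i < k" "j < k" for i j
    proof -
      have "rdist X (x i) (x j) \<le> d (x i) (y i) + d (x j) (y i)"
        "d (x j) (y i) \<le> d (x j) (y j) + rdist Y (y j) (y i)"
        "rdist Y (y i) (y j) \<le> d (x i) (y i) + d (x i) (y j)"
        "d (x i) (y j) \<le> rdist X (x i) (x j) + d (x j) (y j)"
        using d xy[OF that(1)] xy[OF that(2)] unfolding cross_metric_def by blast+
      then show ?thesis
        using s[OF that(1)] s[OF that(2)] mdist_commute[of "fst Y" "y j" "y i"] by linarith
    qed
    then have "\<bar>edge_prod (fst X) es x - edge_prod (fst Y) es y\<bar> \<le> ?n * (2 * ?s)"
      using es by (intro edge_prod_lipschitz) auto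
    then show "edge_prod (fst X) es x \<le> edge_prod (fst Y) es y + 2 * ?n * ?s + 0"
      by simp
  qed (use \<open>0 < \<epsilon>\<close> edge_prod_measurable_PiM[OF X es] edge_prod_measurable_PiM[OF Y es]
      in \<open>auto simp: edge_prod_nonneg edge_prod_le_1\<close>)
  then show ?thesis by simp
qed

lemma semichar_tendsto:
  assumes X: "\<And>n. mm_space (Xs n)" "mm_space X" and lim: "GPr_lim Xs X"
    and es: "on_vertices k es"
  shows "(\<lambda>n. semichar (Xs n) k es) \<longlonglongrightarrow> semichar X k es"
proof -
  let ?C = "real k * (2 * real (length es) + 1)"
  have ev: "\<bar>semichar (Xs n) k es - semichar X k es\<bar> \<le> ?C * (GPr_dist (Xs n) X + 1 / real (Suc n))" for n
  proof -
    let ?e = "GPr_dist (Xs n) X + 1 / real (Suc n)"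
    have e: "?e > 0"
      using GPr_dist_nonneg[OF X(1) X(2), of n] by (intro add_nonneg_pos) auto
    obtain d where d: "cross_metric (fst (Xs n)) (fst X) d" "cross_dominates (Xs n) X d ?e"
      "cross_dominates X (Xs n) (\<lambda>y x. d x y) ?e"
      by (rule GPr_dist_less_cross[OF X(1) X(2), of n ?e]) auto
    show ?thesis
      using semichar_le_cross_dominates[OF X(1) X(2) d(1,2) e es]
        semichar_le_cross_dominates[OF X(2) X(1) cross_metric_flip[OF d(1)] d(3) e es]
      by (simp add: algebra_simps abs_le_iff)
  qed
  have "(\<lambda>n. ?C * (GPr_dist (Xs n) X + 1 / real (Suc n))) \<longlonglongrightarrow> ?C * (0 + 0)"
    using lim unfolding GPr_lim_def by (intro tendsto_intros LIMSEQ_Suc[OF lim_1_over_n])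
  then have "(\<lambda>n. ?C * (GPr_dist (Xs n) X + 1 / real (Suc n))) \<longlonglongrightarrow> 0"
    by simp
  then have "(\<lambda>n. semichar (Xs n) k es - semichar X k es) \<longlonglongrightarrow> 0"
    by (rule Lim_null_comparison[rotated]) (use ev in auto)
  then show ?thesis
    by (simp add: LIM_zero_iff)
qed

section \<open>Diagonal subsequences, extension of short maps, moment problem\<close>

text \<open>The diagonal sequence satisfies the \<open>n\<close>-th property only from its \<open>n\<close>-th term on; hence the assumption that
  the properties do not depend on initial segments.\<close>

lemma diagonal_subsequence:
  fixes Q :: "nat \<Rightarrow> (nat \<Rightarrow> nat) \<Rightarrow> bool"
  assumes ex: "\<And>n (s :: nat \<Rightarrow> nat). strict_mono s \<Longrightarrow> \<exists>r :: nat \<Rightarrow> nat. strict_mono r \<and> Q n (s \<circ> r)"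
    and sub: "\<And>n s (r :: nat \<Rightarrow> nat). strict_mono r \<Longrightarrow> Q n s \<Longrightarrow> Q n (s \<circ> r)"
    and tail: "\<And>n s k. Q n (s \<circ> (+) k) \<Longrightarrow> Q n s"
  obtains s :: "nat \<Rightarrow> nat" where "strict_mono s" "\<And>n. Q n s"
proof -
  interpret subseqs Q using ex by unfold_locales blast
  show ?thesis
    using that[of diagseq] subseq_diagseq tail[OF diagseq_holds[OF sub]] by blast
qed

text \<open>The image of \<open>x\<close> is characterised by lying within \<open>r (x, q\<^sub>j)\<close> of \<open>s\<^sub>j\<close> for all \<open>j\<close>. Any choice of points with this
  property is automatically short and extends \<open>s\<close>.\<close>

lemma short_map_extension:
  assumes q: "dense_seq m q" and m': "mcomplete_of m'" and s: "\<And>i. s i \<in> mspace m'"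
    and short: "\<And>i j. mdist m' (s i) (s j) \<le> mdist m (q i) (q j)"
  obtains f where "f \<in> mspace m \<rightarrow> mspace m'" "\<And>i. f (q i) = s i"
    "\<And>x y. x \<in> mspace m \<Longrightarrow> y \<in> mspace m \<Longrightarrow> mdist m' (f x) (f y) \<le> mdist m x y"
proof -
  have q': "q i \<in> mspace m" for i
    using q by (simp add: dense_seq_def)
  have "\<exists>l\<in>mspace m'. \<forall>j. mdist m' l (s j) \<le> mdist m x (q j)" if x: "x \<in> mspace m" for x
  proof -
    have "\<forall>n. \<exists>i. mdist m x (q i) < 1 / real (Suc n)"
      using q x unfolding dense_seq_def by simp
    then obtain i where i: "\<And>n. mdist m x (q (i n)) < 1 / real (Suc n)"
      by metis
    have conv: "(\<lambda>n. mdist m x (q (i n))) \<longlonglongrightarrow> 0"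
      by (rule real_tendsto_sandwich[OF _ _ tendsto_const LIMSEQ_Suc[OF lim_1_over_n]])
        (use less_imp_le[OF i] in \<open>auto intro!: always_eventually\<close>)
    have "\<exists>N. \<forall>a\<ge>N. \<forall>b\<ge>N. mdist m' (s (i a)) (s (i b)) < e" if "e > 0" for e
    proof -
      have "eventually (\<lambda>n. mdist m x (q (i n)) < e / 2) sequentially"
        using conv that by (intro order_tendstoD) auto
      then obtain N where N: "\<And>n. n \<ge> N \<Longrightarrow> mdist m x (q (i n)) < e / 2"
        by (auto simp: eventually_sequentially)
      have "mdist m' (s (i a)) (s (i b)) < e" if "a \<ge> N" "b \<ge> N" for a b
        using short[of "i a" "i b"] mdist_triangle[OF q' x q', of "i a" "i b"] N[OF that(1)] N[OF that(2)]
        by (simp add: mdist_commute)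
      then show ?thesis by blast
    qed
    then obtain l where l: "l \<in> mspace m'" "(\<lambda>n. mdist m' (s (i n)) l) \<longlonglongrightarrow> 0"
      by (rule mcomplete_ofD[OF m' s])
    have "mdist m' l (s j) \<le> mdist m x (q j)" for j
    proof (rule LIMSEQ_le_const)
      show "(\<lambda>n. mdist m' (s (i n)) l + mdist m x (q (i n)) + mdist m x (q j)) \<longlonglongrightarrow> mdist m x (q j)"
        using tendsto_add[OF tendsto_add[OF l(2) conv] tendsto_const] by simp
      show "\<exists>N. \<forall>n\<ge>N. mdist m' l (s j) \<le> mdist m' (s (i n)) l + mdist m x (q (i n)) + mdist m x (q j)"
      proof (intro exI allI impI)
        fix n
        show "mdist m' l (s j) \<le> mdist m' (s (i n)) l + mdist m x (q (i n)) + mdist m x (q j)"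
          using mdist_triangle[OF l(1) s[of "i n"] s[of j]] short[of "i n" j]
            mdist_triangle[OF q'[of "i n"] x q'[of j]]
            mdist_commute[of m' l "s (i n)"] mdist_commute[of m x "q (i n)"] by linarith
      qed
    qed
    then show ?thesis using l by blast
  qed
  then obtain f where f: "\<And>x. x \<in> mspace m \<Longrightarrow> f x \<in> mspace m'"
    "\<And>x j. x \<in> mspace m \<Longrightarrow> mdist m' (f x) (s j) \<le> mdist m x (q j)"
    by metis
  show ?thesis
  proof (rule that[of f])
    show "f \<in> mspace m \<rightarrow> mspace m'"
      using f by auto
    show "f (q i) = s i" for i
      using f(2)[OF q', of i i] f(1)[OF q'] s[of i] mdist_nonneg[of m' "f (q i)" "s i"]
      by (simp add: mdist_self[OF q'])
    show "mdist m' (f x) (f y) \<le> mdist m x y" if xy: "x \<in> mspace m" "y \<in> mspace m" for x y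
    proof (rule field_le_epsilon)
      fix e :: real assume "e > 0"
      then obtain j where j: "mdist m x (q j) < e / 2"
        using q xy unfolding dense_seq_def by (meson half_gt_zero)
      show "mdist m' (f x) (f y) \<le> mdist m x y + e"
        using mdist_triangle[OF f(1) s f(1), of x y j] f(2)[of x j] f(2)[of y j] xy j
          mdist_triangle[OF xy(2,1) q', of j] mdist_commute[of m' "f y" "s j"] mdist_commute[of m x y]
        by linarith
    qed
  qed
qed

lemma prod_list_unit_interval:
  fixes h :: "'c \<Rightarrow> real"
  assumes "\<And>i. i \<in> set js \<Longrightarrow> 0 \<le> h i" "\<And>i. i \<in> set js \<Longrightarrow> h i \<le> 1"
  shows "0 \<le> (\<Prod>i\<leftarrow>js. h i)" "(\<Prod>i\<leftarrow>js. h i) \<le> 1"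
proof -
  show *: "0 \<le> (\<Prod>i\<leftarrow>js. h i)"
    using assms(1) by (induction js) auto
  show "(\<Prod>i\<leftarrow>js. h i) \<le> 1"
    using assms by (induction js) (auto intro!: mult_le_one prod_list_nonneg)
qed

lemma prod_list_replicate_map: "(\<Prod>i\<leftarrow>replicate p j. h i) = (h j :: 'c :: comm_monoid_mult) ^ p"
  by (induction p) auto

lemma (in prob_space) weighted_integrable:
  fixes f w g :: "_ \<Rightarrow> real"
  assumes [measurable]: "f \<in> borel_measurable M" "w \<in> borel_measurable M" "g \<in> borel_measurable borel"
    and f01: "\<And>x. 0 \<le> f x" "\<And>x. f x \<le> 1" and w01: "\<And>x. 0 \<le> w x" "\<And>x. w x \<le> 1"
    and g: "\<And>t. t \<in> {0..1} \<Longrightarrow> \<bar>g t\<bar> \<le> B"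
  shows "integrable M (\<lambda>x. w x * g (f x))"
proof (rule integrable_const_bound[of _ B])
  show "AE x in M. norm (w x * g (f x)) \<le> B"
  proof (intro AE_I2)
    fix x
    have "\<bar>w x\<bar> * \<bar>g (f x)\<bar> \<le> 1 * B"
      using w01 f01 g by (intro mult_mono) auto
    then show "norm (w x * g (f x)) \<le> B" by (simp add: abs_mult)
  qed
qed measurable

lemma (in prob_space) weighted_integral_close:
  fixes f w g r :: "_ \<Rightarrow> real"
  assumes f: "f \<in> borel_measurable M" "\<And>x. 0 \<le> f x" "\<And>x. f x \<le> 1"
    and w: "w \<in> borel_measurable M" "\<And>x. 0 \<le> w x" "\<And>x. w x \<le> 1"
    and g: "g \<in> borel_measurable borel" "\<And>t. t \<in> {0..1} \<Longrightarrow> \<bar>g t\<bar> \<le> B"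
    and r: "r \<in> borel_measurable borel" "\<And>t. t \<in> {0..1} \<Longrightarrow> \<bar>g t - r t\<bar> < e"
  shows "\<bar>(\<integral>x. w x * g (f x) \<partial>M) - (\<integral>x. w x * r (f x) \<partial>M)\<bar> \<le> e"
proof -
  have rB: "\<bar>r t\<bar> \<le> B + e" if "t \<in> {0..1}" for t
    using r(2)[OF that] g(2)[OF that] by linarith
  have ig: "integrable M (\<lambda>x. w x * g (f x))"
    by (rule weighted_integrable[OF f(1) w(1) g(1) f(2,3) w(2,3) g(2)])
  have ir: "integrable M (\<lambda>x. w x * r (f x))"
    by (rule weighted_integrable[OF f(1) w(1) r(1) f(2,3) w(2,3) rB])
  have "\<bar>\<integral>x. w x * g (f x) - w x * r (f x) \<partial>M\<bar> \<le> (\<integral>x. e \<partial>M)"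
  proof (rule integral_abs_bound[THEN order_trans], rule integral_mono)
    show "integrable M (\<lambda>x. \<bar>w x * g (f x) - w x * r (f x)\<bar>)"
      using ig ir by auto
    fix x
    have "\<bar>w x\<bar> * \<bar>g (f x) - r (f x)\<bar> \<le> 1 * e"
      using w f r(2)[of "f x"] by (intro mult_mono) auto
    then show "\<bar>w x * g (f x) - w x * r (f x)\<bar> \<le> e"
      by (simp add: abs_mult flip: right_diff_distrib)
  qed simp
  then show ?thesis
    using ig ir by (simp add: prob_space)
qed

lemma (in prob_space) emeasure_weighted_law:
  fixes f w :: "_ \<Rightarrow> real"
  assumes f [measurable]: "f \<in> borel_measurable M" and f01: "\<And>x. 0 \<le> f x" "\<And>x. f x \<le> 1"
    and w [measurable]: "w \<in> borel_measurable M" and w01: "\<And>x. 0 \<le> w x" "\<And>x. w x \<le> 1"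
    and B [measurable]: "B \<in> sets borel"
  shows "emeasure (distr (density M w) borel f) B = ennreal (\<integral>x. w x * indicator B (f x) \<partial>M)"
proof -
  have "emeasure (distr (density M w) borel f) B = (\<integral>\<^sup>+x. ennreal (w x) * indicator (f -` B \<inter> space M) x \<partial>M)"
    by (simp add: emeasure_distr emeasure_density)
  also have "\<dots> = (\<integral>\<^sup>+x. ennreal (w x * indicator B (f x)) \<partial>M)"
    using w01 by (intro nn_integral_cong) (auto simp: indicator_def)
  also have "\<dots> = ennreal (\<integral>x. w x * indicator B (f x) \<partial>M)"
    using w01 by (intro nn_integral_eq_integral weighted_integrable[OF f w _ f01 w01, of _ 1])
      (auto simp: indicator_def)
  finally show ?thesis .
qed

lemma (in prob_space) weighted_halfline_limit:
  fixes f w :: "_ \<Rightarrow> real"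
  assumes [measurable]: "f \<in> borel_measurable M" "w \<in> borel_measurable M"
    and w01: "\<And>x. 0 \<le> w x" "\<And>x. w x \<le> 1"
  shows "(\<lambda>n. \<integral>x. w x * min 1 (real n * max 0 (f x - c)) \<partial>M) \<longlonglongrightarrow> (\<integral>x. w x * indicator {c<..} (f x) \<partial>M)"
proof (rule integral_dominated_convergence[where w = "\<lambda>_. 1"])
  show "AE x in M. norm (w x * min 1 (real n * max 0 (f x - c))) \<le> 1" for n
    using w01 by (auto simp: abs_mult intro!: mult_le_one)
  have "(\<lambda>n. min 1 (real n * max 0 (t - c))) \<longlonglongrightarrow> indicator {c<..} t" for t
  proof (cases "c < t")
    case True
    have "eventually (\<lambda>n. real n \<ge> 1 / (t - c)) sequentially"
      by real_asymp
    then have "eventually (\<lambda>n. min 1 (real n * max 0 (t - c)) = 1) sequentially"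
      by eventually_elim (use True in \<open>auto simp: field_simps min_def\<close>)
    then show ?thesis
      using True by (simp add: tendsto_eventually)
  qed auto
  then show "AE x in M. (\<lambda>n. w x * min 1 (real n * max 0 (f x - c))) \<longlonglongrightarrow> w x * indicator {c<..} (f x)"
    by (intro AE_I2 tendsto_intros)
qed auto

text \<open>The measures with densities \<open>w\<close> and \<open>w'\<close> have images under \<open>f\<close> and \<open>f'\<close> with the same moments on the
  unit interval, so the images agree by Weierstrass approximation. The weights make it possible to treat several
  random variables one after the other.\<close>

lemma moments_determine_weighted_law:
  fixes f w :: "'a \<Rightarrow> real" and f' w' :: "'b \<Rightarrow> real"
  assumes M: "prob_space M" and N: "prob_space N"
    and f: "f \<in> borel_measurable M" and f01: "\<And>x. 0 \<le> f x" "\<And>x. f x \<le> 1"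
    and w: "w \<in> borel_measurable M" and w01: "\<And>x. 0 \<le> w x" "\<And>x. w x \<le> 1"
    and f': "f' \<in> borel_measurable N" and f'01: "\<And>x. 0 \<le> f' x" "\<And>x. f' x \<le> 1"
    and w': "w' \<in> borel_measurable N" and w'01: "\<And>x. 0 \<le> w' x" "\<And>x. w' x \<le> 1"
    and moments: "\<And>p. (\<integral>x. w x * f x ^ p \<partial>M) = (\<integral>y. w' y * f' y ^ p \<partial>N)"
    and A: "A \<in> sets borel"
  shows "(\<integral>x. w x * indicator A (f x) \<partial>M) = (\<integral>y. w' y * indicator A (f' y) \<partial>N)"
proof -
  interpret M: prob_space M by fact
  interpret N: prob_space N by fact
  have poly: "(\<integral>x. w x * (\<Sum>i\<le>n. a i * f x ^ i) \<partial>M) = (\<integral>y. w' y * (\<Sum>i\<le>n. a i * f' y ^ i) \<partial>N)"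
    for a :: "nat \<Rightarrow> real" and n
  proof -
    have "integrable M (\<lambda>x. w x * f x ^ i)" "integrable N (\<lambda>x. w' x * f' x ^ i)" for i
      by (rule M.weighted_integrable[OF f w _ f01 w01, of _ 1] N.weighted_integrable[OF f' w' _ f'01 w'01, of _ 1];
          auto simp: power_le_one)+
    then have "(\<integral>x. (\<Sum>i\<le>n. a i * (w x * f x ^ i)) \<partial>M) = (\<integral>y. (\<Sum>i\<le>n. a i * (w' y * f' y ^ i)) \<partial>N)"
      by (simp add: Bochner_Integration.integral_sum moments)
    then show ?thesis
      by (simp add: sum_distrib_left mult_ac)
  qed
  have cont: "(\<integral>x. w x * g (f x) \<partial>M) = (\<integral>y. w' y * g (f' y) \<partial>N)" if g: "continuous_on UNIV g" for g :: "real \<Rightarrow> real"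
  proof -
    have gm: "g \<in> borel_measurable borel"
      using g by (rule borel_measurable_continuous_onI)
    have "bounded (g ` {0..1})"
      by (intro compact_imp_bounded compact_continuous_image continuous_on_subset[OF g] compact_Icc) auto
    then obtain B where "\<forall>u\<in>g ` {0..1}. norm u \<le> B"
      unfolding bounded_iff by blast
    then have B: "\<bar>g t\<bar> \<le> B" if "t \<in> {0..1}" for t
      using that by simp
    have "\<bar>(\<integral>x. w x * g (f x) \<partial>M) - (\<integral>y. w' y * g (f' y) \<partial>N)\<bar> \<le> 0 + e" if "e > 0" for e
    proof -
      obtain r where r: "real_polynomial_function r" "\<And>t. t \<in> {0..1} \<Longrightarrow> \<bar>g t - r t\<bar> < e / 2"
        using Stone_Weierstrass_real_polynomial_function[of "{0..1::real}" g "e / 2"] \<open>e > 0\<close> g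
        by (auto intro: continuous_on_subset)
      obtain a n where a: "r = (\<lambda>t. \<Sum>i\<le>n. a i * t ^ i)"
        using r(1) unfolding real_polynomial_function_iff_sum by auto
      have rm: "r \<in> borel_measurable borel"
        unfolding a by measurable
      have "(\<integral>x. w x * r (f x) \<partial>M) = (\<integral>x. w' x * r (f' x) \<partial>N)"
        unfolding a by (rule poly)
      then show ?thesis
        using M.weighted_integral_close[OF f f01 w w01 gm B rm r(2)]
          N.weighted_integral_close[OF f' f'01 w' w'01 gm B rm r(2)] by linarith
    qed
    then have "\<bar>(\<integral>x. w x * g (f x) \<partial>M) - (\<integral>y. w' y * g (f' y) \<partial>N)\<bar> \<le> 0"
      by (rule field_le_epsilon)
    then show ?thesis by simp
  qed
  have halfline: "(\<integral>x. w x * indicator {c<..} (f x) \<partial>M) = (\<integral>y. w' y * indicator {c<..} (f' y) \<partial>N)" for c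
  proof (rule LIMSEQ_unique[OF M.weighted_halfline_limit[OF f w w01]])
    have "(\<integral>x. w x * min 1 (real n * max 0 (f x - c)) \<partial>M) = (\<integral>y. w' y * min 1 (real n * max 0 (f' y - c)) \<partial>N)" for n
      by (rule cont[of "\<lambda>t. min 1 (real n * max 0 (t - c))"]) (intro continuous_intros)
    then show "(\<lambda>n. \<integral>x. w x * min 1 (real n * max 0 (f x - c)) \<partial>M) \<longlonglongrightarrow> (\<integral>x. w' x * indicator {c<..} (f' x) \<partial>N)"
      using N.weighted_halfline_limit[OF f' w' w'01, of c] by simp
  qed
  note \<alpha> = M.emeasure_weighted_law[OF f f01 w w01] and \<beta> = N.emeasure_weighted_law[OF f' f'01 w' w'01]
  have "distr (density M w) borel f = distr (density N w') borel f'"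
    by (rule measure_eqI_lessThan) (simp_all add: \<alpha> \<beta> halfline)
  then have "ennreal (\<integral>x. w x * indicator A (f x) \<partial>M) = ennreal (\<integral>x. w' x * indicator A (f' x) \<partial>N)"
    using \<alpha>[OF A] \<beta>[OF A] by simp
  then show ?thesis
    using w01 w'01 by (simp add: integral_nonneg_AE)
qed

text \<open>The multidimensional moment problem on the unit cube, by replacing one power after the other by the
  indicator of a Borel set; the remaining factors are the weight.\<close>

lemma moments_determine_joint_law:
  fixes f :: "'i \<Rightarrow> 'a \<Rightarrow> real" and f' :: "'i \<Rightarrow> 'b \<Rightarrow> real"
  assumes M: "prob_space M" and N: "prob_space N"
    and f [measurable]: "\<And>i. f i \<in> borel_measurable M" and f01: "\<And>i x. 0 \<le> f i x" "\<And>i x. f i x \<le> 1"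
    and f' [measurable]: "\<And>i. f' i \<in> borel_measurable N" and f'01: "\<And>i x. 0 \<le> f' i x" "\<And>i x. f' i x \<le> 1"
    and moments: "\<And>js. (\<integral>x. (\<Prod>i\<leftarrow>js. f i x) \<partial>M) = (\<integral>y. (\<Prod>i\<leftarrow>js. f' i y) \<partial>N)"
    and gs: "\<And>g. g \<in> set gs \<Longrightarrow> snd g \<in> sets borel"
  shows "measure M {x \<in> space M. \<forall>g\<in>set gs. f (fst g) x \<in> snd g} =
    measure N {y \<in> space N. \<forall>g\<in>set gs. f' (fst g) y \<in> snd g}"
proof -
  interpret M: prob_space M by fact
  interpret N: prob_space N by fact
  have mprod [measurable]: "(\<lambda>x. \<Prod>i\<leftarrow>js. f i x) \<in> borel_measurable M" "(\<lambda>x. \<Prod>i\<leftarrow>js. f' i x) \<in> borel_measurable N" for js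
    by (induction js) auto
  have mind: "(\<lambda>x. \<Prod>g\<leftarrow>gs. indicator (snd g) (f (fst g) x) :: real) \<in> borel_measurable M"
    "(\<lambda>x. \<Prod>g\<leftarrow>gs. indicator (snd g) (f' (fst g) x) :: real) \<in> borel_measurable N"
    if "\<And>g. g \<in> set gs \<Longrightarrow> snd g \<in> sets borel" for gs
    using that by (induction gs) auto
  have ind01: "0 \<le> (\<Prod>g\<leftarrow>gs. indicator (snd g) (h g) :: real)" "(\<Prod>g\<leftarrow>gs. indicator (snd g) (h g) :: real) \<le> 1"
    for gs :: "('i \<times> real set) list" and h
    by (intro prod_list_unit_interval; simp)+
  have "(\<integral>x. (\<Prod>g\<leftarrow>gs. indicator (snd g) (f (fst g) x)) * (\<Prod>i\<leftarrow>js. f i x) \<partial>M) =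
      (\<integral>y. (\<Prod>g\<leftarrow>gs. indicator (snd g) (f' (fst g) y)) * (\<Prod>i\<leftarrow>js. f' i y) \<partial>N)" for js
    using gs
  proof (induction gs arbitrary: js)
    case Nil
    then show ?case using moments by simp
  next
    case (Cons g gs)
    note [measurable] = mind[of gs, OF Cons.prems[OF list.set_intros(2)]]
    let ?w = "\<lambda>x. (\<Prod>g\<leftarrow>gs. indicator (snd g) (f (fst g) x)) * (\<Prod>i\<leftarrow>js. f i x)"
    let ?w' = "\<lambda>x. (\<Prod>g\<leftarrow>gs. indicator (snd g) (f' (fst g) x)) * (\<Prod>i\<leftarrow>js. f' i x)"
    have "(\<integral>x. ?w x * indicator (snd g) (f (fst g) x) \<partial>M) = (\<integral>y. ?w' y * indicator (snd g) (f' (fst g) y) \<partial>N)"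
    proof (rule moments_determine_weighted_law[OF M N])
      show "(\<integral>x. ?w x * f (fst g) x ^ p \<partial>M) = (\<integral>y. ?w' y * f' (fst g) y ^ p \<partial>N)" for p
        using Cons.IH[of "replicate p (fst g) @ js"] Cons.prems
        by (simp add: prod_list_replicate_map mult_ac del: map_replicate)
      show "0 \<le> ?w x" "?w x \<le> 1" for x
        using ind01 prod_list_unit_interval[of js "\<lambda>i. f i x"] f01 by (auto intro!: mult_le_one)
      show "0 \<le> ?w' x" "?w' x \<le> 1" for x
        using ind01 prod_list_unit_interval[of js "\<lambda>i. f' i x"] f'01 by (auto intro!: mult_le_one)
    qed (use f01 f'01 Cons.prems in auto)
    then show ?case by (simp add: mult_ac)
  qed
  from this[of "[]"] have eq: "(\<integral>x. (\<Prod>g\<leftarrow>gs. indicator (snd g) (f (fst g) x)) \<partial>M) =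
      (\<integral>y. (\<Prod>g\<leftarrow>gs. indicator (snd g) (f' (fst g) y)) \<partial>N :: real)" by simp
  have ind: "(\<Prod>g\<leftarrow>gs. indicator (snd g) (h (fst g))) = (if \<forall>g\<in>set gs. h (fst g) \<in> snd g then 1 else 0 :: real)"
    for h :: "'i \<Rightarrow> real"
    by (induction gs) auto
  have set: "{x \<in> space M. \<forall>g\<in>set gs. f (fst g) x \<in> snd g} \<in> sets M" "{x \<in> space N. \<forall>g\<in>set gs. f' (fst g) x \<in> snd g} \<in> sets N"
    using gs by (auto intro!: sets.sets_Collect_finite_All')
  have "(\<integral>x. (\<Prod>g\<leftarrow>gs. indicator (snd g) (f (fst g) x)) \<partial>M) =
      (\<integral>x. indicator {x \<in> space M. \<forall>g\<in>set gs. f (fst g) x \<in> snd g} x \<partial>M :: real)"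
    unfolding ind[of "\<lambda>i. f i x" for x] by (intro Bochner_Integration.integral_cong) (auto simp: indicator_def)
  moreover have "(\<integral>x. (\<Prod>g\<leftarrow>gs. indicator (snd g) (f' (fst g) x)) \<partial>N) =
      (\<integral>x. indicator {x \<in> space N. \<forall>g\<in>set gs. f' (fst g) x \<in> snd g} x \<partial>N :: real)"
    unfolding ind[of "\<lambda>i. f' i x" for x] by (intro Bochner_Integration.integral_cong) (auto simp: indicator_def)
  ultimately show ?thesis
    using eq set by simp
qed

section \<open>Reconstruction from the semicharacters\<close>

text \<open>The edge product of a star with centre \<open>z\<close>, whose leaves are the points \<open>x\<^sub>i\<close>.\<close>

definition star_prod :: "'a metric \<Rightarrow> nat list \<Rightarrow> (nat \<Rightarrow> 'a) \<Rightarrow> 'a \<Rightarrow> real" where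
  "star_prod m js x z = (\<Prod>i\<leftarrow>js. exp (- mdist m (x i) z))"

text \<open>An edge product of the given points times the expectation of a star product over a random
  centre. Both kinds of functionals of \<open>x\<close> occur in one definition, with an empty list for the other factor.\<close>

definition profile :: "'a mms \<Rightarrow> (nat \<times> nat) list \<times> nat list \<Rightarrow> (nat \<Rightarrow> 'a) \<Rightarrow> real" where
  "profile X t x = edge_prod (fst X) (fst t) x * (\<integral>z. star_prod (fst X) (snd t) x z \<partial>snd X)"

definition supported :: "nat \<Rightarrow> (nat \<times> nat) list \<times> nat list \<Rightarrow> bool" where
  "supported N t \<longleftrightarrow> set (fst t) \<subseteq> {..<N} \<times> {..<N} \<and> set (snd t) \<subseteq> {..<N}"

lemma supported_mono: "supported N t \<Longrightarrow> N \<le> k \<Longrightarrow> supported k t"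
  by (force simp: supported_def)

lemma star_prod_eq_edge_prod:
  "set js \<subseteq> {..<k} \<Longrightarrow> star_prod m js x z = edge_prod m (map (\<lambda>i. (i, k)) js) (x(k := z))"
  unfolding star_prod_def by (induction js) auto

lemma star_edges_subset: "set js \<subseteq> {..<k} \<Longrightarrow> set (map (\<lambda>i. (i, k)) js) \<subseteq> {..<Suc k} \<times> {..<Suc k}"
  by auto

lemma star_prod_bounds: "0 \<le> star_prod m js x z" "star_prod m js x z \<le> 1"
  unfolding star_prod_def by (rule prod_list_unit_interval; simp)+

lemma star_prod_cong: "(\<And>i. i \<in> set js \<Longrightarrow> x i = y i) \<Longrightarrow> star_prod m js x z = star_prod m js y z"
  unfolding star_prod_def by (induction js) auto

lemma star_prod_measurable:
  assumes X: "mm_space X" and "\<And>i. i \<in> set js \<Longrightarrow> x i \<in> points X"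
  shows "star_prod (fst X) js x \<in> borel_measurable (snd X)"
  using assms(2)
proof (induction js)
  case (Cons i js)
  then have [measurable]: "rdist X (x i) \<in> borel_measurable (snd X)" "star_prod (fst X) js x \<in> borel_measurable (snd X)"
    using measurable_mdist_const[OF X] by auto
  then have "(\<lambda>z. exp (- rdist X (x i) z) * star_prod (fst X) js x z) \<in> borel_measurable (snd X)"
    by measurable
  then show ?case by (simp add: star_prod_def)
qed (simp add: star_prod_def[abs_def])

lemma profile_cong:
  assumes "supported N t" "\<And>i. i < N \<Longrightarrow> x i = y i"
  shows "profile X t x = profile X t y"
proof -
  have "edge_prod (fst X) (fst t) x = edge_prod (fst X) (fst t) y"
    using assms by (intro edge_prod_cong[of _ "{..<N}"]) (auto simp: supported_def)
  moreover have "star_prod (fst X) (snd t) x z = star_prod (fst X) (snd t) y z" for z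
    using assms by (intro star_prod_cong) (auto simp: supported_def)
  ultimately show ?thesis by (simp add: profile_def)
qed

lemma star_integral_bounds:
  assumes X: "mm_space X"
  shows "0 \<le> (\<integral>z. star_prod (fst X) js x z \<partial>snd X)" "(\<integral>z. star_prod (fst X) js x z \<partial>snd X) \<le> 1"
proof -
  interpret prob_space "snd X" using X by (rule mm_spaceD)
  show "0 \<le> (\<integral>z. star_prod (fst X) js x z \<partial>snd X)"
    by (intro integral_nonneg_AE) (auto simp: star_prod_bounds)
  show "(\<integral>z. star_prod (fst X) js x z \<partial>snd X) \<le> 1"
  proof (cases "integrable (snd X) (star_prod (fst X) js x)")
    case True
    then show ?thesis by (intro integral_le_const) (auto simp: star_prod_bounds)
  qed (simp add: not_integrable_integral_eq)
qed

lemma profile_bounds: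
  assumes X: "mm_space X"
  shows "0 \<le> profile X t x" "profile X t x \<le> 1"
  unfolding profile_def using star_integral_bounds[OF X] edge_prod_nonneg edge_prod_le_1
  by (auto intro!: mult_le_one mult_nonneg_nonneg)

lemma profile_measurable:
  assumes X: "mm_space X" and t: "supported k t"
  shows "profile X t \<in> borel_measurable (sample k X)"
proof -
  have es: "set (fst t) \<subseteq> {..<k} \<times> {..<k}" and js: "set (snd t) \<subseteq> {..<k}"
    using t by (auto simp: supported_def)
  have "(\<lambda>x. \<integral>z. star_prod (fst X) (snd t) x z \<partial>snd X) \<in> borel_measurable (sample k X)"
    unfolding star_prod_eq_edge_prod[OF js]
    by (rule integral_PiM_Suc(1)[OF mm_spaceD(3)[OF X] edge_prod_measurable_PiM[OF X star_edges_subset[OF js]]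
          edge_prod_nonneg edge_prod_le_1])
  then show ?thesis
    unfolding profile_def using edge_prod_measurable_PiM[OF X es] by measurable
qed

lemma prod_list_profile_measurable:
  assumes X: "mm_space X" and "\<And>t. t \<in> set ts \<Longrightarrow> supported k t"
  shows "(\<lambda>x. \<Prod>t\<leftarrow>ts. profile X t x) \<in> borel_measurable (sample k X)"
  using assms(2) by (induction ts) (auto intro!: borel_measurable_times profile_measurable[OF X])

lemma prod_list_profile_bounds:
  assumes X: "mm_space X"
  shows "0 \<le> (\<Prod>t\<leftarrow>ts. profile X t x)" "(\<Prod>t\<leftarrow>ts. profile X t x) \<le> 1"
  by (rule prod_list_unit_interval; simp add: profile_bounds[OF X])+

text \<open>A profile contains an expectation over a random centre. By independence, the centre may be taken as one more
  sample point \<open>k\<close>, which turns the star into edges to the new vertex. The other profiles depend only on the first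
  \<open>N\<close> points and are unaffected.\<close>

lemma integral_absorb_profile:
  assumes X: "mm_space X" and es: "on_vertices k es" and Nk: "N \<le> k"
    and t: "supported N t" and ts: "\<And>t. t \<in> set ts \<Longrightarrow> supported N t"
  shows "(\<integral>x. edge_prod (fst X) es x * (profile X t x * (\<Prod>t\<leftarrow>ts. profile X t x)) \<partial>sample k X)
    = (\<integral>x. edge_prod (fst X) (es @ fst t @ map (\<lambda>i. (i, k)) (snd t)) x * (\<Prod>t\<leftarrow>ts. profile X t x)
        \<partial>(sample (Suc k) X))"
proof -
  let ?es = "es @ fst t @ map (\<lambda>i. (i, k)) (snd t)"
  let ?F = "\<lambda>x. edge_prod (fst X) ?es x * (\<Prod>t\<leftarrow>ts. profile X t x)"
  have tk: "set (fst t) \<subseteq> {..<k} \<times> {..<k}" "set (snd t) \<subseteq> {..<k}"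
    using supported_mono[OF t Nk] by (auto simp: supported_def)
  have es': "set ?es \<subseteq> {..<Suc k} \<times> {..<Suc k}"
    using es tk by (auto simp: less_Suc_eq)
  have tsS: "supported (Suc k) t" if "t \<in> set ts" for t
    using supported_mono[OF ts[OF that]] Nk by simp
  have F: "?F \<in> borel_measurable (sample (Suc k) X)"
    by (intro borel_measurable_times edge_prod_measurable_PiM[OF X es'] prod_list_profile_measurable[OF X] tsS)
  have "(\<integral>x. ?F x \<partial>(sample (Suc k) X)) = (\<integral>x. \<integral>z. ?F (x(k := z)) \<partial>snd X \<partial>sample k X)"
    by (rule integral_PiM_Suc(3)[OF mm_spaceD(3)[OF X] F])
      (intro mult_nonneg_nonneg mult_le_one edge_prod_nonneg edge_prod_le_1 prod_list_profile_bounds[OF X])+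
  also have "\<dots> = (\<integral>x. edge_prod (fst X) es x * (profile X t x * (\<Prod>t\<leftarrow>ts. profile X t x)) \<partial>sample k X)"
  proof (intro Bochner_Integration.integral_cong refl)
    fix x
    have "?F (x(k := z)) = (edge_prod (fst X) es x * edge_prod (fst X) (fst t) x * (\<Prod>t\<leftarrow>ts. profile X t x))
        * star_prod (fst X) (snd t) x z" for z
    proof -
      have "edge_prod (fst X) es (x(k := z)) = edge_prod (fst X) es x"
        "edge_prod (fst X) (fst t) (x(k := z)) = edge_prod (fst X) (fst t) x"
        by (rule edge_prod_cong[OF es] edge_prod_cong[OF tk(1)]; simp)+
      moreover have "(\<Prod>t\<leftarrow>ts. profile X t (x(k := z))) = (\<Prod>t\<leftarrow>ts. profile X t x)"
        using ts Nk by (intro arg_cong[where f = prod_list] map_cong profile_cong[of N]) auto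
      ultimately show ?thesis
        by (simp add: star_prod_eq_edge_prod[OF tk(2)] mult_ac)
    qed
    then show "(\<integral>z. ?F (x(k := z)) \<partial>snd X) =
        edge_prod (fst X) es x * (profile X t x * (\<Prod>t\<leftarrow>ts. profile X t x))"
      by (simp add: profile_def mult_ac)
  qed
  finally show ?thesis by simp
qed

text \<open>All centres are absorbed in turn, and what remains is a semicharacter.\<close>

lemma semichar_eq_profile_moments:
  assumes X: "mm_space X" and Y: "mm_space Y"
    and eq: "\<And>k es. on_vertices k es \<Longrightarrow> semichar X k es = semichar Y k es"
    and ts: "\<And>t. t \<in> set ts \<Longrightarrow> supported N t"
  shows "(\<integral>x. (\<Prod>t\<leftarrow>ts. profile X t x) \<partial>sample N X) =
    (\<integral>y. (\<Prod>t\<leftarrow>ts. profile Y t y) \<partial>sample N Y)"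
proof -
  have "(\<integral>x. edge_prod (fst X) es x * (\<Prod>t\<leftarrow>ts. profile X t x) \<partial>sample k X) =
    (\<integral>y. edge_prod (fst Y) es y * (\<Prod>t\<leftarrow>ts. profile Y t y) \<partial>sample k Y)"
    if "N \<le> k" "on_vertices k es" for es k
    using ts that
  proof (induction ts arbitrary: es k)
    case Nil
    then show ?case using eq[of es k] by (simp add: semichar_def)
  next
    case (Cons t ts)
    have t: "supported N t" and ts: "\<And>t. t \<in> set ts \<Longrightarrow> supported N t"
      using Cons.prems by auto
    have "set (es @ fst t @ map (\<lambda>i. (i, k)) (snd t)) \<subseteq> {..<Suc k} \<times> {..<Suc k}"
      using Cons.prems supported_mono[OF t \<open>N \<le> k\<close>] by (force simp: supported_def less_Suc_eq)
    then show ?case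
      using Cons.IH[of "Suc k" "es @ fst t @ map (\<lambda>i. (i, k)) (snd t)"] ts \<open>N \<le> k\<close>
        integral_absorb_profile[OF X \<open>on_vertices k es\<close> \<open>N \<le> k\<close> t ts]
        integral_absorb_profile[OF Y \<open>on_vertices k es\<close> \<open>N \<le> k\<close> t ts]
      by (simp del: edge_prod_simps)
  qed
  from this[of N "[]"] show ?thesis by simp
qed

text \<open>Polynomials in the variables indexed by \<open>S\<close>, as linear combinations of monomials given by lists of
  variables.\<close>

inductive poly_fun :: "'i set \<Rightarrow> (('i \<Rightarrow> real) \<Rightarrow> real) \<Rightarrow> bool" for S where
  monomial: "set ts \<subseteq> S \<Longrightarrow> poly_fun S (\<lambda>v. c * (\<Prod>t\<leftarrow>ts. v t))"
| add: "poly_fun S f \<Longrightarrow> poly_fun S g \<Longrightarrow> poly_fun S (\<lambda>v. f v + g v)"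

lemma poly_fun_const: "poly_fun S (\<lambda>_. c)"
  using poly_fun.monomial[of "[]" S c] by simp

lemma poly_fun_proj: "t \<in> S \<Longrightarrow> poly_fun S (\<lambda>v. v t)"
  using poly_fun.monomial[of "[t]" S 1] by simp

lemma poly_fun_mult: "poly_fun S f \<Longrightarrow> poly_fun S g \<Longrightarrow> poly_fun S (\<lambda>v. f v * g v)"
proof (induction rule: poly_fun.induct)
  case (monomial ts c)
  from monomial(2) show ?case
  proof (induction rule: poly_fun.induct)
    case (monomial us d)
    then have "poly_fun S (\<lambda>v. (c * d) * (\<Prod>t\<leftarrow>ts @ us. v t))"
      using \<open>set ts \<subseteq> S\<close> by (intro poly_fun.monomial) auto
    then show ?case by (simp add: mult_ac)
  next
    case (add f g)
    then show ?case using poly_fun.add by (simp add: distrib_left)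
  qed
next
  case (add f f')
  then show ?case using poly_fun.add by (simp add: distrib_right)
qed

lemma poly_fun_power: "poly_fun S f \<Longrightarrow> poly_fun S (\<lambda>v. f v ^ n)"
  by (induction n) (auto intro: poly_fun_const poly_fun_mult)

lemma poly_fun_sum: "(\<And>t. t \<in> T \<Longrightarrow> poly_fun S (f t)) \<Longrightarrow> poly_fun S (\<lambda>v. \<Sum>t\<in>T. f t v)"
  by (induction T rule: infinite_finite_induct) (auto intro: poly_fun_const poly_fun.add)

lemma semichar_eq_profile_polynomials:
  assumes X: "mm_space X" and Y: "mm_space Y"
    and eq: "\<And>k es. on_vertices k es \<Longrightarrow> semichar X k es = semichar Y k es"
    and f: "poly_fun {t. supported N t} f"
  shows "(\<integral>x. f (\<lambda>t. profile X t x) \<partial>sample N X) =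
    (\<integral>y. f (\<lambda>t. profile Y t y) \<partial>sample N Y)"
proof -
  interpret PX: prob_space "sample N X" by (rule prob_space_PiM_mm[OF X])
  interpret PY: prob_space "sample N Y" by (rule prob_space_PiM_mm[OF Y])
  have "integrable (sample N X) (\<lambda>x. f (\<lambda>t. profile X t x)) \<and>
    integrable (sample N Y) (\<lambda>x. f (\<lambda>t. profile Y t x)) \<and> ?thesis"
    using f
  proof (induction rule: poly_fun.induct)
    case (monomial ts c)
    then have ts: "\<And>t. t \<in> set ts \<Longrightarrow> supported N t" by auto
    have "integrable (sample N X) (\<lambda>x. \<Prod>t\<leftarrow>ts. profile X t x)"
      "integrable (sample N Y) (\<lambda>x. \<Prod>t\<leftarrow>ts. profile Y t x)"
      by (intro PX.integrable_unit_interval PY.integrable_unit_interval prod_list_profile_measurable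
          prod_list_profile_bounds X Y ts; assumption)+
    then show ?case
      using semichar_eq_profile_moments[OF X Y eq ts] by simp
  qed auto
  then show ?thesis by simp
qed

lemma profile_lipschitz:
  assumes X: "mm_space X" and t: "supported N t"
    and x: "\<And>i. i < N \<Longrightarrow> x i \<in> points X" and y: "\<And>i. i < N \<Longrightarrow> y i \<in> points X"
    and d: "\<And>i. i < N \<Longrightarrow> rdist X (x i) (y i) \<le> \<delta>"
  shows "\<bar>profile X t x - profile X t y\<bar> \<le> real (2 * length (fst t) + length (snd t)) * \<delta>"
proof -
  interpret prob_space "snd X" using X by (rule mm_spaceD)
  let ?m = "fst X"
  have es: "set (fst t) \<subseteq> {..<N} \<times> {..<N}" and js: "set (snd t) \<subseteq> {..<N}"
    using t by (auto simp: supported_def)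
  have 1: "\<bar>edge_prod ?m (fst t) x - edge_prod ?m (fst t) y\<bar> \<le> real (length (fst t)) * (2 * \<delta>)"
  proof (rule edge_prod_lipschitz)
    fix e assume "e \<in> set (fst t)"
    then have e: "fst e < N" "snd e < N" using es by auto
    show "\<bar>mdist ?m (x (fst e)) (x (snd e)) - mdist ?m (y (fst e)) (y (snd e))\<bar> \<le> 2 * \<delta>"
      using mdist_triangle[OF x[OF e(1)] y[OF e(1)] x[OF e(2)]] mdist_triangle[OF y[OF e(1)] y[OF e(2)] x[OF e(2)]]
        mdist_triangle[OF y[OF e(1)] x[OF e(1)] y[OF e(2)]] mdist_triangle[OF x[OF e(1)] x[OF e(2)] y[OF e(2)]]
        d[OF e(1)] d[OF e(2)] mdist_commute[of ?m "x (fst e)" "y (fst e)"] mdist_commute[of ?m "x (snd e)" "y (snd e)"]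
      by linarith
  qed
  have st: "\<bar>star_prod ?m (snd t) x z - star_prod ?m (snd t) y z\<bar> \<le> real (length (snd t)) * \<delta>"
    if z: "z \<in> mspace ?m" for z
  proof -
    have "\<bar>edge_prod ?m (map (\<lambda>i. (i, N)) (snd t)) (x(N := z)) - edge_prod ?m (map (\<lambda>i. (i, N)) (snd t)) (y(N := z))\<bar>
        \<le> real (length (map (\<lambda>i. (i, N)) (snd t))) * \<delta>"
    proof (rule edge_prod_lipschitz)
      fix e assume "e \<in> set (map (\<lambda>i. (i, N)) (snd t))"
      then have e: "fst e < N" "snd e = N" using js by auto
      show "\<bar>mdist ?m ((x(N := z)) (fst e)) ((x(N := z)) (snd e)) - mdist ?m ((y(N := z)) (fst e)) ((y(N := z)) (snd e))\<bar> \<le> \<delta>"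
        using e mdist_triangle[OF x[OF e(1)] y[OF e(1)] z] mdist_triangle[OF y[OF e(1)] x[OF e(1)] z]
          d[OF e(1)] mdist_commute[of ?m "x (fst e)" "y (fst e)"]
        by auto
    qed
    then show ?thesis
      by (simp add: star_prod_eq_edge_prod[OF js])
  qed
  have int: "integrable (snd X) (star_prod ?m (snd t) x)" "integrable (snd X) (star_prod ?m (snd t) y)"
    using js x y by (auto intro!: integrable_unit_interval star_prod_measurable[OF X] simp: star_prod_bounds)
  have 2: "\<bar>(\<integral>z. star_prod ?m (snd t) x z \<partial>snd X) - (\<integral>z. star_prod ?m (snd t) y z \<partial>snd X)\<bar> \<le> real (length (snd t)) * \<delta>"
  proof -
    have "\<bar>\<integral>z. star_prod ?m (snd t) x z - star_prod ?m (snd t) y z \<partial>snd X\<bar> \<le> (\<integral>z. real (length (snd t)) * \<delta> \<partial>snd X)"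
      using int st mm_spaceD(4)[OF X]
      by (intro integral_abs_bound[THEN order_trans] integral_mono) auto
    then show ?thesis
      using int by (simp add: prob_space)
  qed
  have "\<bar>profile X t x - profile X t y\<bar> \<le>
    \<bar>edge_prod ?m (fst t) x - edge_prod ?m (fst t) y\<bar> +
    \<bar>(\<integral>z. star_prod ?m (snd t) x z \<partial>snd X) - (\<integral>z. star_prod ?m (snd t) y z \<partial>snd X)\<bar>"
    unfolding profile_def
    using star_integral_bounds[OF X] by (intro abs_mult_diff_le) (auto simp: edge_prod_nonneg edge_prod_le_1)
  then show ?thesis
    using 1 2 by (simp add: algebra_simps)
qed

lemma PiM_ball_pos:
  fixes N :: nat
  assumes X: "mm_space X" and x: "\<And>i. i < N \<Longrightarrow> x i \<in> points X" and "\<delta> > 0"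
  shows "(\<Pi>\<^sub>E i\<in>{..<N}. rball X (x i) \<delta>) \<in> sets (sample N X)"
    and "measure (sample N X) (\<Pi>\<^sub>E i\<in>{..<N}. rball X (x i) \<delta>) > 0"
proof -
  interpret X: prob_space "snd X" using X by (rule mm_spaceD)
  interpret P: product_prob_space "\<lambda>_. snd X" "{..<N}" ..
  show "(\<Pi>\<^sub>E i\<in>{..<N}. rball X (x i) \<delta>) \<in> sets (sample N X)"
    using mm_space_ball_sets[OF X] by (intro sets_PiM_I_finite) auto
  have "emeasure (sample N X) (\<Pi>\<^sub>E i\<in>{..<N}. rball X (x i) \<delta>)
    = (\<Prod>i<N. emeasure (snd X) (rball X (x i) \<delta>))"
    using mm_space_ball_sets[OF X] by (intro P.emeasure_PiM) auto
  also have "\<dots> = ennreal (\<Prod>i<N. mass X (rball X (x i) \<delta>))"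
    by (simp add: X.emeasure_eq_measure prod_ennreal)
  finally show "measure (sample N X) (\<Pi>\<^sub>E i\<in>{..<N}. rball X (x i) \<delta>) > 0"
    using mm_space_ball_pos[OF X x \<open>\<delta> > 0\<close>] by (subst measure_def) (auto simp: prod_nonneg intro!: prod_pos)
qed

text \<open>Let \<open>q\<close> be the polynomial \<open>1 - (1 / p) \<Sum> (v\<^sub>t - c\<^sub>t)\<^sup>2\<close>, where \<open>c\<^sub>t\<close> are the values to be approximated
  and \<open>p\<close> is their number. If no configuration in \<open>Y\<close> came close, \<open>q\<close> would be at most some \<open>a\<close> on \<open>Y\<close>, while \<open>q\<close> is at
  least some \<open>b > a\<close> on a neighbourhood of \<open>x\<close>, which has positive measure \<open>\<kappa>\<close> by full support. The powers of \<open>q\<close>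
  have equal expectations on both sides, so \<open>\<kappa> * b ^ n \<le> a ^ n\<close> for all \<open>n\<close>, which is absurd.\<close>

lemma profile_approximation:
  assumes X: "mm_space X" and Y: "mm_space Y"
    and eq: "\<And>k es. on_vertices k es \<Longrightarrow> semichar X k es = semichar Y k es"
    and T: "finite T" "\<And>t. t \<in> T \<Longrightarrow> supported N t"
    and x: "\<And>i. i < N \<Longrightarrow> x i \<in> points X" and "e > 0"
  obtains y where "\<And>i. i < N \<Longrightarrow> y i \<in> points Y" "\<And>t. t \<in> T \<Longrightarrow> \<bar>profile Y t y - profile X t x\<bar> < e"
proof -
  interpret PX: prob_space "sample N X" by (rule prob_space_PiM_mm[OF X])
  interpret PY: prob_space "sample N Y" by (rule prob_space_PiM_mm[OF Y])
  have "\<exists>y\<in>space (sample N Y). \<forall>t\<in>T. \<bar>profile Y t y - profile X t x\<bar> < e"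
  proof (rule ccontr)
    assume contr: "\<not> ?thesis"
    then have "T \<noteq> {}"
      using PY.not_empty by auto
    define p where "p = real (card T)"
    have p: "p \<ge> 1"
      using T(1) \<open>T \<noteq> {}\<close> by (simp add: p_def Suc_le_eq card_gt_0_iff)
    let ?c = "\<lambda>t. profile X t x"
    define q where "q v = 1 - (1 / p) * (\<Sum>t\<in>T. (v t - ?c t) ^ 2)" for v
    have q: "poly_fun {t. supported N t} q"
    proof -
      have "poly_fun {t. supported N t} (\<lambda>v. 1 + (- 1 / p) * (\<Sum>t\<in>T. (v t + - ?c t) ^ 2))"
        using T(2) by (intro poly_fun.add poly_fun_const poly_fun_mult poly_fun_sum poly_fun_power poly_fun_proj) auto
      then show ?thesis
        unfolding q_def by simp
    qed
    have sq_le_1: "(v t - ?c t) ^ 2 \<le> 1" if "0 \<le> v t" "v t \<le> 1" for v t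
      using that profile_bounds[OF X, of t x] by (simp add: abs_square_le_1 abs_le_iff)
    have q_bounds: "0 \<le> q v" "q v \<le> 1" if "\<And>t. 0 \<le> v t \<and> v t \<le> 1" for v
    proof -
      have "(\<Sum>t\<in>T. (v t - ?c t) ^ 2) \<le> p * 1"
        unfolding p_def using that by (intro sum_bounded_above sq_le_1) auto
      then show "0 \<le> q v"
        using p by (simp add: q_def field_simps)
      show "q v \<le> 1"
        using p by (auto simp: q_def sum_nonneg)
    qed
    note qX = q_bounds[of "\<lambda>t. profile X t x" for x] and qY = q_bounds[of "\<lambda>t. profile Y t x" for x]
    have qX01: "0 \<le> q (\<lambda>t. profile X t x)" "q (\<lambda>t. profile X t x) \<le> 1" for x
      using qX profile_bounds[OF X] by auto
    have qY01: "0 \<le> q (\<lambda>t. profile Y t x)" "q (\<lambda>t. profile Y t x) \<le> 1" for x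
      using qY profile_bounds[OF Y] by auto
    have qX_m: "(\<lambda>x. q (\<lambda>t. profile X t x) ^ n) \<in> borel_measurable (sample N X)" for n
      unfolding q_def using T(2)
      by (intro borel_measurable_power borel_measurable_diff borel_measurable_times borel_measurable_sum
          borel_measurable_const profile_measurable[OF X]) auto
    have qY_m: "(\<lambda>x. q (\<lambda>t. profile Y t x) ^ n) \<in> borel_measurable (sample N Y)" for n
      unfolding q_def using T(2)
      by (intro borel_measurable_power borel_measurable_diff borel_measurable_times borel_measurable_sum
          borel_measurable_const profile_measurable[OF Y]) auto
    \<comment> \<open>On \<open>Y\<close> some term of the sum is at least \<open>e\<^sup>2\<close>; near \<open>x\<close> all terms are at most \<open>(e / (2 * p))\<^sup>2\<close>, and \<open>p \<ge> 1\<close>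
      makes the second bound the better one.\<close>
    define a where "a = 1 - e ^ 2 / p"
    define b where "b = 1 - (e / (2 * p)) ^ 2"
    have "(e / (2 * p)) ^ 2 < e ^ 2 / p"
    proof -
      have "(e / (2 * p)) ^ 2 = (e ^ 2 / p) * (1 / (4 * p))"
        using p by (simp add: power2_eq_square field_simps)
      also have "\<dots> < (e ^ 2 / p) * 1"
        using p \<open>e > 0\<close> by (intro mult_strict_left_mono) (auto simp: field_simps)
      finally show ?thesis by simp
    qed
    then have ab: "a < b"
      by (simp add: a_def b_def)
    have le_a: "q (\<lambda>t. profile Y t y) \<le> a" if y: "y \<in> space (sample N Y)" for y
    proof -
      obtain t where t: "t \<in> T" "\<bar>profile Y t y - ?c t\<bar> \<ge> e"
        using contr y by force
      then have "e ^ 2 \<le> (profile Y t y - ?c t) ^ 2"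
        using \<open>e > 0\<close> by (metis abs_of_pos abs_le_square_iff)
      also have "\<dots> \<le> (\<Sum>t\<in>T. (profile Y t y - ?c t) ^ 2)"
        using t T(1) by (intro member_le_sum) auto
      finally show ?thesis
        using p by (simp add: q_def a_def divide_right_mono)
    qed
    have a0: "0 \<le> a"
    proof -
      obtain y where "y \<in> space (sample N Y)" using PY.not_empty by blast
      from le_a[OF this] qY01(1)[of y] show ?thesis by simp
    qed
    define C where "C = (\<Sum>t\<in>T. real (2 * length (fst t) + length (snd t))) + 1"
    have C: "C > 0" and Ct: "real (2 * length (fst t) + length (snd t)) \<le> C" if "t \<in> T" for t
    proof -
      have "real (2 * length (fst t) + length (snd t)) \<le> (\<Sum>t\<in>T. real (2 * length (fst t) + length (snd t)))"
        using T(1) that by (intro member_le_sum) auto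
      then show "real (2 * length (fst t) + length (snd t)) \<le> C" by (simp add: C_def)
    qed (auto simp: C_def intro!: add_nonneg_pos sum_nonneg)
    have "C > 0" using C \<open>T \<noteq> {}\<close> by auto
    define \<delta> where "\<delta> = e / (2 * p) / C"
    have \<delta>: "\<delta> > 0" using \<open>C > 0\<close> p \<open>e > 0\<close> by (simp add: \<delta>_def)
    let ?U = "\<Pi>\<^sub>E i\<in>{..<N}. rball X (x i) \<delta>"
    let ?PX = "sample N X" and ?PY = "sample N Y"
    have U: "?U \<in> sets ?PX" "measure ?PX ?U > 0"
      using x \<delta> by (auto intro!: PiM_ball_pos[OF X])
    have b_le: "b \<le> q (\<lambda>t. profile X t z)" if z: "z \<in> ?U" for z
    proof -
      have zi: "z i \<in> points X" "rdist X (z i) (x i) \<le> \<delta>" if "i < N" for i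
        using z that by (auto simp: PiE_iff mdist_commute less_imp_le)
      have "(profile X t z - ?c t) ^ 2 \<le> (e / (2 * p)) ^ 2" if t: "t \<in> T" for t
      proof -
        have "\<bar>profile X t z - ?c t\<bar> \<le> real (2 * length (fst t) + length (snd t)) * \<delta>"
          using zi x by (intro profile_lipschitz[OF X T(2)[OF t]]) auto
        also have "\<dots> \<le> C * \<delta>"
          using Ct[OF t] \<delta> by (intro mult_right_mono) auto
        also have "\<dots> = e / (2 * p)"
          using \<open>C > 0\<close> by (simp add: \<delta>_def)
        finally have "\<bar>profile X t z - ?c t\<bar> \<le> e / (2 * p)" .
        then show ?thesis
          using \<open>e > 0\<close> p by (intro power2_le_iff_abs_le[THEN iffD2]) auto
      qed
      then have "(\<Sum>t\<in>T. (profile X t z - ?c t) ^ 2) \<le> p * (e / (2 * p)) ^ 2"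
        unfolding p_def by (intro sum_bounded_above) auto
      then show ?thesis
        using p by (simp add: q_def b_def field_simps)
    qed
    have bound: "measure ?PX ?U * b ^ n \<le> a ^ n" for n
    proof -
      have intX: "integrable ?PX (\<lambda>x. q (\<lambda>t. profile X t x) ^ n)"
        using qX01 by (intro PX.integrable_unit_interval qX_m) (auto intro: power_le_one)
      have "measure ?PX ?U * b ^ n = (\<integral>z. indicator ?U z * b ^ n \<partial>?PX)"
        using U(1) by simp
      also have "\<dots> \<le> (\<integral>z. q (\<lambda>t. profile X t z) ^ n \<partial>?PX)"
      proof (rule integral_mono)
        show "integrable ?PX (\<lambda>z. indicator ?U z * b ^ n)"
          using U(1) by (intro integrable_mult_left) (simp add: integrable_indicator_iff PX.emeasure_eq_measure)
        show "indicator ?U z * b ^ n \<le> q (\<lambda>t. profile X t z) ^ n" for z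
          using b_le[of z] qX01 ab a0 by (auto simp: indicator_def intro!: power_mono)
      qed (rule intX)
      also have "\<dots> = (\<integral>y. q (\<lambda>t. profile Y t y) ^ n \<partial>?PY)"
        using semichar_eq_profile_polynomials[OF X Y eq poly_fun_power[OF q]] .
      also have "\<dots> \<le> a ^ n"
      proof (rule PY.integral_le_const)
        show "integrable ?PY (\<lambda>x. q (\<lambda>t. profile Y t x) ^ n)"
          using qY01 by (intro PY.integrable_unit_interval qY_m) (auto intro: power_le_one)
        show "AE y in ?PY. q (\<lambda>t. profile Y t y) ^ n \<le> a ^ n"
          using le_a qY01 by (auto intro!: power_mono)
      qed
      finally show ?thesis .
    qed
    have "measure ?PX ?U \<le> (a / b) ^ n" for n
      using bound[of n] ab a0 by (simp add: power_divide pos_le_divide_eq)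
    moreover have "(\<lambda>n. (a / b) ^ n) \<longlonglongrightarrow> 0"
      using ab a0 by (intro LIMSEQ_power_zero) auto
    ultimately have "measure ?PX ?U \<le> 0"
      by (intro LIMSEQ_le_const) auto
    then show False using U(2) by simp
  qed
  then obtain y where y: "y \<in> space (sample N Y)" "\<forall>t\<in>T. \<bar>profile Y t y - profile X t x\<bar> < e"
    by blast
  then show ?thesis
    using that[of y] mm_spaceD(4)[OF Y] by (auto simp: space_PiM)
qed

text \<open>Centres of a cover may be taken outside \<open>S\<close>, at the cost of doubling the radius.\<close>

lemma mtotally_boundedI_net:
  assumes S: "S \<subseteq> mspace m" and net: "\<And>e. e > 0 \<Longrightarrow> \<exists>K. finite K \<and> K \<subseteq> mspace m \<and> S \<subseteq> (\<Union>x\<in>K. mball_of m x e)"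
  shows "Metric_space.mtotally_bounded (mspace m) (mdist m) S"
proof -
  interpret Metric_space "mspace m" "mdist m" by simp
  show ?thesis
    unfolding mtotally_bounded_def
  proof (intro allI impI)
    fix e :: real assume "e > 0"
    then obtain K where K: "finite K" "K \<subseteq> mspace m" "S \<subseteq> (\<Union>x\<in>K. mball_of m x (e / 2))"
      using net[of "e / 2"] by auto
    define h where "h x = (SOME s. s \<in> S \<and> s \<in> mball_of m x (e / 2))" for x
    have h: "h x \<in> S" "h x \<in> mball_of m x (e / 2)" if "s \<in> S" "s \<in> mball_of m x (e / 2)" for s x
      using someI[of "\<lambda>s. s \<in> S \<and> s \<in> mball_of m x (e / 2)" s] that unfolding h_def by blast+
    let ?K = "h ` {x \<in> K. S \<inter> mball_of m x (e / 2) \<noteq> {}}"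
    have "S \<subseteq> (\<Union>y\<in>?K. mball y e)"
    proof
      fix s assume s: "s \<in> S"
      then obtain x where x: "x \<in> K" "s \<in> mball_of m x (e / 2)"
        using K by blast
      have "mdist m (h x) s \<le> mdist m (h x) x + mdist m x s"
        using h[OF s x(2)] x by (intro mdist_triangle) auto
      then have "mdist m (h x) s < e"
        using h[OF s x(2)] x(2) by (simp add: mdist_commute)
      then have "s \<in> mball (h x) e"
        using s h[OF s x(2)] S by auto
      moreover have "h x \<in> ?K"
        using x s by blast
      ultimately show "s \<in> (\<Union>y\<in>?K. mball y e)" by blast
    qed
    moreover have "?K \<subseteq> S" using h by blast
    ultimately show "\<exists>K. finite K \<and> K \<subseteq> S \<and> S \<subseteq> (\<Union>x\<in>K. mball x e)"
      using K(1) by (intro exI[of _ ?K]) auto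
  qed
qed

lemma totally_bounded_convergent_subsequence:
  assumes "mcomplete_of m" "Metric_space.mtotally_bounded (mspace m) (mdist m) (range a)"
  obtains r :: "nat \<Rightarrow> nat" and l where "strict_mono r" "l \<in> mspace m" "(\<lambda>n. mdist m (a (r n)) l) \<longlonglongrightarrow> 0"
proof -
  interpret Metric_space "mspace m" "mdist m" by simp
  obtain r :: "nat \<Rightarrow> nat" where r: "strict_mono r" "MCauchy (a \<circ> r)"
    using assms(2) unfolding mtotally_bounded_sequentially by blast
  then obtain l where "l \<in> mspace m" "(\<lambda>n. mdist m ((a \<circ> r) n) l) \<longlonglongrightarrow> 0"
    using assms(1) unfolding mcomplete_of_def mcomplete_def limitin_metric_dist_null by blast
  then show ?thesis using that r by auto
qed

lemma star_prod_replicate: "star_prod m (replicate p i) x z = exp (- (real p * mdist m (x i) z))"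
  unfolding star_prod_def prod_list_replicate_map by (simp add: exp_of_nat_mult[symmetric] algebra_simps)

lemma profile_edge:
  assumes X: "mm_space X"
  shows "profile X ([(i, j)], []) x = exp (- rdist X (x i) (x j))"
proof -
  interpret prob_space "snd X" using X by (rule mm_spaceD)
  show ?thesis by (simp add: profile_def star_prod_def prob_space)
qed

lemma profile_star: "profile X ([], js) x = (\<integral>z. star_prod (fst X) js x z \<partial>snd X)"
  by (simp add: profile_def)

text \<open>The profiles control the masses of balls: \<open>\<integral> exp (- p * r (x\<^sub>i, z)) d\<mu>(z)\<close> is at least
  \<open>\<kappa> * exp (- p * e / 2)\<close>, where \<open>\<kappa>\<close> is the mass of the ball of radius \<open>e / 2\<close>, and at most \<open>exp (- p * e)\<close> plus the mass of
  the ball of radius \<open>e\<close>. For large \<open>p\<close> the first bound exceeds the second unless that mass is bounded below.\<close>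

lemma profile_convergence_ball_mass:
  assumes X: "mm_space X" and Y: "mm_space Y" and xi: "x i \<in> points X"
    and y: "\<And>n. y n i \<in> points Y"
    and conv: "\<And>t. (\<lambda>n. profile Y t (y n)) \<longlonglongrightarrow> profile X t x" and "e > 0"
  obtains c where "c > 0" "eventually (\<lambda>n. c \<le> mass Y (rball Y (y n i) e)) sequentially"
proof -
  interpret X: prob_space "snd X" using X by (rule mm_spaceD)
  interpret Y: prob_space "snd Y" using Y by (rule mm_spaceD)
  define \<kappa> where "\<kappa> = mass X (rball X (x i) (e / 2))"
  have \<kappa>: "\<kappa> > 0"
    unfolding \<kappa>_def using xi \<open>e > 0\<close> by (intro mm_space_ball_pos[OF X]) auto
  have "(\<lambda>p. exp (- (real p * (e / 2)))) \<longlonglongrightarrow> 0"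
    using \<open>e > 0\<close> by real_asymp
  then have "eventually (\<lambda>p. exp (- (real p * (e / 2))) < \<kappa> / 2) sequentially"
    using \<kappa> by (intro order_tendstoD) auto
  then obtain p :: nat where p: "exp (- (real p * (e / 2))) < \<kappa> / 2"
    by (auto simp: eventually_sequentially)
  have split: "exp (- (real p * e)) = exp (- (real p * (e / 2))) * exp (- (real p * (e / 2)))"
    by (simp flip: exp_add)
  \<comment> \<open>The limit exceeds \<open>4 * c\<close>, so the profiles eventually exceed \<open>3 * c\<close>, and \<open>2 * c\<close> is lost to the complement
    of the ball.\<close>
  define c where "c = exp (- (real p * e)) / 2"
  have "c > 0" by (simp add: c_def)
  let ?t = "([] :: (nat \<times> nat) list, replicate p i)"
  have X_ge: "\<kappa> * exp (- (real p * (e / 2))) \<le> profile X ?t x"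
  proof -
    have "\<kappa> * exp (- (real p * (e / 2))) =
        (\<integral>z. indicator (rball X (x i) (e / 2)) z * exp (- (real p * (e / 2))) \<partial>snd X)"
      using mm_space_ball_sets[OF X] by (simp add: \<kappa>_def)
    also have "\<dots> \<le> (\<integral>z. star_prod (fst X) (replicate p i) x z \<partial>snd X)"
    proof (rule integral_mono)
      show "integrable (snd X) (star_prod (fst X) (replicate p i) x)"
        using xi by (intro X.integrable_unit_interval star_prod_measurable[OF X]) (auto simp: star_prod_bounds)
      show "integrable (snd X) (\<lambda>z. indicator (rball X (x i) (e / 2)) z * exp (- (real p * (e / 2))))"
        using mm_space_ball_sets[OF X] by (intro integrable_mult_left) (simp add: integrable_indicator_iff X.emeasure_eq_measure)
      show "indicator (rball X (x i) (e / 2)) z * exp (- (real p * (e / 2))) \<le> star_prod (fst X) (replicate p i) x z" for z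
      proof (cases "z \<in> rball X (x i) (e / 2)")
        case True
        then have "real p * rdist X (x i) z \<le> real p * (e / 2)"
          by (intro mult_left_mono) auto
        then show ?thesis using True by (simp add: star_prod_replicate del: in_mball_of)
      qed (simp add: star_prod_bounds)
    qed
    finally show ?thesis by (simp add: profile_star)
  qed
  have Y_le: "profile Y ?t (y n) \<le> mass Y (rball Y (y n i) e) + exp (- (real p * e))" for n
  proof -
    have ind: "integrable (snd Y) (\<lambda>z. indicator (rball Y (y n i) e) z :: real)"
      using mm_space_ball_sets[OF Y] by (simp add: integrable_indicator_iff Y.emeasure_eq_measure)
    have "(\<integral>z. star_prod (fst Y) (replicate p i) (y n) z \<partial>snd Y) \<le>
        (\<integral>z. indicator (rball Y (y n i) e) z + exp (- (real p * e)) \<partial>snd Y)"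
    proof (rule integral_mono)
      show "integrable (snd Y) (star_prod (fst Y) (replicate p i) (y n))"
        using y by (intro Y.integrable_unit_interval star_prod_measurable[OF Y]) (auto simp: star_prod_bounds)
      show "integrable (snd Y) (\<lambda>z. indicator (rball Y (y n i) e) z + exp (- (real p * e)))"
        using ind by (intro Bochner_Integration.integrable_add) auto
      fix z assume "z \<in> space (snd Y)"
      then have "z \<in> points Y" using mm_spaceD(4)[OF Y] by simp
      then show "star_prod (fst Y) (replicate p i) (y n) z \<le> indicator (rball Y (y n i) e) z + exp (- (real p * e))"
      proof (cases "z \<in> rball Y (y n i) e")
        case True
        then show ?thesis
          using star_prod_bounds(2)[of "fst Y" "replicate p i" "y n" z] by (simp add: add_increasing2 del: in_mball_of)
      next
        case False
        then have "real p * e \<le> real p * rdist Y (y n i) z"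
          using y[of n] \<open>z \<in> points Y\<close> by (intro mult_left_mono) auto
        then show ?thesis using False by (simp add: star_prod_replicate del: in_mball_of)
      qed
    qed
    also have "\<dots> = mass Y (rball Y (y n i) e) + exp (- (real p * e))"
      using ind mm_space_ball_sets[OF Y] by (simp add: Y.prob_space)
    finally show ?thesis by (simp add: profile_star)
  qed
  have big: "profile X ?t x > 2 * exp (- (real p * e))"
  proof -
    have "2 * exp (- (real p * e)) = (2 * exp (- (real p * (e / 2)))) * exp (- (real p * (e / 2)))"
      unfolding split by simp
    also have "\<dots> < \<kappa> * exp (- (real p * (e / 2)))"
      using p by (intro mult_strict_right_mono) auto
    finally show ?thesis using X_ge by linarith
  qed
  then have "3 / 2 * exp (- (real p * e)) < profile X ?t x"
    using exp_gt_zero[of "- (real p * e)"] by linarith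
  then have "eventually (\<lambda>n. 3 / 2 * exp (- (real p * e)) < profile Y ?t (y n)) sequentially"
    by (rule order_tendstoD(1)[OF conv])
  then have "eventually (\<lambda>n. c \<le> mass Y (rball Y (y n i) e)) sequentially"
  proof eventually_elim
    case (elim n)
    then show ?case using Y_le[of n] by (simp add: c_def)
  qed
  then show ?thesis using that \<open>c > 0\<close> by blast
qed

text \<open>A ball of mass at least \<open>c\<close> meets every set of mass greater than \<open>1 - c\<close>, in particular a finite union of balls.\<close>

lemma profile_convergence_totally_bounded:
  assumes X: "mm_space X" and Y: "mm_space Y" and xi: "x i \<in> points X"
    and y: "\<And>n. y n i \<in> points Y"
    and conv: "\<And>t. (\<lambda>n. profile Y t (y n)) \<longlonglongrightarrow> profile X t x"
  shows "Metric_space.mtotally_bounded (points Y) (rdist Y) (range (\<lambda>n. y n i))"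
proof (rule mtotally_boundedI_net)
  interpret Y: prob_space "snd Y" using Y by (rule mm_spaceD)
  obtain q where q: "dense_seq (fst Y) q" using mm_space_dense_seq[OF Y] .
  have q': "q j \<in> points Y" for j using q by (simp add: dense_seq_def)
  fix e :: real assume "e > 0"
  then obtain c n0 where c: "c > 0" "\<And>n. n \<ge> n0 \<Longrightarrow> c \<le> mass Y (rball Y (y n i) (e / 2))"
    using profile_convergence_ball_mass[where e = "e / 2", OF X Y xi y conv]
    unfolding eventually_sequentially by (metis half_gt_zero)
  obtain K :: nat where K: "mass Y (points Y - (\<Union>j<K. rball Y (q j) (e / 2))) < c"
    using mm_space_net[OF Y q _ c(1), of "e / 2"] \<open>e > 0\<close> by auto
  have near: "\<exists>j<K. y n i \<in> rball Y (q j) e" if "n \<ge> n0" for n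
  proof -
    have "\<not> rball Y (y n i) (e / 2) \<subseteq> points Y - (\<Union>j<K. rball Y (q j) (e / 2))"
    proof
      assume sub: "rball Y (y n i) (e / 2) \<subseteq> points Y - (\<Union>j<K. rball Y (q j) (e / 2))"
      have "points Y - (\<Union>j<K. rball Y (q j) (e / 2)) \<in> sets (snd Y)"
        using mm_space_ball_sets[OF Y] mm_spaceD(4)[OF Y] by (metis sets.Diff sets.finite_UN finite_lessThan sets.top)
      from Y.finite_measure_mono[OF sub this] show False
        using K c(2)[OF that] by simp
    qed
    then obtain z where "z \<in> rball Y (y n i) (e / 2)"
      "z \<notin> points Y - (\<Union>j<K. rball Y (q j) (e / 2))"
      by blast
    moreover from this have "z \<in> points Y"
      by simp
    ultimately obtain j where z: "z \<in> rball Y (y n i) (e / 2)" "j < K" "z \<in> rball Y (q j) (e / 2)"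
      by blast
    have "rdist Y (q j) (y n i) \<le> rdist Y (q j) z + rdist Y z (y n i)"
      using z by (intro mdist_triangle) auto
    then show ?thesis
      using z y by (intro exI[of _ j]) (auto simp: mdist_commute)
  qed
  let ?K = "q ` {..<K} \<union> (\<lambda>n. y n i) ` {..<n0}"
  have "range (\<lambda>n. y n i) \<subseteq> (\<Union>x\<in>?K. rball Y x e)"
  proof
    fix u assume "u \<in> range (\<lambda>n. y n i)"
    then obtain n where u: "u = y n i" by blast
    show "u \<in> (\<Union>x\<in>?K. rball Y x e)"
    proof (cases "n \<ge> n0")
      case True
      then obtain j where "j < K" "y n i \<in> rball Y (q j) e" using near by blast
      then show ?thesis unfolding u by blast
    next
      case False
      moreover have "y n i \<in> rball Y (y n i) e"
        using y[of n] \<open>e > 0\<close> by (simp add: mdist_self)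
      ultimately show ?thesis unfolding u by (intro UN_I[of "y n i"]) auto
    qed
  qed
  moreover have "finite ?K" "?K \<subseteq> points Y" using q' y by auto
  ultimately show "\<exists>K. finite K \<and> K \<subseteq> points Y \<and> range (\<lambda>n. y n i) \<subseteq> (\<Union>x\<in>K. rball Y x e)"
    by blast
qed (use y in auto)

text \<open>At stage \<open>n\<close> the first \<open>n\<close> points are matched up to \<open>1 / (n + 1)\<close> for the profiles among the first \<open>n\<close> in an
  enumeration. Each coordinate of the resulting sequence of configurations ranges over a totally bounded set, so a
  diagonal subsequence converges, and the profiles are continuous.\<close>

lemma profile_copy_exists:
  assumes X: "mm_space X" and Y: "mm_space Y"
    and eq: "\<And>k es. on_vertices k es \<Longrightarrow> semichar X k es = semichar Y k es"
    and x: "\<And>i. x i \<in> points X"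
  obtains y where "\<And>i. y i \<in> points Y" "\<And>t. profile Y t y = profile X t x"
proof -
  obtain y0 where y0: "y0 \<in> points Y" using mm_space_nonempty[OF Y] by blast
  define T where "T n = {t :: (nat \<times> nat) list \<times> nat list. to_nat t < n \<and> supported n t}" for n
  have finT: "finite (T n)" for n
    by (rule finite_subset[OF _ finite_vimageI[OF finite_lessThan[of n] inj_to_nat]]) (auto simp: T_def)
  have supp: "\<exists>N. supported N t" for t :: "(nat \<times> nat) list \<times> nat list"
  proof -
    have "finite (fst ` set (fst t) \<union> snd ` set (fst t) \<union> set (snd t))" by simp
    then obtain N where "\<forall>i\<in>fst ` set (fst t) \<union> snd ` set (fst t) \<union> set (snd t). i < N"
      unfolding finite_nat_set_iff_bounded by blast
    then have "supported N t"
      unfolding supported_def by (force simp: image_iff)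
    then show ?thesis ..
  qed
  have evT: "eventually (\<lambda>n. t \<in> T n) sequentially" for t
  proof -
    obtain N where "supported N t" using supp by blast
    then show ?thesis
      unfolding eventually_sequentially T_def
      by (intro exI[of _ "max N (Suc (to_nat t))"]) (auto intro: supported_mono)
  qed
  define P where "P n y \<longleftrightarrow> (\<forall>i. y i \<in> points Y) \<and> (\<forall>t\<in>T n. \<bar>profile Y t y - profile X t x\<bar> < 1 / real (Suc n))"
    for n and y :: "nat \<Rightarrow> 'b"
  have "\<exists>y. P n y" for n
  proof -
    obtain y where y: "\<And>i. i < n \<Longrightarrow> y i \<in> points Y"
      "\<And>t. t \<in> T n \<Longrightarrow> \<bar>profile Y t y - profile X t x\<bar> < 1 / real (Suc n)"
      by (rule profile_approximation[OF X Y eq finT, of n n x "1 / real (Suc n)"]) (auto simp: T_def x)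
    \<comment> \<open>Coordinates beyond \<open>n\<close> are irrelevant for the profiles in \<open>T n\<close>; the value \<open>y0\<close> keeps them in the space.\<close>
    let ?y = "\<lambda>i. if i < n then y i else y0"
    have "profile Y t ?y = profile Y t y" if "t \<in> T n" for t
      using that by (intro profile_cong[of n]) (auto simp: T_def)
    then have "P n ?y"
      using y y0 by (simp add: P_def)
    then show ?thesis by blast
  qed
  then obtain y where "\<And>n. P n (y n)"
    by metis
  then have y: "\<And>n i. y n i \<in> points Y"
    "\<And>n t. t \<in> T n \<Longrightarrow> \<bar>profile Y t (y n) - profile X t x\<bar> < 1 / real (Suc n)"
    by (simp_all add: P_def)
  have conv: "(\<lambda>n. profile Y t (y n)) \<longlonglongrightarrow> profile X t x" for t
  proof -
    have "(\<lambda>n. profile Y t (y n) - profile X t x) \<longlonglongrightarrow> 0"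
    proof (rule Lim_null_comparison)
      show "eventually (\<lambda>n. norm (profile Y t (y n) - profile X t x) \<le> 1 / real (Suc n)) sequentially"
        using evT[of t]
      proof eventually_elim
        case (elim n)
        then show ?case using y(2)[of t n] by simp
      qed
      show "(\<lambda>n. 1 / real (Suc n)) \<longlonglongrightarrow> 0"
        by (rule LIMSEQ_Suc[OF lim_1_over_n])
    qed
    then show ?thesis by (simp add: LIM_zero_iff)
  qed
  define Q where "Q i s \<longleftrightarrow> (\<exists>l\<in>points Y. (\<lambda>n. rdist Y (y (s n) i) l) \<longlonglongrightarrow> 0)" for i and s :: "nat \<Rightarrow> nat"
  obtain s :: "nat \<Rightarrow> nat" where s: "strict_mono s" "\<And>i. Q i s"
  proof (rule diagonal_subsequence[of Q])
    fix i and s :: "nat \<Rightarrow> nat" assume "strict_mono s"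
    then have "(\<lambda>n. profile Y t (y (s n))) \<longlonglongrightarrow> profile X t x" for t
      using LIMSEQ_subseq_LIMSEQ[OF conv[of t]] by (simp add: o_def)
    then have "Metric_space.mtotally_bounded (points Y) (rdist Y) (range (\<lambda>n. y (s n) i))"
      using y(1) x by (intro profile_convergence_totally_bounded[OF X Y]) auto
    then obtain r :: "nat \<Rightarrow> nat" and l where "strict_mono r" "l \<in> points Y" "(\<lambda>n. rdist Y (y (s (r n)) i) l) \<longlonglongrightarrow> 0"
      by (rule totally_bounded_convergent_subsequence[OF mm_spaceD(1)[OF Y]])
    then show "\<exists>r :: nat \<Rightarrow> nat. strict_mono r \<and> Q i (s \<circ> r)"
      unfolding Q_def by auto
  next
    fix i s and r :: "nat \<Rightarrow> nat" assume "strict_mono r" "Q i s"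
    then show "Q i (s \<circ> r)"
      unfolding Q_def using LIMSEQ_subseq_LIMSEQ by (fastforce simp: o_def)
  next
    fix i s k assume "Q i (s \<circ> (+) k)"
    then show "Q i s"
      unfolding Q_def using LIMSEQ_offset[where k = k] by (fastforce simp: add.commute[of k])
  qed blast
  then have "\<exists>l. l \<in> points Y \<and> (\<lambda>n. rdist Y (y (s n) i) l) \<longlonglongrightarrow> 0" for i
    by (auto simp: Q_def)
  then obtain l where l: "\<And>i. l i \<in> points Y" "\<And>i. (\<lambda>n. rdist Y (y (s n) i) (l i)) \<longlonglongrightarrow> 0"
    by metis
  have "profile Y t l = profile X t x" for t
  proof (rule LIMSEQ_unique)
    obtain N where N: "supported N t" using supp by blast
    let ?C = "real (2 * length (fst t) + length (snd t))"
    have "(\<lambda>n. ?C * (\<Sum>i<N. rdist Y (y (s n) i) (l i))) \<longlonglongrightarrow> ?C * (\<Sum>i<N. 0)"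
      by (intro tendsto_intros l)
    then have lim0: "(\<lambda>n. ?C * (\<Sum>i<N. rdist Y (y (s n) i) (l i))) \<longlonglongrightarrow> 0" by simp
    have "(\<lambda>n. profile Y t (y (s n)) - profile Y t l) \<longlonglongrightarrow> 0"
    proof (rule Lim_null_comparison[OF always_eventually lim0], intro allI)
      fix n
      have "rdist Y (y (s n) i) (l i) \<le> (\<Sum>i<N. rdist Y (y (s n) i) (l i))" if "i < N" for i
        using that by (intro member_le_sum) auto
      then show "norm (profile Y t (y (s n)) - profile Y t l) \<le> ?C * (\<Sum>i<N. rdist Y (y (s n) i) (l i))"
        unfolding real_norm_def using y(1) l(1) by (intro profile_lipschitz[OF Y N]) auto
    qed
    then show "(\<lambda>n. profile Y t (y (s n))) \<longlonglongrightarrow> profile Y t l"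
      by (simp add: LIM_zero_iff)
    show "(\<lambda>n. profile Y t (y (s n))) \<longlonglongrightarrow> profile X t x"
      using LIMSEQ_subseq_LIMSEQ[OF conv s(1)] by (simp add: o_def)
  qed
  then show ?thesis using that l(1) by blast
qed

lemma openin_ball_conditions:
  assumes "\<And>i. q i \<in> mspace m"
  shows "openin (mtopology_of m) {z \<in> mspace m. \<forall>g\<in>set gs. mdist m (q (fst g)) z < snd g}"
proof (induction gs)
  case Nil
  then show ?case using openin_topspace[of "mtopology_of m"] by simp
next
  case (Cons h gs)
  have "{z \<in> mspace m. \<forall>g\<in>set (h # gs). mdist m (q (fst g)) z < snd g} =
    mball_of m (q (fst h)) (snd h) \<inter> {z \<in> mspace m. \<forall>g\<in>set gs. mdist m (q (fst g)) z < snd g}"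
    using assms by auto
  then show ?case using openin_Int[OF openin_ball Cons] by simp
qed

text \<open>Finite intersections of balls with centres in a dense sequence form a generator of the Borel sets that is
  stable under intersection.\<close>

lemma measure_eq_on_balls:
  assumes Y: "mm_space Y" and q: "dense_seq (fst Y) q"
    and M: "prob_space M" "sets M = sets (snd Y)"
    and eq: "\<And>gs :: (nat \<times> real) list. measure M {z \<in> points Y. \<forall>g\<in>set gs. rdist Y (q (fst g)) z < snd g} =
      mass Y {z \<in> points Y. \<forall>g\<in>set gs. rdist Y (q (fst g)) z < snd g}"
  shows "M = snd Y"
proof -
  interpret M: prob_space M by fact
  interpret Y: prob_space "snd Y" using Y by (rule mm_spaceD)
  let ?m = "fst Y"
  have q': "q j \<in> mspace ?m" for j using q by (simp add: dense_seq_def)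
  define B where "B gs = {z \<in> mspace ?m. \<forall>g\<in>set gs. mdist ?m (q (fst g)) z < snd g}" for gs :: "(nat \<times> real) list"
  let ?E = "range B"
  have sets_B: "B gs \<in> sets (snd Y)" for gs
    unfolding B_def by (intro mm_space_open_sets[OF Y] openin_ball_conditions q')
  have open_E: "U \<in> sigma_sets (mspace ?m) ?E" if U: "openin (mtopology_of ?m) U" for U
  proof -
    define I where "I = {(i, c). c \<in> \<rat> \<and> mball_of ?m (q i) c \<subseteq> U}"
    have "I \<subseteq> UNIV \<times> \<rat>" by (auto simp: I_def)
    moreover have "countable (UNIV \<times> \<rat> :: (nat \<times> real) set)"
      by (intro countable_SIGMA countable_rat) auto
    ultimately have I: "countable I" by (rule countable_subset)
    have "U = (\<Union>g\<in>I. B [g])"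
    proof (intro subset_antisym subsetI)
      fix u assume u: "u \<in> U"
      then obtain e where e: "e > 0" "\<And>z. z \<in> mspace ?m \<Longrightarrow> mdist ?m u z < e \<Longrightarrow> z \<in> U"
        using U unfolding openin_mtopology_of_iff by blast
      have um: "u \<in> mspace ?m" using U u unfolding openin_mtopology_of_iff by blast
      obtain c where c: "c \<in> \<rat>" "0 < c" "c < e / 2"
        using Rats_dense_in_real[of 0 "e / 2"] e by auto
      obtain i where i: "mdist ?m u (q i) < c"
        using q um c unfolding dense_seq_def by blast
      have "z \<in> U" if "z \<in> mball_of ?m (q i) c" for z
        using that e(2)[of z] mdist_triangle[OF um q'[of i], of z] i c by auto
      then have "(i, c) \<in> I" using c by (auto simp: I_def)
      then show "u \<in> (\<Union>g\<in>I. B [g])"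
        using um i by (intro UN_I[of "(i, c)"]) (auto simp: B_def mdist_commute)
    next
      fix u assume "u \<in> (\<Union>g\<in>I. B [g])"
      then show "u \<in> U" using q' by (auto simp: I_def B_def)
    qed
    also have "\<dots> \<in> sigma_sets (mspace ?m) ?E"
      using I by (intro sigma_sets_UNION) (auto intro: sigma_sets.Basic)
    finally show ?thesis .
  qed
  have sigma: "sets (snd Y) = sigma_sets (mspace ?m) ?E"
  proof
    show "sets (snd Y) \<subseteq> sigma_sets (mspace ?m) ?E"
      unfolding mm_spaceD(5)[OF Y] sets_metric_borel
      by (rule sigma_sets_mono) (use open_E in auto)
    show "sigma_sets (mspace ?m) ?E \<subseteq> sets (snd Y)"
      using sets.sigma_sets_subset[of ?E "snd Y"] sets_B mm_spaceD(4)[OF Y] by auto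
  qed
  show ?thesis
  proof (rule measure_eqI_generator_eq[of ?E "mspace ?m" _ _ "\<lambda>_. mspace ?m"])
    show "Int_stable ?E"
    proof (rule Int_stableI)
      fix a b assume "a \<in> ?E" "b \<in> ?E"
      then obtain gs hs where "a = B gs" "b = B hs" by blast
      then have "a \<inter> b = B (gs @ hs)" by (auto simp: B_def)
      then show "a \<inter> b \<in> ?E" by blast
    qed
    show "emeasure M A = emeasure (snd Y) A" if "A \<in> ?E" for A
      using that eq by (auto simp: M.emeasure_eq_measure Y.emeasure_eq_measure B_def)
    show "range (\<lambda>_. mspace ?m) \<subseteq> ?E"
      by (auto simp: B_def intro!: image_eqI[of _ _ "[]"])
  qed (use sigma M in \<open>auto simp: B_def\<close>)
qed

lemma short_map_fixing_dense_seq: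
  assumes d: "dense_seq m q" and h: "\<And>i. h (q i) = q i" "\<And>u. u \<in> mspace m \<Longrightarrow> h u \<in> mspace m"
    "\<And>u v. u \<in> mspace m \<Longrightarrow> v \<in> mspace m \<Longrightarrow> mdist m (h u) (h v) \<le> mdist m u v"
    and u: "u \<in> mspace m"
  shows "h u = u"
proof -
  have "mdist m (h u) u \<le> 0 + e" if e: "e > 0" for e
  proof -
    obtain i where i: "mdist m u (q i) < e / 2"
      using d u e unfolding dense_seq_def by (meson half_gt_zero)
    have qi: "q i \<in> mspace m" using d by (simp add: dense_seq_def)
    show ?thesis
      using mdist_triangle[OF h(2)[OF u] qi u] h(3)[OF u qi] h(1)[of i] i by (simp add: mdist_commute)
  qed
  then have "mdist m (h u) u \<le> 0" by (rule field_le_epsilon)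
  then have "mdist m (h u) u = 0" by (simp add: antisym)
  then show ?thesis using h(2)[OF u] u by simp
qed

text \<open>Let \<open>x\<close> be dense in \<open>X\<close> and \<open>y\<close> a sequence in \<open>Y\<close> with the same profiles. Edges show that \<open>x\<close> and \<open>y\<close> have the
  same mutual distances; stars show that the distances from \<open>x\<close> to a random point of \<open>X\<close> have the same joint law as
  those from \<open>y\<close> to a random point of \<open>Y\<close>. Since a random point of \<open>X\<close> is almost surely near some \<open>x\<^sub>i\<close>, the
  points of \<open>Y\<close> away from all \<open>y\<^sub>i\<close> form a null set, and by full support \<open>y\<close> is dense.\<close>

theorem semichar_eq_imp_iso:
  assumes X: "mm_space X" and Y: "mm_space Y"
    and eq: "\<And>k es. on_vertices k es \<Longrightarrow> semichar X k es = semichar Y k es"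
  shows "X \<simeq>\<^sub>m Y"
proof -
  interpret X: prob_space "snd X" using X by (rule mm_spaceD)
  interpret Y: prob_space "snd Y" using Y by (rule mm_spaceD)
  let ?mX = "fst X" and ?mY = "fst Y"
  obtain x where dx: "dense_seq ?mX x" using mm_space_dense_seq[OF X] .
  have x: "x i \<in> mspace ?mX" for i using dx by (simp add: dense_seq_def)
  obtain y where y: "\<And>i. y i \<in> mspace ?mY" and prof: "\<And>t. profile Y t y = profile X t x"
  proof (rule profile_copy_exists[where x = x, OF X Y eq x])
    fix y assume "\<And>i. y i \<in> mspace ?mY" "\<And>t. profile Y t y = profile X t x"
    then show ?thesis by (rule that)
  qed
  have dist_eq: "mdist ?mY (y i) (y j) = mdist ?mX (x i) (x j)" for i j
    using prof[of "([(i, j)], [])"] by (simp add: profile_edge[OF X] profile_edge[OF Y])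
  have star_eq: "(\<integral>z. (\<Prod>i\<leftarrow>js. exp (- mdist ?mX (x i) z)) \<partial>snd X) = (\<integral>z. (\<Prod>i\<leftarrow>js. exp (- mdist ?mY (y i) z)) \<partial>snd Y)" for js
    using prof[of "([], js)"] by (simp add: profile_star star_prod_def)
  have law: "mass X {z \<in> space (snd X). \<forall>g\<in>set gs. exp (- mdist ?mX (x (fst g)) z) \<in> snd g} =
      mass Y {z \<in> space (snd Y). \<forall>g\<in>set gs. exp (- mdist ?mY (y (fst g)) z) \<in> snd g}"
    if "\<And>g. g \<in> set gs \<Longrightarrow> snd g \<in> sets borel" for gs
  proof (rule moments_determine_joint_law[OF mm_spaceD(3)[OF X] mm_spaceD(3)[OF Y] _ _ _ _ _ _ star_eq that])
    show "(\<lambda>z. exp (- mdist ?mX (x i) z)) \<in> borel_measurable (snd X)" for i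
      using measurable_mdist_const[OF X x] by measurable
    show "(\<lambda>z. exp (- mdist ?mY (y i) z)) \<in> borel_measurable (snd Y)" for i
      using measurable_mdist_const[OF Y y] by measurable
  qed auto
  \<comment> \<open>A distance below \<open>c\<close> means that \<open>exp (- r)\<close> lies in the half-line above \<open>exp (- c)\<close>.\<close>
  have balls: "mass X {z \<in> mspace ?mX. \<forall>g\<in>set gs. mdist ?mX (x (fst g)) z < snd g} =
      mass Y {z \<in> mspace ?mY. \<forall>g\<in>set gs. mdist ?mY (y (fst g)) z < snd g}" for gs :: "(nat \<times> real) list"
  proof -
    have "snd h \<in> sets borel" if "h \<in> set (map (\<lambda>g. (fst g, {exp (- snd g)<..})) gs)" for h
      using that by auto
    from law[of "map (\<lambda>g. (fst g, {exp (- snd g)<..})) gs", OF this] show ?thesis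
      by (simp add: mm_spaceD(4)[OF X] mm_spaceD(4)[OF Y])
  qed
  have far: "mass X {z \<in> mspace ?mX. \<forall>i<K. e \<le> mdist ?mX (x i) z} =
      mass Y {z \<in> mspace ?mY. \<forall>i<K. e \<le> mdist ?mY (y i) z}" for e :: real and K :: nat
  proof -
    have "snd h \<in> sets borel" if "h \<in> set (map (\<lambda>i. (i, {..exp (- e)})) [0..<K])" for h
      using that by auto
    from law[of "map (\<lambda>i. (i, {..exp (- e)})) [0..<K]", OF this]
    have "mass X {z \<in> mspace ?mX. \<forall>i\<in>{0..<K}. e \<le> mdist ?mX (x i) z} =
        mass Y {z \<in> mspace ?mY. \<forall>i\<in>{0..<K}. e \<le> mdist ?mY (y i) z}"
      by (simp add: mm_spaceD(4)[OF X] mm_spaceD(4)[OF Y])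
    then show ?thesis by (simp add: Ball_def)
  qed
  have dy: "dense_seq ?mY y"
    unfolding dense_seq_def
  proof (intro conjI allI ballI impI y, rule ccontr)
    fix z and e :: real assume z: "z \<in> mspace ?mY" "e > 0" and "\<nexists>i. mdist ?mY z (y i) < e"
    then have away: "mdist ?mY z (y i) \<ge> e" for i by (simp add: not_less)
    let ?B = "mball_of ?mY z (e / 2)"
    have "mass Y ?B > 0"
      using z by (intro mm_space_ball_pos[OF Y]) auto
    then obtain K :: nat where K: "mass X (mspace ?mX - (\<Union>i<K. mball_of ?mX (x i) (e / 2))) < mass Y ?B"
      using mm_space_net[OF X dx _, of "e / 2"] z by auto
    have "mspace ?mX - (\<Union>i<K. mball_of ?mX (x i) (e / 2)) = {z \<in> mspace ?mX. \<forall>i<K. e / 2 \<le> mdist ?mX (x i) z}"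
      using x by (auto simp: not_less)
    then have "mass Y {z \<in> mspace ?mY. \<forall>i<K. e / 2 \<le> mdist ?mY (y i) z} < mass Y ?B"
      using K far[of K "e / 2"] by simp
    moreover have "mass Y ?B \<le> mass Y {z \<in> mspace ?mY. \<forall>i<K. e / 2 \<le> mdist ?mY (y i) z}"
    proof (rule Y.finite_measure_mono)
      show "?B \<subseteq> {z \<in> mspace ?mY. \<forall>i<K. e / 2 \<le> mdist ?mY (y i) z}"
      proof
        fix u assume u: "u \<in> ?B"
        have "e / 2 \<le> mdist ?mY (y i) u" for i
          using away[of i] mdist_triangle[OF z(1) _ y[of i], of u] u by (auto simp: mdist_commute)
        then show "u \<in> {z \<in> mspace ?mY. \<forall>i<K. e / 2 \<le> mdist ?mY (y i) z}"
          using u by auto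
      qed
      have "{z \<in> mspace ?mY. \<forall>i<K. e / 2 \<le> mdist ?mY (y i) z} = mspace ?mY - (\<Union>i<K. mball_of ?mY (y i) (e / 2))"
        using y by (auto simp: not_less)
      moreover have "\<dots> \<in> sets (snd Y)"
        using mm_space_ball_sets[OF Y] mm_spaceD(4)[OF Y] by (metis sets.Diff sets.finite_UN finite_lessThan sets.top)
      ultimately show "{z \<in> mspace ?mY. \<forall>i<K. e / 2 \<le> mdist ?mY (y i) z} \<in> sets (snd Y)" by simp
    qed
    ultimately show False by simp
  qed
  obtain f where f: "f \<in> mspace ?mX \<rightarrow> mspace ?mY" "\<And>i. f (x i) = y i"
    "\<And>u v. u \<in> mspace ?mX \<Longrightarrow> v \<in> mspace ?mX \<Longrightarrow> mdist ?mY (f u) (f v) \<le> mdist ?mX u v"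
  proof (rule short_map_extension[where s = y, OF dx mm_spaceD(1)[OF Y] y eq_refl[OF dist_eq]])
    fix f assume "f \<in> mspace ?mX \<rightarrow> mspace ?mY" "\<And>i. f (x i) = y i"
      "\<And>u v. u \<in> mspace ?mX \<Longrightarrow> v \<in> mspace ?mX \<Longrightarrow> mdist ?mY (f u) (f v) \<le> mdist ?mX u v"
    then show ?thesis by (rule that)
  qed
  obtain g where g: "g \<in> mspace ?mY \<rightarrow> mspace ?mX" "\<And>i. g (y i) = x i"
    "\<And>u v. u \<in> mspace ?mY \<Longrightarrow> v \<in> mspace ?mY \<Longrightarrow> mdist ?mX (g u) (g v) \<le> mdist ?mY u v"
  proof (rule short_map_extension[where s = x, OF dy mm_spaceD(1)[OF X] x eq_refl[OF dist_eq[symmetric]]])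
    fix g assume "g \<in> mspace ?mY \<rightarrow> mspace ?mX" "\<And>i. g (y i) = x i"
      "\<And>u v. u \<in> mspace ?mY \<Longrightarrow> v \<in> mspace ?mY \<Longrightarrow> mdist ?mX (g u) (g v) \<le> mdist ?mY u v"
    then show ?thesis by (rule that)
  qed
  have gf: "g (f u) = u" if u: "u \<in> mspace ?mX" for u
  proof -
    have "mdist ?mX (g (f a)) (g (f b)) \<le> mdist ?mX a b" if "a \<in> mspace ?mX" "b \<in> mspace ?mX" for a b
      using f(3)[OF that] g(3)[of "f a" "f b"] f(1) that by fastforce
    then show ?thesis
      by (intro short_map_fixing_dense_seq[OF dx, of "\<lambda>u. g (f u)" u] u)
        (use f(1,2) g(1,2) in \<open>auto simp: Pi_iff\<close>)
  qed
  have fg: "f (g u) = u" if u: "u \<in> mspace ?mY" for u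
  proof -
    have "mdist ?mY (f (g a)) (f (g b)) \<le> mdist ?mY a b" if "a \<in> mspace ?mY" "b \<in> mspace ?mY" for a b
      using g(3)[OF that] f(3)[of "g a" "g b"] g(1) that by fastforce
    then show ?thesis
      by (intro short_map_fixing_dense_seq[OF dy, of "\<lambda>u. f (g u)" u] u)
        (use f(1,2) g(1,2) in \<open>auto simp: Pi_iff\<close>)
  qed
  have emb: "isometric_embedding ?mX ?mY f"
    unfolding isometric_embedding_def
  proof (intro conjI ballI f(1) antisym f(3))
    fix u v assume "u \<in> mspace ?mX" "v \<in> mspace ?mX"
    then show "mdist ?mX u v \<le> mdist ?mY (f u) (f v)"
      using g(3)[of "f u" "f v"] f(1) gf by auto
  qed
  moreover have "f ` mspace ?mX = mspace ?mY"
    using f(1) g(1) fg by (force intro: rev_image_eqI)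
  moreover have "distr (snd X) (metric_borel ?mY) f = snd Y"
  proof (rule measure_eq_on_balls[OF Y dy])
    have fm: "f \<in> measurable (snd X) (metric_borel ?mY)"
      by (rule isometric_embedding_measurable[OF X emb])
    show "prob_space (distr (snd X) (metric_borel ?mY) f)"
      using X.prob_space_distr[OF fm] .
    show "sets (distr (snd X) (metric_borel ?mY) f) = sets (snd Y)"
      using mm_spaceD(5)[OF Y] by simp
    fix gs :: "(nat \<times> real) list"
    let ?S = "{z \<in> mspace ?mY. \<forall>g\<in>set gs. mdist ?mY (y (fst g)) z < snd g}"
    have "openin (mtopology_of ?mY) ?S"
      by (rule openin_ball_conditions[OF y])
    then have S: "?S \<in> sets (metric_borel ?mY)" by (rule open_in_metric_borel)
    have "measure (distr (snd X) (metric_borel ?mY) f) ?S = mass X (f -` ?S \<inter> space (snd X))"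
      using fm S by (simp add: measure_distr)
    also have "f -` ?S \<inter> space (snd X) = {z \<in> mspace ?mX. \<forall>g\<in>set gs. mdist ?mX (x (fst g)) z < snd g}"
    proof -
      have "mdist ?mY (y i) (f z) = mdist ?mX (x i) z" if "z \<in> mspace ?mX" for i z
        using emb x that f(2) unfolding isometric_embedding_def by metis
      then show ?thesis
        using f(1) mm_spaceD(4)[OF X] by auto
    qed
    also have "mass X \<dots> = mass Y ?S" by (rule balls)
    finally show "measure (distr (snd X) (metric_borel ?mY) f) ?S = mass Y ?S" .
  qed
  ultimately show ?thesis
    unfolding mm_iso_def by blast
qed

section \<open>Limits of direct summands\<close>

text \<open>Points at distance \<open>0\<close> are identified by passing to the least index of each class.\<close>

lemma pseudo_metric_completion:
  fixes \<rho> :: "nat \<Rightarrow> nat \<Rightarrow> real"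
  assumes refl: "\<And>i. \<rho> i i = 0" and sym: "\<And>i j. \<rho> i j = \<rho> j i" and tri: "\<And>i j k. \<rho> i k \<le> \<rho> i j + \<rho> j k"
  obtains S :: "(nat \<Rightarrow> real) metric" and e
  where "mcomplete_of S" "dense_seq S e" "\<And>i j. mdist S (e i) (e j) = \<rho> i j"
proof -
  have pos: "0 \<le> \<rho> i j" for i j
    using tri[of i i j] refl[of i] sym[of i j] by linarith
  define rep where "rep i = (LEAST j. \<rho> i j = 0)" for i
  have rep0: "\<rho> i (rep i) = 0" for i
    unfolding rep_def by (rule LeastI[of _ i]) (rule refl)
  have shift: "\<rho> i k = \<rho> j k" if "\<rho> i j = 0" for i j k
    using tri[of i k j] tri[of j k i] sym[of i j] that by linarith
  have \<rho>_rep: "\<rho> (rep i) (rep j) = \<rho> i j" for i j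
    using shift[OF rep0, of i "rep j"] shift[OF rep0, of j i] sym by metis
  have rep_eq: "rep i = rep j" if "\<rho> i j = 0" for i j
    unfolding rep_def using shift[OF that] by simp
  interpret R: Metric_space "range rep" \<rho>
  proof
    show "\<rho> x y = 0 \<longleftrightarrow> x = y" if "x \<in> range rep" "y \<in> range rep" for x y
      using that rep_eq \<rho>_rep refl by (metis imageE)
  qed (rule pos, rule sym, rule tri)
  obtain f :: "nat \<Rightarrow> nat \<Rightarrow> real" and S where S: "mcomplete_of S" "f \<in> range rep \<rightarrow> mspace S"
    "mtopology_of S closure_of f ` range rep = mspace S"
    "\<And>x y. x \<in> range rep \<Longrightarrow> y \<in> range rep \<Longrightarrow> mdist S (f x) (f y) = \<rho> x y"
    by (rule R.metric_completion) blast
  interpret S: Metric_space "mspace S" "mdist S" by simp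
  have "dense_seq S (f \<circ> rep)"
    unfolding dense_seq_def
  proof (intro conjI allI ballI impI)
    show "(f \<circ> rep) i \<in> mspace S" for i using S(2) by auto
    fix x and e :: real assume x: "x \<in> mspace S" "e > 0"
    then have "x \<in> S.mtopology closure_of f ` range rep"
      using S(3) by (simp add: mtopology_of_def)
    then show "\<exists>i. mdist S x ((f \<circ> rep) i) < e"
      using x unfolding S.metric_closure_of by auto
  qed
  then show ?thesis
    using that[of S "f \<circ> rep"] S(1) S(4) \<rho>_rep by auto
qed

text \<open>Pairs \<open>(p\<^sub>i, q\<^sub>i)\<close> of nearby points, the \<open>q\<^sub>i\<close> forming a net of \<open>Z\<close> up to mass \<open>\<eta>\<close>, are carried by \<open>f\<close> and \<open>g\<close> to a finite
  correspondence between \<open>V\<close> and \<open>U\<close>. If \<open>w\<close> and \<open>z\<close> are close and \<open>z\<close> is close to \<open>q\<^sub>i\<close>, then \<open>f w\<close> and \<open>g z\<close> are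
  close to the matched points because \<open>f\<close> and \<open>g\<close> are short. Hence the Prohorov condition passes from \<open>W\<close> and \<open>Z\<close> to
  the images.\<close>

lemma short_images_close:
  assumes W: "mm_space W" and Z: "mm_space Z" and V: "mm_space V" and U: "mm_space U"
    and d: "cross_metric (fst W) (fst Z) d"
    and dom: "cross_dominates W Z d \<epsilon>" "cross_dominates Z W (\<lambda>z w. d w z) \<epsilon>" and \<epsilon>: "\<epsilon> \<le> \<eta>" and "\<eta> > 0"
    and f: "f \<in> measurable (snd W) (snd V)" "distr (snd W) (snd V) f = snd V"
      "\<And>w w'. w \<in> points W \<Longrightarrow> w' \<in> points W \<Longrightarrow> rdist V (f w) (f w') \<le> rdist W w w'"
    and g: "g \<in> measurable (snd Z) (snd U)" "distr (snd Z) (snd U) g = snd U"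
      "\<And>z z'. z \<in> points Z \<Longrightarrow> z' \<in> points Z \<Longrightarrow> rdist U (g z) (g z') \<le> rdist Z z z'"
    and I: "finite I" "I \<noteq> {}" and p: "\<And>i. i \<in> I \<Longrightarrow> p i \<in> points W" and q: "\<And>i. i \<in> I \<Longrightarrow> q i \<in> points Z"
    and pq: "\<And>i. i \<in> I \<Longrightarrow> d (p i) (q i) < \<eta>"
    and fg: "\<And>i j. i \<in> I \<Longrightarrow> j \<in> I \<Longrightarrow>
      \<bar>rdist V (f (p i)) (f (p j)) - rdist U (g (q i)) (g (q j))\<bar> \<le> 2 * \<eta>"
    and net: "mass Z (points Z - (\<Union>i\<in>I. rball Z (q i) \<eta>)) < \<eta>"
  shows "GPr_dist V U \<le> 6 * \<eta>"
proof -
  interpret W: prob_space "snd W" using W by (rule mm_spaceD)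
  interpret Z: prob_space "snd Z" using Z by (rule mm_spaceD)
  interpret V: prob_space "snd V" using V by (rule mm_spaceD)
  interpret U: prob_space "snd U" using U by (rule mm_spaceD)
  note sp = mm_spaceD(4)[OF W] mm_spaceD(4)[OF Z] mm_spaceD(4)[OF V] mm_spaceD(4)[OF U]
  have fs: "f w \<in> points V" if "w \<in> points W" for w
    using measurable_space[OF f(1)] that sp by auto
  have gs: "g z \<in> points U" if "z \<in> points Z" for z
    using measurable_space[OF g(1)] that sp by auto
  define c where "c v u = (MIN i\<in>I. rdist V v (f (p i)) + rdist U (g (q i)) u) + \<eta>" for v u
  have c: "cross_metric (fst V) (fst U) c"
    unfolding c_def using I \<open>\<eta> > 0\<close> p q fg fs gs by (intro cross_metric_correspondence) auto
  have key: "c (f w) (g z) < 6 * \<eta>"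
    if w: "w \<in> points W" and z: "z \<in> points Z" and "d w z < \<epsilon>" and i: "i \<in> I" "rdist Z (q i) z < \<eta>" for w z i
  proof -
    have "(MIN i\<in>I. rdist V (f w) (f (p i)) + rdist U (g (q i)) (g z)) \<le>
        rdist V (f w) (f (p i)) + rdist U (g (q i)) (g z)"
      using I i by (intro Min_le) auto
    moreover have "rdist W w (p i) \<le> d w z + d (p i) z" "d (p i) z \<le> d (p i) (q i) + rdist Z (q i) z"
      using d w z p[OF i(1)] q[OF i(1)] unfolding cross_metric_def by blast+
    moreover have "rdist V (f w) (f (p i)) \<le> rdist W w (p i)" "rdist U (g (q i)) (g z) \<le> rdist Z (q i) z"
      using f(3)[OF w p[OF i(1)]] g(3)[OF q[OF i(1)] z] by auto
    ultimately show ?thesis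
      using pq[OF i(1)] i(2) \<open>d w z < \<epsilon>\<close> \<epsilon> \<open>\<eta> > 0\<close> unfolding c_def by linarith
  qed
  let ?N = "\<Union>i\<in>I. rball Z (q i) \<eta>"
  have N: "?N \<in> sets (snd Z)"
    using mm_space_ball_sets[OF Z] I by auto
  have split: "mass Z A \<le> mass Z (A \<inter> ?N) + \<eta>" if A: "A \<in> sets (snd Z)" for A
  proof -
    have AZ: "A \<subseteq> points Z" using sets.sets_into_space[OF A] sp by simp
    have "mass Z A = mass Z (A \<inter> ?N) + mass Z (A - ?N)"
      using Z.finite_measure_Diff'[OF A N] by simp
    moreover have "mass Z (A - ?N) \<le> mass Z (points Z - ?N)"
      using AZ N sets.compl_sets[OF N] sp by (intro Z.finite_measure_mono) auto
    ultimately show ?thesis using net by simp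
  qed
  have "cross_dominates V U c (6 * \<eta>)"
    unfolding cross_dominates_def
  proof
    fix A assume A: "A \<in> sets (snd V)"
    let ?A = "f -` A \<inter> space (snd W)" and ?C = "{u \<in> points U. \<exists>v\<in>A. c v u < 6 * \<eta>}"
    have AV: "A \<subseteq> points V" using sets.sets_into_space[OF A] sp by simp
    have A': "?A \<in> sets (snd W)" using measurable_sets[OF f(1) A] .
    have C: "?C \<in> sets (snd U)" by (rule cross_nbhd_sets[OF U c AV])
    let ?D = "{z \<in> points Z. \<exists>w\<in>?A. d w z < \<epsilon>}"
    have D: "?D \<in> sets (snd Z)"
      by (rule cross_nbhd_sets[OF Z d]) (use sp in auto)
    have "mass V A = measure (distr (snd W) (snd V) f) A" by (simp only: f(2))
    also have "\<dots> = mass W ?A"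
      using f(1) A by (simp add: measure_distr)
    also have "\<dots> \<le> mass Z ?D + \<epsilon>"
      using dom(1) A' unfolding cross_dominates_def by blast
    also have "\<dots> \<le> mass Z (?D \<inter> ?N) + \<eta> + \<eta>"
      using split[OF D] \<epsilon> by simp
    also have "mass Z (?D \<inter> ?N) \<le> mass Z (g -` ?C \<inter> space (snd Z))"
    proof (rule Z.finite_measure_mono)
      show "?D \<inter> ?N \<subseteq> g -` ?C \<inter> space (snd Z)"
      proof
        fix z assume "z \<in> ?D \<inter> ?N"
        then obtain w i where "w \<in> points W" "f w \<in> A" "z \<in> points Z" "d w z < \<epsilon>" "i \<in> I" "rdist Z (q i) z < \<eta>"
          using sp by auto
        then show "z \<in> g -` ?C \<inter> space (snd Z)"
          using key gs sp by auto
      qed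
    qed (rule measurable_sets[OF g(1) C])
    also have "\<dots> = measure (distr (snd Z) (snd U) g) ?C"
      using g(1) C by (simp add: measure_distr)
    also have "\<dots> = mass U ?C" by (simp only: g(2))
    finally show "mass V A \<le> mass U ?C + 6 * \<eta>"
      using \<open>\<eta> > 0\<close> by simp
  qed
  moreover have "cross_dominates U V (\<lambda>u v. c v u) (6 * \<eta>)"
    unfolding cross_dominates_def
  proof
    fix A assume A: "A \<in> sets (snd U)"
    let ?A = "g -` A \<inter> space (snd Z)" and ?C = "{v \<in> points V. \<exists>u\<in>A. c v u < 6 * \<eta>}"
    have AU: "A \<subseteq> points U" using sets.sets_into_space[OF A] sp by simp
    have A': "?A \<in> sets (snd Z)" using measurable_sets[OF g(1) A] .
    have C: "?C \<in> sets (snd V)" by (rule cross_nbhd_sets[OF V cross_metric_flip[OF c] AU])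
    have AN: "?A \<inter> ?N \<in> sets (snd Z)" using A' N by auto
    let ?D = "{w \<in> points W. \<exists>z\<in>?A \<inter> ?N. d w z < \<epsilon>}"
    have "mass U A = measure (distr (snd Z) (snd U) g) A" by (simp only: g(2))
    also have "\<dots> = mass Z ?A"
      using g(1) A by (simp add: measure_distr)
    also have "\<dots> \<le> mass Z (?A \<inter> ?N) + \<eta>"
      by (rule split[OF A'])
    also have "mass Z (?A \<inter> ?N) \<le> mass W ?D + \<epsilon>"
      using dom(2) AN unfolding cross_dominates_def by blast
    also have "mass W ?D \<le> mass W (f -` ?C \<inter> space (snd W))"
    proof (rule W.finite_measure_mono)
      show "?D \<subseteq> f -` ?C \<inter> space (snd W)"
      proof
        fix w assume "w \<in> ?D"
        then obtain z i where "w \<in> points W" "g z \<in> A" "z \<in> points Z" "d w z < \<epsilon>" "i \<in> I" "rdist Z (q i) z < \<eta>"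
          using sp by auto
        then show "w \<in> f -` ?C \<inter> space (snd W)"
          using key fs sp by auto
      qed
    qed (rule measurable_sets[OF f(1) C])
    also have "\<dots> = measure (distr (snd W) (snd V) f) ?C"
      using f(1) C by (simp add: measure_distr)
    also have "\<dots> = mass V ?C" by (simp only: f(2))
    finally show "mass U A \<le> mass V ?C + 6 * \<eta>"
      using \<open>\<eta> > 0\<close> \<epsilon> by simp
  qed
  ultimately show ?thesis
    using \<open>\<eta> > 0\<close> by (intro GPr_dist_le_cross[OF V U c]) auto
qed

lemma distr_snd_boxplus:
  assumes X: "mm_space X" and Y: "mm_space Y"
  shows "distr (snd (X \<boxplus> Y)) (snd Y) snd = snd Y"
proof (rule measure_eqI)
  interpret X: prob_space "snd X" using X by (rule mm_spaceD)
  interpret Y: prob_space "snd Y" using Y by (rule mm_spaceD)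
  fix A assume "A \<in> sets (distr (snd (X \<boxplus> Y)) (snd Y) snd)"
  then have A: "A \<in> sets (snd Y)" by simp
  then have AY: "A \<subseteq> space (snd Y)" by (rule sets.sets_into_space)
  have "emeasure (distr (snd (X \<boxplus> Y)) (snd Y) snd) A = emeasure (snd X \<Otimes>\<^sub>M snd Y) (space (snd X) \<times> A)"
    using A AY by (auto simp: emeasure_distr boxplus_def space_pair_measure intro!: arg_cong[where f = "emeasure _"])
  also have "\<dots> = emeasure (snd Y) A"
    using A by (simp add: Y.emeasure_pair_measure_Times X.emeasure_space_1)
  finally show "emeasure (distr (snd (X \<boxplus> Y)) (snd Y) snd) A = emeasure (snd Y) A" .
qed simp

lemma almost_minimizer_exists:
  fixes f :: "'a \<Rightarrow> real"
  assumes "S \<noteq> {}" "\<And>x. x \<in> S \<Longrightarrow> 0 \<le> f x" "\<eta> > 0"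
  obtains x where "x \<in> S" "\<And>y. y \<in> S \<Longrightarrow> f x \<le> f y + \<eta>"
proof -
  have bdd: "bdd_below (f ` S)"
    using assms(2) by (auto intro!: bdd_belowI[of _ 0])
  have "Inf (f ` S) < Inf (f ` S) + \<eta>" using assms(3) by simp
  then obtain x where x: "x \<in> S" "f x < Inf (f ` S) + \<eta>"
    using cInf_lessD[of "f ` S"] assms(1) by blast
  have "f x \<le> f y + \<eta>" if "y \<in> S" for y
    using x(2) cInf_lower[OF imageI[OF that] bdd] by linarith
  then show ?thesis using that x(1) by blast
qed

text \<open>A ball around \<open>q\<close> has positive mass, so once \<open>\<epsilon> n\<close> is below that mass the Prohorov condition forces points of
  \<open>W n\<close> near the ball.\<close>

lemma dominated_points_approximable:
  assumes W: "\<And>n. mm_space (W n)" and Z: "mm_space Z" and d: "\<And>n. cross_metric (fst (W n)) (fst Z) (d n)"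
    and dom: "\<And>n. cross_dominates Z (W n) (\<lambda>z w. d n w z) (\<epsilon> n)" and \<epsilon>: "\<epsilon> \<longlonglongrightarrow> 0"
    and q: "q \<in> points Z"
  obtains p where "\<And>n. p n \<in> points (W n)" "(\<lambda>n. d n (p n) q) \<longlonglongrightarrow> 0"
proof -
  have dpos: "0 \<le> d n w q" if "w \<in> points (W n)" for n w
    using d q that unfolding cross_metric_def by blast
  have "\<exists>p. p \<in> points (W n) \<and> (\<forall>w\<in>points (W n). d n p q \<le> d n w q + 1 / real (Suc n))" for n
    by (rule almost_minimizer_exists[of "points (W n)" "\<lambda>w. d n w q" "1 / real (Suc n)"])
      (use mm_space_nonempty[OF W] dpos in auto)
  then obtain p where p: "\<And>n. p n \<in> points (W n)"
    "\<And>n w. w \<in> points (W n) \<Longrightarrow> d n (p n) q \<le> d n w q + 1 / real (Suc n)"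
    by metis
  have "(\<lambda>n. d n (p n) q) \<longlonglongrightarrow> 0"
  proof (rule tendstoI)
    fix \<eta> :: real assume "\<eta> > 0"
    define h where "h = \<eta> / 4"
    have h: "h > 0" using \<open>\<eta> > 0\<close> by (simp add: h_def)
    let ?B = "rball Z q h"
    have "mass Z ?B > 0" by (rule mm_space_ball_pos[OF Z q h])
    then have ev: "eventually (\<lambda>n. \<epsilon> n < min h (mass Z ?B)) sequentially"
      using h by (intro order_tendstoD(2)[OF \<epsilon>]) auto
    have ev2: "eventually (\<lambda>n. 1 / real (Suc n) < h) sequentially"
      using order_tendstoD(2)[OF LIMSEQ_Suc[OF lim_1_over_n] h] .
    show "eventually (\<lambda>n. dist (d n (p n) q) 0 < \<eta>) sequentially"
      using ev ev2
    proof eventually_elim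
      case (elim n)
      have "mass Z ?B \<le> mass (W n) {w \<in> points (W n). \<exists>z\<in>?B. d n w z < \<epsilon> n} + \<epsilon> n"
        using dom[of n] mm_space_ball_sets[OF Z] unfolding cross_dominates_def by blast
      then have "mass (W n) {w \<in> points (W n). \<exists>z\<in>?B. d n w z < \<epsilon> n} > 0"
        using elim by simp
      then have "{w \<in> points (W n). \<exists>z\<in>?B. d n w z < \<epsilon> n} \<noteq> {}"
        by (metis measure_empty less_irrefl)
      then obtain w z where w: "w \<in> points (W n)" "z \<in> ?B" "d n w z < \<epsilon> n" by blast
      have "d n w q \<le> d n w z + rdist Z z q"
        using d w q unfolding cross_metric_def by auto
      then have "d n (p n) q < 3 * h"
        using p(2)[OF w(1)] w elim by (auto simp: mdist_commute)
      then show ?case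
        using dpos[OF p(1)] h by (simp add: h_def)
    qed
  qed
  then show ?thesis using that p(1) by blast
qed

text \<open>The space \<open>V\<close> in the proof is the quotient of \<open>Z\<close> by the limit \<open>\<rho>\<close> of the pseudometrics that the
  distances of \<open>Ys n\<close> induce on the approximating points.\<close>

lemma summand_limit_subsequence:
  fixes Xs :: "nat \<Rightarrow> 'd mms" and Ys :: "nat \<Rightarrow> 'e mms"
  assumes X: "\<And>n. mm_space (Xs n)" and Y: "\<And>n. mm_space (Ys n)" and Z: "mm_space Z"
    and lim: "GPr_lim (\<lambda>n. Xs n \<boxplus> Ys n) Z"
  obtains s :: "nat \<Rightarrow> nat" and U :: "real mms" where "strict_mono s" "mm_space U" "GPr_lim (\<lambda>n. Ys (s n)) U"
proof -
  let ?W = "\<lambda>n. Xs n \<boxplus> Ys n"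
  have W: "mm_space (?W n)" for n by (rule mm_space_boxplus[OF X Y])
  define \<epsilon> where "\<epsilon> n = GPr_dist (?W n) Z + 1 / real (Suc n)" for n
  have \<epsilon>: "\<epsilon> \<longlonglongrightarrow> 0"
    using tendsto_add[OF lim[unfolded GPr_lim_def] LIMSEQ_Suc[OF lim_1_over_n]] by (simp add: \<epsilon>_def[abs_def])
  have "\<exists>d. cross_metric (fst (?W n)) (fst Z) d \<and> cross_dominates (?W n) Z d (\<epsilon> n) \<and> cross_dominates Z (?W n) (\<lambda>z w. d w z) (\<epsilon> n)" for n
    by (rule GPr_dist_less_cross[OF W Z, of n "\<epsilon> n"], simp add: \<epsilon>_def) blast
  then obtain d where d: "\<And>n. cross_metric (fst (?W n)) (fst Z) (d n)"
    and dom: "\<And>n. cross_dominates (?W n) Z (d n) (\<epsilon> n)" "\<And>n. cross_dominates Z (?W n) (\<lambda>z w. d n w z) (\<epsilon> n)"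
    by metis
  obtain q where dq: "dense_seq (fst Z) q" using mm_space_dense_seq[OF Z] .
  have q: "q i \<in> points Z" for i using dq by (simp add: dense_seq_def)
  have "\<exists>p. (\<forall>n. p n \<in> points (?W n)) \<and> (\<lambda>n. d n (p n) (q i)) \<longlonglongrightarrow> 0" for i
    by (rule dominated_points_approximable[OF W Z d dom(2) \<epsilon> q[of i]]) blast
  then obtain p where p: "\<And>i n. p i n \<in> points (?W n)" and pq: "\<And>i. (\<lambda>n. d n (p i n) (q i)) \<longlonglongrightarrow> 0"
    by metis
  define a where "a i j n = rdist (Ys n) (snd (p i n)) (snd (p j n))" for i j n
  have mW: "rdist (?W n) w w' = rdist (Xs n) (fst w) (fst w') + rdist (Ys n) (snd w) (snd w')" for n w w'
    by (simp add: boxplus_def case_prod_unfold)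
  \<comment> \<open>An upper bound for the distances in the summand, through the distances in the whole space.\<close>
  define b where "b i j n = d n (p i n) (q i) + rdist Z (q i) (q j) + d n (p j n) (q j)" for i j n
  have ab: "a i j n \<le> b i j n" for i j n
  proof -
    have "rdist (?W n) (p i n) (p j n) \<le> d n (p i n) (q j) + d n (p j n) (q j)"
      "d n (p i n) (q j) \<le> d n (p i n) (q i) + rdist Z (q i) (q j)"
      using d[of n] p[of i n] p[of j n] q[of i] q[of j] unfolding cross_metric_def by blast+
    then show ?thesis
      unfolding a_def b_def mW using mdist_nonneg[of "fst (Xs n)" "fst (p i n)" "fst (p j n)"] by linarith
  qed
  have b: "b i j \<longlonglongrightarrow> rdist Z (q i) (q j)" for i j
    using tendsto_add[OF tendsto_add[OF pq[of i] tendsto_const] pq[of j]] by (simp add: b_def[abs_def])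
  have bounded_a: "bounded (range (a i j))" for i j
  proof -
    have "bounded (range (b i j))" by (rule convergent_imp_bounded[OF b])
    then obtain B where B: "\<And>n. \<bar>b i j n\<bar> \<le> B" by (auto simp: bounded_iff)
    have "\<bar>a i j n\<bar> \<le> B" for n
    proof -
      have "0 \<le> a i j n" by (simp add: a_def)
      then show ?thesis using ab[of i j n] B[of n] by linarith
    qed
    then show ?thesis by (auto simp: bounded_iff)
  qed
  define Q where "Q k s \<longleftrightarrow> (\<exists>l. (\<lambda>n. a (fst (prod_decode k)) (snd (prod_decode k)) (s n)) \<longlonglongrightarrow> l)" for k and s :: "nat \<Rightarrow> nat"
  obtain s :: "nat \<Rightarrow> nat" where s: "strict_mono s" "\<And>k. Q k s"
  proof (rule diagonal_subsequence[of Q])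
    fix k and s :: "nat \<Rightarrow> nat"
    let ?a = "\<lambda>n. a (fst (prod_decode k)) (snd (prod_decode k)) (s n)"
    have "bounded (range ?a)"
      by (rule bounded_subset[OF bounded_a[of "fst (prod_decode k)" "snd (prod_decode k)"]]) auto
    then obtain l and r :: "nat \<Rightarrow> nat" where "strict_mono r" "(?a \<circ> r) \<longlonglongrightarrow> l"
      using bounded_imp_convergent_subsequence by blast
    then show "\<exists>r :: nat \<Rightarrow> nat. strict_mono r \<and> Q k (s \<circ> r)"
      unfolding Q_def by (auto simp: o_def)
  next
    fix k s and r :: "nat \<Rightarrow> nat" assume "strict_mono r" "Q k s"
    then show "Q k (s \<circ> r)"
      unfolding Q_def using LIMSEQ_subseq_LIMSEQ by (fastforce simp: o_def)
  next
    fix k s j assume "Q k (s \<circ> (+) j)"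
    then show "Q k s"
      unfolding Q_def using LIMSEQ_offset[where k = j] by (fastforce simp: add.commute[of j])
  qed blast
  have "\<exists>l. (\<lambda>n. a i j (s n)) \<longlonglongrightarrow> l" for i j
    using s(2)[of "prod_encode (i, j)"] by (simp add: Q_def)
  then obtain \<rho> where \<rho>: "\<And>i j. (\<lambda>n. a i j (s n)) \<longlonglongrightarrow> \<rho> i j"
    by metis
  have pY: "snd (p i n) \<in> points (Ys n)" for i n
    using p[of i n] by (auto simp: boxplus_def)
  have \<rho>_refl: "\<rho> i i = 0" for i
  proof (rule LIMSEQ_unique[OF \<rho>])
    show "(\<lambda>n. a i i (s n)) \<longlonglongrightarrow> 0" by (simp add: a_def mdist_self pY)
  qed
  have \<rho>_sym: "\<rho> i j = \<rho> j i" for i j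
    by (rule LIMSEQ_unique[OF \<rho>]) (use \<rho>[of j i] in \<open>simp add: a_def mdist_commute\<close>)
  have \<rho>_tri: "\<rho> i k \<le> \<rho> i j + \<rho> j k" for i j k
    by (rule LIMSEQ_le[OF \<rho> tendsto_add[OF \<rho> \<rho>]])
      (auto simp: a_def intro!: mdist_triangle pY)
  have \<rho>_le: "\<rho> i j \<le> rdist Z (q i) (q j)" for i j
    by (rule LIMSEQ_le[OF \<rho> LIMSEQ_subseq_LIMSEQ[OF b s(1)]]) (auto simp: ab)
  obtain S :: "(nat \<Rightarrow> real) metric" and e where S: "mcomplete_of S" and e: "dense_seq S e"
    and dist_e: "\<And>i j. mdist S (e i) (e j) = \<rho> i j"
  proof (rule pseudo_metric_completion[of \<rho>, OF \<rho>_refl \<rho>_sym \<rho>_tri])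
    fix S :: "(nat \<Rightarrow> real) metric" and e
    assume "mcomplete_of S" "dense_seq S e" "\<And>i j. mdist S (e i) (e j) = \<rho> i j"
    then show ?thesis by (rule that)
  qed
  have eS: "e i \<in> mspace S" for i using e by (simp add: dense_seq_def)
  have short_e: "mdist S (e i) (e j) \<le> rdist Z (q i) (q j)" for i j
    using \<rho>_le dist_e by simp
  obtain \<Phi> where \<Phi>: "\<Phi> \<in> points Z \<rightarrow> mspace S" "\<And>i. \<Phi> (q i) = e i"
    "\<And>u v. u \<in> points Z \<Longrightarrow> v \<in> points Z \<Longrightarrow> mdist S (\<Phi> u) (\<Phi> v) \<le> rdist Z u v"
  proof (rule short_map_extension[where s = e, OF dq S eS short_e])
    fix f assume "f \<in> points Z \<rightarrow> mspace S" "\<And>i. f (q i) = e i"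
      "\<And>u v. u \<in> points Z \<Longrightarrow> v \<in> points Z \<Longrightarrow> mdist S (f u) (f v) \<le> rdist Z u v"
    then show ?thesis by (rule that)
  qed
  define V where "V = (S, distr (snd Z) (metric_borel S) \<Phi>)"
  have V: "mm_space V"
    unfolding V_def
  proof (rule mm_space_image[OF Z S \<Phi>(1) \<Phi>(3)])
    fix t and \<eta> :: real assume "t \<in> mspace S" "\<eta> > 0"
    then obtain i where "mdist S t (e i) < \<eta>" using e unfolding dense_seq_def by blast
    then show "\<exists>x\<in>points Z. mdist S t (\<Phi> x) < \<eta>"
      using q \<Phi>(2) by metis
  qed
  have \<Phi>_m: "\<Phi> \<in> measurable (snd Z) (snd V)"
    using short_map_measurable[OF \<Phi>(1) \<Phi>(3)] measurable_cong_sets[OF mm_spaceD(5)[OF Z], of "snd V" "metric_borel S"]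
    by (auto simp: V_def)
  have \<Phi>_d: "distr (snd Z) (snd V) \<Phi> = snd V"
    unfolding V_def by (simp cong: distr_cong)
  have snd_m: "snd \<in> measurable (snd (?W n)) (snd (Ys n))" for n
    by (simp add: boxplus_def)
  have limV: "(\<lambda>n. GPr_dist (Ys (s n)) V) \<longlonglongrightarrow> 0"
  proof (rule tendstoI)
    fix \<eta>' :: real assume "\<eta>' > 0"
    \<comment> \<open>Any constant above the \<open>6\<close> of \<open>short_images_close\<close> gives a strict inequality.\<close>
    define \<eta> where "\<eta> = \<eta>' / 7"
    have \<eta>: "\<eta> > 0" using \<open>\<eta>' > 0\<close> by (simp add: \<eta>_def)
    obtain K :: nat where K: "mass Z (points Z - (\<Union>i<K. rball Z (q i) \<eta>)) < \<eta>"
      using mm_space_net[OF Z dq \<eta> \<eta>] .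
    interpret Z: prob_space "snd Z" using Z by (rule mm_spaceD)
    \<comment> \<open>Including the index \<open>K\<close> makes the index set nonempty.\<close>
    have net: "mass Z (points Z - (\<Union>i\<le>K. rball Z (q i) \<eta>)) < \<eta>"
    proof (rule le_less_trans[OF Z.finite_measure_mono K])
      show "points Z - (\<Union>i<K. rball Z (q i) \<eta>) \<in> sets (snd Z)"
        using mm_space_ball_sets[OF Z] mm_spaceD(4)[OF Z] by (metis sets.Diff sets.finite_UN finite_lessThan sets.top)
    qed auto
    have ev1: "eventually (\<lambda>n. \<epsilon> (s n) < \<eta>) sequentially"
      using order_tendstoD(2)[OF LIMSEQ_subseq_LIMSEQ[OF \<epsilon> s(1)] \<eta>] by simp
    have ev2: "eventually (\<lambda>n. \<forall>i\<in>{..K}. d (s n) (p i (s n)) (q i) < \<eta>) sequentially"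
      using order_tendstoD(2)[OF LIMSEQ_subseq_LIMSEQ[OF pq s(1)] \<eta>] by (intro eventually_ball_finite) auto
    have ev3: "eventually (\<lambda>n. \<forall>i\<in>{..K}. \<forall>j\<in>{..K}. \<bar>a i j (s n) - \<rho> i j\<bar> \<le> 2 * \<eta>) sequentially"
    proof (intro eventually_ball_finite ballI)
      fix i j
      have "eventually (\<lambda>n. dist (a i j (s n)) (\<rho> i j) < 2 * \<eta>) sequentially"
        using tendstoD[OF \<rho>] \<eta> by simp
      then show "eventually (\<lambda>n. \<bar>a i j (s n) - \<rho> i j\<bar> \<le> 2 * \<eta>) sequentially"
        by eventually_elim (simp add: dist_real_def)
    qed auto
    show "eventually (\<lambda>n. dist (GPr_dist (Ys (s n)) V) 0 < \<eta>') sequentially"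
      using ev1 ev2 ev3
    proof eventually_elim
      case (elim n)
      have "GPr_dist (Ys (s n)) V \<le> 6 * \<eta>"
      proof (rule short_images_close[OF W Z Y V d dom _ \<eta> snd_m distr_snd_boxplus[OF X Y] _ \<Phi>_m \<Phi>_d])
        show "\<epsilon> (s n) \<le> \<eta>" using elim by simp
        show "mdist (fst (Ys (s n))) (snd w) (snd w') \<le> mdist (fst (?W (s n))) w w'" for w w'
          by (simp add: mW)
        show "rdist V (\<Phi> z) (\<Phi> z') \<le> rdist Z z z'" if "z \<in> points Z" "z' \<in> points Z" for z z'
          using \<Phi>(3)[OF that] by (simp add: V_def)
        show "mass Z (points Z - (\<Union>i\<in>{..K}. rball Z (q i) \<eta>)) < \<eta>"
          by (rule net)
        show "p i (s n) \<in> mspace (fst (?W (s n)))" for i by (rule p)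
        show "q i \<in> points Z" for i by (rule q)
        show "d (s n) (p i (s n)) (q i) < \<eta>" if "i \<in> {..K}" for i
          using elim that by blast
        show "\<bar>mdist (fst (Ys (s n))) (snd (p i (s n))) (snd (p j (s n))) - rdist V (\<Phi> (q i)) (\<Phi> (q j))\<bar> \<le> 2 * \<eta>"
          if "i \<in> {..K}" "j \<in> {..K}" for i j
          using elim(3) that by (simp add: V_def \<Phi>(2) dist_e a_def)
      qed auto
      then show ?case
        using GPr_dist_nonneg[OF Y V, of "s n"] \<eta> by (simp add: \<eta>_def)
    qed
  qed
  obtain U :: "real mms" where U: "mm_space U" "U \<simeq>\<^sub>m V"
    by (rule mm_space_real_representative[OF V])
  have "(\<lambda>n. GPr_dist (Ys (s n)) U) \<longlonglongrightarrow> 0"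
    by (rule real_tendsto_sandwich[OF _ _ tendsto_const limV])
      (auto intro!: always_eventually GPr_dist_nonneg[OF Y U(1)] GPr_dist_iso_le[OF Y U(1) V U(2)])
  then have "GPr_lim (\<lambda>n. Ys (s n)) U" by (simp add: GPr_lim_def)
  then show ?thesis using that s(1) U(1) by blast
qed

section \<open>Cancellation and limits\<close>

text \<open>With \<open>GPr_dist_iso_le\<close> this places isomorphic spaces at distance \<open>0\<close>.\<close>

lemma GPr_dist_self:
  assumes X: "mm_space X"
  shows "GPr_dist X X = 0"
proof (rule antisym)
  interpret prob_space "snd X" using X by (rule mm_spaceD)
  have d: "cross_metric (fst X) (fst X) (rdist X)"
    using cross_metric_embed[of "fst X" "fst X" id "fst X" id] by (simp add: isometric_embedding_def)
  have "GPr_dist X X \<le> 0 + e" if "e > 0" for e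
  proof -
    have dom: "cross_dominates X X (rdist X) e"
      unfolding cross_dominates_def
    proof
      fix A assume A: "A \<in> sets (snd X)"
      then have AX: "A \<subseteq> points X"
        using sets.sets_into_space mm_spaceD(4)[OF X] by blast
      have "mass X A \<le> mass X {y \<in> points X. \<exists>x\<in>A. rdist X x y < e}"
        using AX \<open>e > 0\<close> by (intro finite_measure_mono cross_nbhd_sets[OF X d]) (force simp: mdist_self)+
      then show "mass X A \<le> mass X {y \<in> points X. \<exists>x\<in>A. rdist X x y < e} + e"
        using \<open>e > 0\<close> by simp
    qed
    have "GPr_dist X X \<le> e"
      using dom by (intro GPr_dist_le_cross[OF X X d dom _ that]) (simp add: mdist_commute)
    then show ?thesis by simp
  qed
  then show "GPr_dist X X \<le> 0" by (rule field_le_epsilon)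
qed (rule GPr_dist_nonneg[OF X X])

text \<open>The constant sequence \<open>Y\<close> converges to \<open>X\<close>, so this is a case of continuity.\<close>

lemma semichar_iso:
  assumes X: "mm_space X" and Y: "mm_space Y" and iso: "X \<simeq>\<^sub>m Y" and es: "on_vertices k es"
  shows "semichar X k es = semichar Y k es"
proof -
  have "GPr_dist Y X = 0"
    using GPr_dist_iso_le[OF Y X Y iso] GPr_dist_self[OF Y] GPr_dist_nonneg[OF Y X] by simp
  then have "GPr_lim (\<lambda>_. Y) X" by (simp add: GPr_lim_def)
  from semichar_tendsto[OF Y X this es] show ?thesis
    by (simp add: LIMSEQ_const_iff)
qed

lemma boxplus_left_cancel:
  assumes Y: "mm_space Y" and A: "mm_space A" and B: "mm_space B"
    and eq: "\<And>k es. on_vertices k es \<Longrightarrow> semichar Y k es * semichar A k es = semichar Y k es * semichar B k es"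
  shows "A \<simeq>\<^sub>m B"
proof (rule semichar_eq_imp_iso[OF A B])
  fix k es assume es: "set es \<subseteq> {..<k} \<times> {..<k :: nat}"
  show "semichar A k es = semichar B k es"
    using eq[OF es] semichar_pos[OF Y es] by simp
qed

lemma LIMSEQ_if_subsubsequences:
  fixes a :: "nat \<Rightarrow> real"
  assumes "\<And>s :: nat \<Rightarrow> nat. strict_mono s \<Longrightarrow> \<exists>r :: nat \<Rightarrow> nat. strict_mono r \<and> (\<lambda>n. a (s (r n))) \<longlonglongrightarrow> l"
  shows "a \<longlonglongrightarrow> l"
proof (rule ccontr)
  assume "\<not> a \<longlonglongrightarrow> l"
  then obtain e where e: "e > 0" "\<And>N. \<exists>n\<ge>N. e \<le> dist (a n) l"
    unfolding lim_sequentially by (meson not_less)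
  then have "infinite {n. e \<le> dist (a n) l}"
    by (auto simp: infinite_nat_iff_unbounded_le)
  then obtain s :: "nat \<Rightarrow> nat" where s: "strict_mono s" "\<And>n. s n \<in> {n. e \<le> dist (a n) l}"
    using infinite_enumerate by blast
  then obtain r :: "nat \<Rightarrow> nat" where "(\<lambda>n. a (s (r n))) \<longlonglongrightarrow> l"
    using assms by blast
  then obtain n where "dist (a (s (r n))) l < e"
    using e(1) unfolding lim_sequentially by blast
  then show False using s(2)[of "r n"] by simp
qed

lemma GPr_lim_subsequence: "GPr_lim Xs X \<Longrightarrow> strict_mono s \<Longrightarrow> GPr_lim (\<lambda>n. Xs (s n)) X"
  unfolding GPr_lim_def using LIMSEQ_subseq_LIMSEQ by (fastforce simp: o_def)

lemma semichar_summand_limit: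
  assumes X: "\<And>n. mm_space (Xs n)" "mm_space X" and Y: "\<And>n. mm_space (Ys n)" "mm_space U" and Z: "mm_space Z"
    and lim: "GPr_lim Xs X" "GPr_lim (\<lambda>n. Xs n \<boxplus> Ys n) Z" "GPr_lim Ys U"
    and es: "on_vertices k es"
  shows "semichar Z k es = semichar X k es * semichar U k es"
proof (rule LIMSEQ_unique)
  show "(\<lambda>n. semichar (Xs n \<boxplus> Ys n) k es) \<longlonglongrightarrow> semichar Z k es"
    by (rule semichar_tendsto[OF mm_space_boxplus[OF X(1) Y(1)] Z lim(2) es])
  show "(\<lambda>n. semichar (Xs n \<boxplus> Ys n) k es) \<longlonglongrightarrow> semichar X k es * semichar U k es"
    unfolding semichar_boxplus[OF X(1) Y(1) es]
    by (intro tendsto_mult semichar_tendsto[OF X lim(1) es] semichar_tendsto[OF Y lim(3) es])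
qed

lemma summand_limit:
  fixes Xs :: "nat \<Rightarrow> 'd mms" and Ys :: "nat \<Rightarrow> 'e mms"
  assumes X: "\<And>n. mm_space (Xs n)" "mm_space X" and Y: "\<And>n. mm_space (Ys n)" and Z: "mm_space Z"
    and lim: "GPr_lim Xs X" "GPr_lim (\<lambda>n. Xs n \<boxplus> Ys n) Z"
  shows "\<exists>U :: real mms. mm_space U \<and> GPr_lim Ys U \<and> Z \<simeq>\<^sub>m X \<boxplus> U"
proof -
  have sub: "\<exists>(r :: nat \<Rightarrow> nat) U :: real mms. strict_mono r \<and> mm_space U \<and> GPr_lim (\<lambda>n. Ys (s (r n))) U \<and>
      (\<forall>k es. on_vertices k es \<longrightarrow> semichar Z k es = semichar X k es * semichar U k es)"
    if s: "strict_mono s" for s :: "nat \<Rightarrow> nat"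
  proof -
    obtain r :: "nat \<Rightarrow> nat" and U :: "real mms" where r: "strict_mono r" "mm_space U" "GPr_lim (\<lambda>n. Ys (s (r n))) U"
      by (rule summand_limit_subsequence[OF X(1) Y Z GPr_lim_subsequence[OF lim(2) s]])
    have sr: "strict_mono (\<lambda>n. s (r n))"
      using strict_mono_o[OF s r(1)] by (simp add: o_def)
    have "semichar Z k es = semichar X k es * semichar U k es" if "on_vertices k es" for k es
      by (rule semichar_summand_limit[OF X(1,2) Y r(2) Z GPr_lim_subsequence[OF lim(1) sr]
          GPr_lim_subsequence[OF lim(2) sr] r(3) that])
    then show ?thesis using r by blast
  qed
  obtain U :: "real mms" where U: "mm_space U"
    and ZU: "\<And>k es. on_vertices k es \<Longrightarrow> semichar Z k es = semichar X k es * semichar U k es"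
    using sub[OF strict_mono_id] by blast
  have "(\<lambda>n. GPr_dist (Ys n) U) \<longlonglongrightarrow> 0"
  proof (rule LIMSEQ_if_subsubsequences)
    fix s :: "nat \<Rightarrow> nat" assume "strict_mono s"
    then obtain r :: "nat \<Rightarrow> nat" and U' :: "real mms" where r: "strict_mono r" and U': "mm_space U'"
      and lim': "GPr_lim (\<lambda>n. Ys (s (r n))) U'"
      and ZU': "\<And>k es. on_vertices k es \<Longrightarrow> semichar Z k es = semichar X k es * semichar U' k es"
      using sub by blast
    have "U \<simeq>\<^sub>m U'"
      using ZU ZU' by (intro boxplus_left_cancel[OF X(2) U U']) metis
    then have le: "GPr_dist (Ys n) U \<le> GPr_dist (Ys n) U'" for n
      by (rule GPr_dist_iso_le[OF Y U U'])
    have "(\<lambda>n. GPr_dist (Ys (s (r n))) U) \<longlonglongrightarrow> 0"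
      by (rule real_tendsto_sandwich[OF _ _ tendsto_const lim'[unfolded GPr_lim_def]])
        (auto intro!: always_eventually GPr_dist_nonneg[OF Y U] le)
    then show "\<exists>r :: nat \<Rightarrow> nat. strict_mono r \<and> (\<lambda>n. GPr_dist (Ys (s (r n))) U) \<longlonglongrightarrow> 0"
      using r by blast
  qed
  then have "GPr_lim Ys U" by (simp add: GPr_lim_def)
  moreover have "Z \<simeq>\<^sub>m X \<boxplus> U"
    by (rule semichar_eq_imp_iso[OF Z mm_space_boxplus[OF X(2) U]])
      (simp add: ZU semichar_boxplus[OF X(2) U])
  ultimately show ?thesis using U by blast
qed

theorem proposition3p6:
  fixes Y :: "'a mms" and Z' :: "'b mms" and Z'' :: "'c mms"
    and Xs :: "nat \<Rightarrow> 'd mms" and Ys :: "nat \<Rightarrow> 'e mms"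
    and X :: "'f mms" and Z :: "'g mms"
  shows "(mm_space Y \<and> mm_space Z' \<and> mm_space Z'' \<longrightarrow>
            (Y \<boxplus> Z' \<simeq>\<^sub>m Y \<boxplus> Z'' \<longrightarrow> Z' \<simeq>\<^sub>m Z'') \<and>
            (Y \<boxplus> Z' \<le>\<^sub>m Y \<boxplus> Z'' \<longrightarrow> Z' \<le>\<^sub>m Z''))
       \<and> ((\<forall>n. mm_space (Xs n)) \<and> (\<forall>n. mm_space (Ys n)) \<and> mm_space X \<and> mm_space Z \<and>
            GPr_lim Xs X \<and> GPr_lim (\<lambda>n. Xs n \<boxplus> Ys n) Z \<longrightarrow>
          (\<exists>\<Y> :: real mms. mm_space \<Y> \<and> GPr_lim Ys \<Y> \<and> Z \<simeq>\<^sub>m X \<boxplus> \<Y>))"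
proof (intro conjI impI)
  assume "mm_space Y \<and> mm_space Z' \<and> mm_space Z''"
  then have Y: "mm_space Y" and Z': "mm_space Z'" and Z'': "mm_space Z''" by auto
  {
    assume "Y \<boxplus> Z' \<simeq>\<^sub>m Y \<boxplus> Z''"
    from semichar_iso[OF mm_space_boxplus[OF Y Z'] mm_space_boxplus[OF Y Z''] this]
    show "Z' \<simeq>\<^sub>m Z''"
      by (intro boxplus_left_cancel[OF Y Z' Z'']) (simp add: semichar_boxplus[OF Y Z'] semichar_boxplus[OF Y Z''])
  next
    assume "Y \<boxplus> Z' \<le>\<^sub>m Y \<boxplus> Z''"
    then obtain U :: "real mms" where U: "mm_space U" and iso: "Y \<boxplus> Z'' \<simeq>\<^sub>m Y \<boxplus> Z' \<boxplus> U"
      by (auto simp: mm_le_def)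
    note YZ' = mm_space_boxplus[OF Y Z'] and ZU = mm_space_boxplus[OF Z' U]
    have "Z'' \<simeq>\<^sub>m Z' \<boxplus> U"
    proof (rule boxplus_left_cancel[OF Y Z'' ZU])
      fix k es assume es: "set es \<subseteq> {..<k} \<times> {..<k :: nat}"
      show "semichar Y k es * semichar Z'' k es = semichar Y k es * semichar (Z' \<boxplus> U) k es"
        using semichar_iso[OF mm_space_boxplus[OF Y Z''] mm_space_boxplus[OF YZ' U] iso es]
        by (simp add: semichar_boxplus[OF Y Z'' es] semichar_boxplus[OF YZ' U es]
            semichar_boxplus[OF Y Z' es] semichar_boxplus[OF Z' U es])
    qed
    then show "Z' \<le>\<^sub>m Z''"
      using U unfolding mm_le_def by blast
  }
next
  assume "(\<forall>n. mm_space (Xs n)) \<and> (\<forall>n. mm_space (Ys n)) \<and> mm_space X \<and> mm_space Z \<and>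
    GPr_lim Xs X \<and> GPr_lim (\<lambda>n. Xs n \<boxplus> Ys n) Z"
  then show "\<exists>\<Y> :: real mms. mm_space \<Y> \<and> GPr_lim Ys \<Y> \<and> Z \<simeq>\<^sub>m X \<boxplus> \<Y>"
    by (intro summand_limit[of Xs X Ys Z]) auto
qed

end
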